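(* Let $d\ge 2$, $\alpha\ge0$, $\rho>0$ and $\nu\in\mathcal V_\alpha^+\cup\mathcal V_\alpha$. Then the limit $$\chi(\rho,\nu):=\lim_{\beta\to+\infty}\beta^{-\frac{\alpha+1}{\alpha+1+d}}\ln c_c(\beta,\rho,\nu)$$ exists and equals $-\big(\lambda_c^*(\alpha)\,C_\nu^{\alpha+1}/\rho\big)^{\frac1{\alpha+1+d}}$.
   Context: $\Omega$ is the space of sets $\omega=\{(x_i,E_{x_i})\}\subset\mathbb R^d\times\mathbb R$ such that $\widehat\omega:=\{x_i\}$ is a locally finite subset of $\mathbb R^d$ (each $x\in\widehat\omega$ carries exactly one mark $E_x$). $\mathrm{PPP}[\rho,\nu]$ denotes the homogeneous Poisson point process on $\mathbb R^d$ with intensity $\rho$ whose points are marked by i.i.d. real random variables with common law $\nu$ (independent of the points); the same symbol denotes its law on $\Omega$. Graph $\mathcal G[\zeta,\beta](\omega)$: for $\omega\in\Omega$, $\zeta,\beta>0$, it has vertex set $\widehat\omega$ and an edge $\{x,y\}$ for each $x\neq y$ in $\widehat\omega$ with $|x-y|+\beta(|E_x|+|E_y|+|E_x-E_y|)\le\zeta$. It percolates if it has an unbounded connected component. Critical threshold and conductance: $\theta(\zeta,\beta,\rho,\nu):=\mathrm{PPP}[\rho,\nu](\mathcal G[\zeta,\beta]\text{ percolates})\in\{0,1\}$; $\zeta_c(\beta,\rho,\nu)\in(0,+\infty)$ is the value such that $\theta(\zeta,\beta,\rho,\nu)=1$ for $\zeta>\zeta_c(\beta,\rho,\nu)$ and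 $\theta(\zeta,\beta,\rho,\nu)=0$ for $\zeta<\zeta_c(\beta,\rho,\nu)$ (it exists for $d\ge2$); $c_c(\beta,\rho,\nu):=\exp\{-\zeta_c(\beta,\rho,\nu)\}$. For $C>0$, $\alpha\ge0$: $\nu^+_{C,\alpha}(dE)=\frac{\alpha+1}{C^{\alpha+1}}E^\alpha\mathbf 1_{[0,C]}(E)\,dE$ and $\nu_{C,\alpha}(dE)=\frac{\alpha+1}{2C^{\alpha+1}}|E|^\alpha\mathbf 1_{[-C,C]}(E)\,dE$. Classes: $\nu\in\mathcal V_\alpha^+$ (resp. $\nu\in\mathcal V_\alpha$) if $\nu$ is a probability measure on $\mathbb R$ and there are $\varepsilon_\nu,C_\nu>0$ with $\nu(B)=\nu^+_{C_\nu,\alpha}(B)$ (resp. $\nu(B)=\nu_{C_\nu,\alpha}(B)$) for every Borel $B\subset[-\varepsilon_\nu,\varepsilon_\nu]$; such constants are fixed. Critical intensities: $\lambda_c^+(\alpha)\in(0,+\infty)$ is the value such that $\mathcal G[1,1]$ under $\mathrm{PPP}[\lambda,\nu^+_{1,\alpha}]$ a.s. percolates if $\lambda>\lambda_c^+(\alpha)$ and a.s. does not percolate if $\lambda<\lambda_c^+(\alpha)$; $\lambda_c(\alpha)\in(0,+\infty)$ is defined in the same way with $\nu_{1,\alpha}$ in place of $\nu^+_{1,\alpha}$. Set $\lambda_c^*(\alpha):=\lambda_c^+(\alpha)$ if $\nu\in\mathcal V_\alpha^+$ and $\lambda_c^*(\alpha):=\lambda_c(\alpha)$ if $\nu\in\mathcal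 V_\alpha$. *)

theory Defs
  imports "HOL-Probability.Probability"
begin

definition locally_finite_set :: "'a::metric_space set \<Rightarrow> bool" where
  "locally_finite_set S \<longleftrightarrow> (\<forall>B. bounded B \<longrightarrow> finite (S \<inter> B))"

text \<open>Injectivity of \<open>fst\<close> says that each point carries exactly one mark.\<close>

definition configs :: "((real ^ 'n) \<times> real) set set" where
  "configs = {\<omega>. inj_on fst \<omega> \<and> locally_finite_set (fst ` \<omega>)}"

text \<open>The standard \<sigma>-algebra on configurations, generated by the counting variables. The
  counting sets are bounded, so that \<open>\<omega> \<inter> A\<close> is finite and \<open>card\<close> is the true number of points.\<close>

definition config_space :: "((real ^ 'n) \<times> real) set measure" where
  "config_space = sigma configs
     {{\<omega> \<in> configs. card (\<omega> \<inter> A) = k} | A k. A \<in> sets borel \<and> bounded A}"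

definition mark :: "((real ^ 'n) \<times> real) set \<Rightarrow> real ^ 'n \<Rightarrow> real" where
  "mark \<omega> x = (THE e. (x, e) \<in> \<omega>)"

definition graph_edges ::
  "real \<Rightarrow> real \<Rightarrow> ((real ^ 'n) \<times> real) set \<Rightarrow> ((real ^ 'n) \<times> (real ^ 'n)) set" where
  "graph_edges \<zeta> \<beta> \<omega> = {(x, y). x \<in> fst ` \<omega> \<and> y \<in> fst ` \<omega> \<and> x \<noteq> y \<and>
     norm (x - y) + \<beta> * (\<bar>mark \<omega> x\<bar> + \<bar>mark \<omega> y\<bar> + \<bar>mark \<omega> x - mark \<omega> y\<bar>) \<le> \<zeta>}"

definition component ::
  "real \<Rightarrow> real \<Rightarrow> ((real ^ 'n) \<times> real) set \<Rightarrow> real ^ 'n \<Rightarrow> (real ^ 'n) set" where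
  "component \<zeta> \<beta> \<omega> x = {y. (x, y) \<in> (graph_edges \<zeta> \<beta> \<omega>)\<^sup>*}"

definition percolates :: "real \<Rightarrow> real \<Rightarrow> ((real ^ 'n) \<times> real) set \<Rightarrow> bool" where
  "percolates \<zeta> \<beta> \<omega> \<longleftrightarrow> (\<exists>x \<in> fst ` \<omega>. \<not> bounded (component \<zeta> \<beta> \<omega> x))"

text \<open>A random locally finite set \<open>\<eta>\<close> on the probability space \<open>M\<close> is a homogeneous Poisson point
  process of intensity \<open>\<rho>\<close>. The Poisson weights are written out so that null sets \<open>B\<close>
  (parameter 0) are included.\<close>

definition poisson_process ::
  "'s measure \<Rightarrow> real \<Rightarrow> ('s \<Rightarrow> (real ^ 'n) set) \<Rightarrow> bool" where
  "poisson_process M \<rho> \<eta> \<longleftrightarrow>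
     prob_space M \<and>
     (\<forall>s \<in> space M. locally_finite_set (\<eta> s)) \<and>
     (\<forall>B k. B \<in> sets borel \<longrightarrow> bounded B \<longrightarrow>
        measure M {s \<in> space M. card (\<eta> s \<inter> B) = k} =
          (\<rho> * measure lborel B) ^ k / fact k * exp (- (\<rho> * measure lborel B))) \<and>
     (\<forall>(B :: nat \<Rightarrow> (real ^ 'n) set) m.
        (\<forall>i < m. B i \<in> sets borel \<and> bounded (B i)) \<longrightarrow> disjoint_family_on B {..<m} \<longrightarrow>
        prob_space.indep_vars M (\<lambda>_. count_space UNIV) (\<lambda>i s. card (\<eta> s \<inter> B i)) {..<m})"

text \<open>Injective enumerations \<open>x\<^sub>0, x\<^sub>1, \<dots>\<close> of infinite locally finite sets.\<close>

definition enumeration_space :: "(nat \<Rightarrow> real ^ 'n) measure" where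
  "enumeration_space = restrict_space (\<Pi>\<^sub>M i \<in> (UNIV :: nat set). borel)
     {x. inj x \<and> locally_finite_set (range x)}"

text \<open>\<open>P\<close> is the law of \<open>{(x\<^sub>i, E\<^sub>i)}\<close>, where the set \<open>{x\<^sub>i}\<close> is a Poisson point process of
  intensity \<open>\<rho>\<close> and the marks \<open>E\<^sub>i\<close> are i.i.d. with law \<open>\<nu>\<close> and independent of the points (hence
  the product measure). For \<open>\<rho> > 0\<close>, the only case used, the process is almost surely infinite,
  so its points can be enumerated by the natural numbers.\<close>

definition is_PPP :: "real \<Rightarrow> real measure \<Rightarrow> ((real ^ 'n) \<times> real) set measure \<Rightarrow> bool" where
  "is_PPP \<rho> \<nu> P \<longleftrightarrow>
     (\<exists>Q :: (nat \<Rightarrow> real ^ 'n) measure.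
        sets Q = sets enumeration_space \<and> poisson_process Q \<rho> range \<and>
        P = distr (Q \<Otimes>\<^sub>M (\<Pi>\<^sub>M i \<in> (UNIV :: nat set). \<nu>)) config_space
              (\<lambda>(x, e). range (\<lambda>i. (x i, e i))))"

definition PPP :: "real \<Rightarrow> real measure \<Rightarrow> ((real ^ 'n) \<times> real) set measure" where
  "PPP \<rho> \<nu> = (THE P. is_PPP \<rho> \<nu> P)"

text \<open>The type argument carries the dimension \<open>d = CARD('n)\<close>.\<close>

definition perc_prob :: "'n::finite itself \<Rightarrow> real \<Rightarrow> real \<Rightarrow> real \<Rightarrow> real measure \<Rightarrow> real" where
  "perc_prob _ \<zeta> \<beta> \<rho> \<nu> =
     (let P = PPP \<rho> \<nu> :: ((real ^ 'n) \<times> real) set measure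
      in measure P {\<omega> \<in> space P. percolates \<zeta> \<beta> \<omega>})"

definition zeta_c :: "'n::finite itself \<Rightarrow> real \<Rightarrow> real \<Rightarrow> real measure \<Rightarrow> real" where
  "zeta_c d \<beta> \<rho> \<nu> = (THE z. 0 < z \<and>
     (\<forall>\<zeta> > z. perc_prob d \<zeta> \<beta> \<rho> \<nu> = 1) \<and>
     (\<forall>\<zeta>. 0 < \<zeta> \<longrightarrow> \<zeta> < z \<longrightarrow> perc_prob d \<zeta> \<beta> \<rho> \<nu> = 0))"

definition c_c :: "'n::finite itself \<Rightarrow> real \<Rightarrow> real \<Rightarrow> real measure \<Rightarrow> real" where
  "c_c d \<beta> \<rho> \<nu> = exp (- zeta_c d \<beta> \<rho> \<nu>)"

definition nu_plus :: "real \<Rightarrow> real \<Rightarrow> real measure" where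
  "nu_plus C \<alpha> = density lborel
     (\<lambda>E. ennreal ((\<alpha> + 1) / C powr (\<alpha> + 1) * E powr \<alpha> * indicator {0..C} E))"

definition nu_sym :: "real \<Rightarrow> real \<Rightarrow> real measure" where
  "nu_sym C \<alpha> = density lborel
     (\<lambda>E. ennreal ((\<alpha> + 1) / (2 * C powr (\<alpha> + 1)) * \<bar>E\<bar> powr \<alpha> * indicator {-C..C} E))"

definition agree_near_0 :: "real \<Rightarrow> real measure \<Rightarrow> real measure \<Rightarrow> bool" where
  "agree_near_0 \<epsilon> \<nu> \<mu> \<longleftrightarrow> (\<forall>B \<in> sets borel. B \<subseteq> {-\<epsilon>..\<epsilon>} \<longrightarrow> emeasure \<nu> B = emeasure \<mu> B)"

definition V_plus :: "real \<Rightarrow> real measure set" where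
  "V_plus \<alpha> = {\<nu>. prob_space \<nu> \<and> sets \<nu> = sets borel \<and>
     (\<exists>\<epsilon> > 0. \<exists>C > 0. agree_near_0 \<epsilon> \<nu> (nu_plus C \<alpha>))}"

definition V_sym :: "real \<Rightarrow> real measure set" where
  "V_sym \<alpha> = {\<nu>. prob_space \<nu> \<and> sets \<nu> = sets borel \<and>
     (\<exists>\<epsilon> > 0. \<exists>C > 0. agree_near_0 \<epsilon> \<nu> (nu_sym C \<alpha>))}"

definition critical_intensity :: "'n::finite itself \<Rightarrow> real measure \<Rightarrow> real" where
  "critical_intensity _ \<mu> = (THE l. 0 < l \<and>
     (\<forall>r > l. AE \<omega> in (PPP r \<mu> :: ((real ^ 'n) \<times> real) set measure). percolates 1 1 \<omega>) \<and>
     (\<forall>r. 0 < r \<longrightarrow> r < l \<longrightarrow>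
        (AE \<omega> in (PPP r \<mu> :: ((real ^ 'n) \<times> real) set measure). \<not> percolates 1 1 \<omega>)))"

definition lambda_c_plus :: "'n::finite itself \<Rightarrow> real \<Rightarrow> real" where
  "lambda_c_plus d \<alpha> = critical_intensity d (nu_plus 1 \<alpha>)"

definition lambda_c :: "'n::finite itself \<Rightarrow> real \<Rightarrow> real" where
  "lambda_c d \<alpha> = critical_intensity d (nu_sym 1 \<alpha>)"

text \<open>Used for \<open>\<nu>\<close> in \<open>V_plus \<alpha> \<union> V_sym \<alpha>\<close> only; the two classes are disjoint, as they
  prescribe different masses for \<open>[-\<epsilon>, 0)\<close>.\<close>

definition lambda_c_star :: "'n::finite itself \<Rightarrow> real \<Rightarrow> real measure \<Rightarrow> real" where
  "lambda_c_star d \<alpha> \<nu> = (if \<nu> \<in> V_plus \<alpha> then lambda_c_plus d \<alpha> else lambda_c d \<alpha>)"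

end

theory Submission
  imports Defs
begin

text \<open>Only marks of size at most \<open>\<zeta> / \<beta>\<close> can occur on edges of the graph with parameters \<open>\<zeta>\<close>, \<open>\<beta>\<close>,
  and near \<open>0\<close> the mark law is a multiple of the self-similar reference law. Discarding the larger
  marks and rescaling positions by \<open>\<zeta>\<close> and marks by \<open>\<zeta> / \<beta>\<close> therefore turns the process into the
  reference process with intensity \<open>\<rho> \<zeta>\<^bsup>\<alpha>+1+d\<^esup> / (\<beta> C)\<^bsup>\<alpha>+1\<^esup>\<close> and the graph into the one with unit
  parameters, so \<open>\<zeta>\<^sub>c\<close> is given by an exact formula as soon as \<open>\<beta>\<close> is large.

  The marked Poisson process is identified by its void probabilities (Renyi): the events of having
  no point in a given set are stable under intersection and generate the whole \<sigma>-algebra. The same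
  principle yields the zero-one law, since void events on a bounded region are independent of
  percolation, which ignores what happens in bounded regions. The critical intensity is positive by
  counting paths of occupied unit cubes, and finite by a hierarchical argument: a block of
  level \<open>n + 1\<close> is bad if two of its nine sub-blocks are bad, so badness requires \<open>2\<^bsup>n+1\<^esup>\<close>
  empty cells, while the good sub-blocks of good blocks are always connected to each other.\<close>

section \<open>Configurations and void events\<close>

text \<open>\<open>PPP\<close>, \<open>zeta_c\<close> and \<open>critical_intensity\<close> are
  definite descriptions, so nothing is known about them until existence and uniqueness are both
  proved. This is why a Poisson process has to be constructed, and why \<open>PPP\<close> is
  afterwards used only through the predicate \<open>has_poisson_voids\<close>. The definition of a
  Poisson process speaks of counts in disjoint regions, whereas the marks sit on an enumeration of
  the points; the bridge is the Laplace functional of the points, evaluated at the probability that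
  a point at x receives a mark outside the forbidden set. The zero-one law is what raises the
  positive probability delivered by the hierarchical argument to 1, and it makes both kinds of
  thresholds meaningful. The threshold grows like \<beta> to the power (\<alpha>+1)/(\<alpha>+1+d),
  which is less than 1. Hence \<open>zeta_c / \<beta>\<close> tends to 0, the relevant marks
  eventually fall into the range where the law is prescribed, and the function whose limit is taken
  is eventually constant.\<close>

lemma card_ge_iff_separated_hits:
  fixes S :: "'a::metric_space set"
  assumes fin: "finite S" and D: "\<And>x e. e > 0 \<Longrightarrow> \<exists>d\<in>D. dist d x < e"
  shows "k \<le> card S \<longleftrightarrow> (\<exists>m. \<exists>ds\<in>lists D. length ds = k \<and>
    (\<forall>i<k. \<forall>j<k. i \<noteq> j \<longrightarrow> ball (ds!i) (1/Suc m) \<inter> ball (ds!j) (1/Suc m) = {}) \<and>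
    (\<forall>i<k. S \<inter> ball (ds!i) (1/Suc m) \<noteq> {}))" (is "_ \<longleftrightarrow> ?R")
proof
  assume "k \<le> card S"
  then obtain T where T: "T \<subseteq> S" "card T = k" "finite T"
    by (metis obtain_subset_with_card_n)
  obtain xs where xs: "set xs = T" "distinct xs" "length xs = k"
    using T finite_distinct_list distinct_card by metis
  have "\<exists>\<delta>>0. \<forall>x\<in>T. \<forall>y\<in>T. x \<noteq> y \<longrightarrow> \<delta> \<le> dist x y"
  proof (cases "\<exists>x\<in>T. \<exists>y\<in>T. x \<noteq> y")
    case True
    let ?E = "(\<lambda>(x,y). dist x y) ` {(x,y). x \<in> T \<and> y \<in> T \<and> x \<noteq> y}"
    have f: "finite ?E"
      by (rule finite_imageI, rule finite_subset[of _ "T \<times> T"]) (use T in auto)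
    have "?E \<noteq> {}" using True by auto
    then have "Min ?E \<in> ?E" using f Min_in by blast
    then have "Min ?E > 0" by auto
    moreover have "\<forall>x\<in>T. \<forall>y\<in>T. x \<noteq> y \<longrightarrow> Min ?E \<le> dist x y"
      using f by (auto intro!: Min_le)
    ultimately show ?thesis by blast
  next
    case False
    then show ?thesis by (intro exI[of _ 1]) auto
  qed
  then obtain \<delta> where \<delta>: "\<delta> > 0" "\<And>x y. x \<in> T \<Longrightarrow> y \<in> T \<Longrightarrow> x \<noteq> y \<Longrightarrow> \<delta> \<le> dist x y" by blast
  \<comment> \<open>If the balls around two approximations meet, the points are joined by four
    segments shorter than \<open>\<delta>/4\<close> (point to centre, centre to common point, and
    back), hence closer than \<delta>.\<close>
  obtain m where m: "1 / real (Suc m) < \<delta>/4"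
    using \<delta>(1) by (metis nat_approx_posE zero_less_divide_iff zero_less_numeral)
  have "\<exists>d. d \<in> D \<and> dist d x < 1 / real (Suc m)" for x
    using D[of "1/real (Suc m)" x] by auto
  then obtain f where f: "\<And>x. f x \<in> D" "\<And>x. dist (f x) x < 1 / real (Suc m)" by metis
  show ?R
  proof (intro exI bexI conjI allI impI)
    show "map f xs \<in> lists D" using f by auto
    show "length (map f xs) = k" using xs by simp
  next
    fix i j assume ij: "i < k" "j < k" "i \<noteq> j"
    show "ball (map f xs ! i) (1 / real (Suc m)) \<inter> ball (map f xs ! j) (1 / real (Suc m)) = {}"
    proof (rule ccontr)
      assume "\<not> ?thesis"
      then obtain z where z: "dist (f (xs!i)) z < 1 / real (Suc m)" "dist (f (xs!j)) z < 1 / real (Suc m)"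
        using ij xs by (auto simp: ball_def)
      have "dist (xs!i) (xs!j) < \<delta>"
        using z f(2)[of "xs!i"] f(2)[of "xs!j"] m by metric
      moreover have "xs!i \<noteq> xs!j" using ij xs by (simp add: nth_eq_iff_index_eq)
      ultimately show False using \<delta>(2)[of "xs!i" "xs!j"] ij xs nth_mem by (metis not_le)
    qed
  next
    fix i assume "i < k"
    then have "xs!i \<in> S \<inter> ball (map f xs ! i) (1 / real (Suc m))"
      using xs T f by (auto simp: ball_def)
    then show "S \<inter> ball (map f xs ! i) (1 / real (Suc m)) \<noteq> {}" by blast
  qed
next
  assume ?R
  then obtain m ds where ds: "length ds = k"
    "\<forall>i<k. \<forall>j<k. i \<noteq> j \<longrightarrow> ball (ds!i) (1/Suc m) \<inter> ball (ds!j) (1/Suc m) = {}"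
    "\<forall>i<k. \<exists>x. x \<in> S \<inter> ball (ds!i) (1/Suc m)" by (metis all_not_in_conv)
  then obtain g where g: "\<And>i. i < k \<Longrightarrow> g i \<in> S \<inter> ball (ds!i) (1/Suc m)" by metis
  have "inj_on g {..<k}"
  proof (rule inj_onI)
    fix i j assume ij: "i \<in> {..<k}" "j \<in> {..<k}" "g i = g j"
    then have "g i \<in> ball (ds!i) (1/Suc m) \<inter> ball (ds!j) (1/Suc m)"
      using g[of i] g[of j] by auto
    then have "ball (ds!i) (1/Suc m) \<inter> ball (ds!j) (1/Suc m) \<noteq> {}" by blast
    then show "i = j" using ds(2) ij(1,2) by blast
  qed
  then have "card (g ` {..<k}) = k" by (simp add: card_image)
  moreover have "g ` {..<k} \<subseteq> S" using g by auto
  ultimately show "k \<le> card S" using card_mono[OF fin, of "g ` {..<k}"] by simp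
qed

lemma countable_dense_points:
  obtains D :: "'a::{metric_space, second_countable_topology} set"
  where "countable D" "\<And>x e. e > 0 \<Longrightarrow> \<exists>d\<in>D. dist d x < e"
proof -
  obtain D :: "'a set" where D: "countable D" "\<And>X. open X \<Longrightarrow> X \<noteq> {} \<Longrightarrow> \<exists>d\<in>D. d \<in> X"
    using countable_dense_setE by blast
  have "\<exists>d\<in>D. dist d x < e" if "e > 0" for x e
    using D(2)[of "ball x e"] that by (auto simp: dist_commute)
  then show ?thesis using D(1) that by blast
qed

text \<open>Having at least k points in \<open>A\<close> means hitting k disjoint small balls with
  centres in a countable dense set, which is a countable combination of complements of void events.
  Only voids of subsets of \<open>A\<close> are used, so that independence over disjoint regions can
  later be read off from voids. The set-valued map \<open>X\<close> is kept abstract because the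
  lemma serves configurations, enumerations and general random sets alike.\<close>

lemma card_eq_generated_by_voids:
  fixes X :: "'s \<Rightarrow> 'a::{metric_space, second_countable_topology} set"
  assumes A: "A \<in> sets borel" and fin: "\<And>s. s \<in> \<Omega> \<Longrightarrow> finite (X s \<inter> A)"
  defines "G \<equiv> {{s\<in>\<Omega>. X s \<inter> A' = {}} | A'. A' \<in> sets borel \<and> A' \<subseteq> A}"
  shows "{s\<in>\<Omega>. card (X s \<inter> A) = k} \<in> sigma_sets \<Omega> G"
proof -
  obtain D :: "'a set" where D: "countable D" "\<And>x e. e > 0 \<Longrightarrow> \<exists>d\<in>D. dist d x < e"
    using countable_dense_points by blast
  have GP: "G \<subseteq> Pow \<Omega>" by (auto simp: G_def)
  interpret S: sigma_algebra \<Omega> "sigma_sets \<Omega> G" by (rule sigma_algebra_sigma_sets[OF GP])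
  have hit: "{s\<in>\<Omega>. X s \<inter> A \<inter> ball d r \<noteq> {}} \<in> sigma_sets \<Omega> G" for d r
  proof -
    have "{s\<in>\<Omega>. X s \<inter> (A \<inter> ball d r) = {}} \<in> sigma_sets \<Omega> G"
      unfolding G_def using A by (intro sigma_sets.Basic CollectI exI[of _ "A \<inter> ball d r"]) auto
    then have "\<Omega> - {s\<in>\<Omega>. X s \<inter> (A \<inter> ball d r) = {}} \<in> sigma_sets \<Omega> G" by (rule S.compl_sets)
    also have "\<Omega> - {s\<in>\<Omega>. X s \<inter> (A \<inter> ball d r) = {}} = {s\<in>\<Omega>. X s \<inter> A \<inter> ball d r \<noteq> {}}" by blast
    finally show ?thesis .
  qed
  have ge: "{s\<in>\<Omega>. k \<le> card (X s \<inter> A)} \<in> sigma_sets \<Omega> G" for k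
  proof -
    define good where "good m = {ds \<in> lists D. length ds = k \<and>
      (\<forall>i<k. \<forall>j<k. i \<noteq> j \<longrightarrow> ball (ds!i) (1/Suc m) \<inter> ball (ds!j) (1/Suc m) = {})}" for m
    have cg: "countable (good m)" for m
      by (rule countable_subset[of _ "lists D"]) (use D in \<open>auto simp: good_def\<close>)
    have "{s\<in>\<Omega>. k \<le> card (X s \<inter> A)} =
      (\<Union>m. \<Union>ds\<in>good m. {s\<in>\<Omega>. \<forall>i\<in>{..<k}. X s \<inter> A \<inter> ball (ds!i) (1/Suc m) \<noteq> {}})"
      (is "?L = ?U")
    proof (rule set_eqI)
      fix s
      show "s \<in> ?L \<longleftrightarrow> s \<in> ?U"
      proof (cases "s \<in> \<Omega>")
        case True
        have "(s \<in> ?L) = (k \<le> card (X s \<inter> A))" using True by blast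
        also have "\<dots> = (\<exists>m. \<exists>ds\<in>lists D. length ds = k \<and>
          (\<forall>i<k. \<forall>j<k. i \<noteq> j \<longrightarrow> ball (ds!i) (1/Suc m) \<inter> ball (ds!j) (1/Suc m) = {}) \<and>
          (\<forall>i<k. X s \<inter> A \<inter> ball (ds!i) (1/Suc m) \<noteq> {}))"
          using card_ge_iff_separated_hits[OF fin[OF True] D(2)] .
        also have "\<dots> = (s \<in> ?U)" using True unfolding good_def Bex_def by (simp add: Ball_def)
        finally show ?thesis .
      qed simp
    qed
    also have "\<dots> \<in> sigma_sets \<Omega> G"
      using hit cg by (intro S.countable_UN'' S.sets_Collect_finite_All) auto
    finally show ?thesis .
  qed
  have "{s\<in>\<Omega>. card (X s \<inter> A) = k} = {s\<in>\<Omega>. k \<le> card (X s \<inter> A)} - {s\<in>\<Omega>. Suc k \<le> card (X s \<inter> A)}"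
    by auto
  then show ?thesis using ge[of k] ge[of "Suc k"] by auto
qed

definition void :: "((real^'n) \<times> real) set \<Rightarrow> ((real^'n) \<times> real) set set" where
  "void A = {\<omega> \<in> configs. \<omega> \<inter> A = {}}"

lemma void_Int: "void A \<inter> void B = void (A \<union> B)"
  by (auto simp: void_def)

lemma void_empty [simp]: "void {} = configs"
  by (auto simp: void_def)

lemma finite_config_Int:
  assumes "\<omega> \<in> configs" "bounded (fst ` A)"
  shows "finite (\<omega> \<inter> A)"
proof -
  have "finite (fst ` \<omega> \<inter> fst ` A)"
    using assms by (auto simp: configs_def locally_finite_set_def)
  then have "finite (fst ` (\<omega> \<inter> A))" by (rule rev_finite_subset) auto
  moreover have "inj_on fst (\<omega> \<inter> A)"
    using assms by (auto simp: configs_def inj_on_def)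
  ultimately show ?thesis by (rule finite_imageD)
qed

definition voids :: "((real^'n) \<times> real) set set set" where
  "voids = {void A | A. A \<in> sets borel \<and> bounded A}"

lemma voidsI: "A \<in> sets borel \<Longrightarrow> bounded A \<Longrightarrow> void A \<in> voids"
  by (auto simp: voids_def)

lemma space_config_space [simp]: "space config_space = configs"
  unfolding config_space_def by (rule space_measure_of) auto

lemma voids_Pow: "voids \<subseteq> Pow configs"
  by (auto simp: voids_def void_def)

text \<open>Replaces the counting generators by void events, which are closed under intersection by
  \<open>void_Int\<close>; this is what the uniqueness theorem for measures requires.\<close>

lemma sets_config_space: "sets (config_space :: ((real^'n) \<times> real) set measure) = sigma_sets configs voids"
proof -
  let ?C = "{{\<omega> \<in> configs. card (\<omega> \<inter> A) = k} | (A::((real^'n) \<times> real) set) k. A \<in> sets borel \<and> bounded A}"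
  have 1: "sets (config_space :: ((real^'n) \<times> real) set measure) = sigma_sets configs ?C"
    unfolding config_space_def by (rule sets_measure_of) auto
  have "sigma_sets configs ?C = sigma_sets configs voids"
  proof (rule sigma_sets_eqI)
    fix a assume "a \<in> ?C"
    then obtain A :: "((real^'n) \<times> real) set" and k where
      A: "A \<in> sets borel" "bounded A" and a: "a = {\<omega> \<in> configs. card (\<omega> \<inter> A) = k}" by blast
    have "{\<omega> \<in> configs. card (id \<omega> \<inter> A) = k} \<in> sigma_sets configs
      {{s\<in>configs. id s \<inter> A' = {}} | A'. A' \<in> sets borel \<and> A' \<subseteq> A}"
      using finite_config_Int A by (intro card_eq_generated_by_voids) (auto intro: bounded_fst)
    also have "\<dots> \<subseteq> sigma_sets configs voids"
      using A by (intro sigma_sets_mono') (auto simp: voids_def void_def intro: bounded_subset)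
    finally show "a \<in> sigma_sets configs voids" by (simp add: a)
  next
    fix b assume "b \<in> (voids :: ((real^'n) \<times> real) set set set)"
    then obtain A :: "((real^'n) \<times> real) set" where A: "A \<in> sets borel" "bounded A" "b = void A"
      by (auto simp: voids_def)
    have "b = {\<omega> \<in> configs. card (\<omega> \<inter> A) = 0}"
      using A finite_config_Int[of _ A] by (auto simp: void_def bounded_fst)
    then show "b \<in> sigma_sets configs ?C" using A by (intro sigma_sets.Basic) blast
  qed
  then show ?thesis using 1 by simp
qed

text \<open>The generators are voids of bounded sets only; a general region is exhausted by its
  intersections with balls.\<close>

lemma void_measurable [measurable]:
  "A \<in> sets borel \<Longrightarrow> void A \<in> sets (config_space :: ((real^'n) \<times> real) set measure)"
proof -
  assume A: "A \<in> sets borel"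
  have "void A = (\<Inter>k::nat. void (A \<inter> ball 0 (real k)))"
  proof -
    have "(\<Union>k::nat. ball 0 (real k)) = (UNIV :: ((real^'n) \<times> real) set)"
      by (auto simp: reals_Archimedean2)
    then have "\<omega> \<inter> A = (\<Union>k::nat. \<omega> \<inter> (A \<inter> ball 0 (real k)))" for \<omega> by blast
    then show ?thesis unfolding void_def by (simp only: UN_simps) blast
  qed
  moreover have "void (A \<inter> ball 0 (real k)) \<in> sets config_space" for k :: nat
    unfolding sets_config_space using A by (intro sigma_sets.Basic voidsI) (auto intro: bounded_Int)
  ultimately show ?thesis by (simp add: sets.countable_INT'')
qed

lemma measurable_config_spaceI:
  fixes f :: "'s \<Rightarrow> ((real^'n) \<times> real) set"
  assumes "\<And>x. x \<in> space M \<Longrightarrow> f x \<in> configs"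
    and "\<And>A. A \<in> sets borel \<Longrightarrow> bounded A \<Longrightarrow> {x\<in>space M. f x \<inter> A = {}} \<in> sets M"
  shows "f \<in> measurable M config_space"
proof (rule measurable_sigma_sets[OF sets_config_space voids_Pow])
  show "f \<in> space M \<rightarrow> configs" using assms by auto
  fix a assume "a \<in> (voids :: ((real^'n) \<times> real) set set set)"
  then obtain A where A: "A \<in> sets borel" "bounded A" "a = void A" by (auto simp: voids_def)
  have "f -` a \<inter> space M = {x\<in>space M. f x \<inter> A = {}}" using A assms(1) by (auto simp: void_def)
  then show "f -` a \<inter> space M \<in> sets M" using assms(2) A by simp
qed

lemma config_measure_eqI:
  fixes P P' :: "((real^'n) \<times> real) set measure"
  assumes "sets P = sets config_space" "sets P' = sets config_space"
    and "\<And>A. A \<in> sets borel \<Longrightarrow> bounded A \<Longrightarrow> emeasure P (void A) = emeasure P' (void A)"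
    and "emeasure P configs \<noteq> \<infinity>"
  shows "P = P'"
proof (rule measure_eqI_generator_eq[where E=voids and \<Omega>=configs and A="\<lambda>_. configs"])
  show "Int_stable (voids :: ((real^'n) \<times> real) set set set)"
    by (auto simp: Int_stable_def voids_def void_Int) (metis bounded_Un sets.Un)
  show "range (\<lambda>_. configs) \<subseteq> (voids :: ((real^'n) \<times> real) set set set)"
    by (auto simp: voids_def intro!: exI[of _ "{}"])
  show "voids \<subseteq> Pow (configs :: ((real^'n) \<times> real) set set)" by (rule voids_Pow)
  show "sets P = sigma_sets configs voids" "sets P' = sigma_sets configs voids"
    using assms(1,2) sets_config_space by metis+
  show "emeasure P X = emeasure P' X" if "X \<in> voids" for X
    using that assms(3) unfolding voids_def by blast
qed (use assms(4) in simp_all)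

section \<open>Laplace functionals of Poisson processes\<close>

lemma nn_integral_power_count:
  assumes M: "prob_space M" and [measurable]: "N \<in> measurable M (count_space UNIV)" and v: "v \<ge> 0"
  shows "(\<integral>\<^sup>+ s. ennreal (v ^ N s) \<partial>M) = (\<Sum>k. ennreal (measure M {s\<in>space M. N s = k} * v ^ k))"
proof -
  interpret prob_space M by fact
  have "(\<integral>\<^sup>+ s. ennreal (v ^ N s) \<partial>M) = (\<integral>\<^sup>+ s. (\<Sum>k. ennreal (v ^ k) * indicator {s\<in>space M. N s = k} s) \<partial>M)"
  proof (rule nn_integral_cong)
    fix s assume s: "s \<in> space M"
    have "(\<Sum>k. ennreal (v ^ k) * indicator {s\<in>space M. N s = k} s) = (\<Sum>k\<in>{N s}. ennreal (v ^ k) * indicator {s\<in>space M. N s = k} s)"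
      by (rule suminf_finite) auto
    then show "ennreal (v ^ N s) = (\<Sum>k. ennreal (v ^ k) * indicator {s\<in>space M. N s = k} s)"
      using s by simp
  qed
  also have "\<dots> = (\<Sum>k. \<integral>\<^sup>+ s. ennreal (v ^ k) * indicator {s\<in>space M. N s = k} s \<partial>M)"
    by (rule nn_integral_suminf) simp
  also have "\<dots> = (\<Sum>k. ennreal (measure M {s\<in>space M. N s = k} * v ^ k))"
    using v by (subst nn_integral_cmult_indicator) (auto simp: emeasure_eq_measure ennreal_mult mult.commute)
  finally show ?thesis .
qed

lemma sums_poisson_pgf:
  fixes a v :: real
  shows "(\<lambda>k. a ^ k / fact k * exp (- a) * v ^ k) sums exp (- a * (1 - v))"
proof -
  have "(\<lambda>k. exp (- a) * ((v * a) ^ k /\<^sub>R fact k)) sums (exp (- a) * exp (v * a))"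
    by (intro sums_mult exp_converges)
  moreover have "exp (- a) * exp (v * a) = exp (- a * (1 - v))" by (simp add: exp_add[symmetric] algebra_simps)
  ultimately show ?thesis by (simp add: power_mult_distrib field_simps)
qed

lemma nn_integral_power_poisson_count:
  assumes M: "prob_space M" and N: "N \<in> measurable M (count_space UNIV)" and a: "a \<ge> 0" and v: "v \<ge> 0"
    and p: "\<And>k. measure M {s\<in>space M. N s = k} = a ^ k / fact k * exp (- a)"
  shows "(\<integral>\<^sup>+ s. ennreal (v ^ N s) \<partial>M) = ennreal (exp (- a * (1 - v)))"
proof -
  have "(\<Sum>k. ennreal (a ^ k / fact k * exp (- a) * v ^ k)) = ennreal (\<Sum>k. a ^ k / fact k * exp (- a) * v ^ k)"
    using a v by (intro suminf_ennreal2 sums_summable[OF sums_poisson_pgf]) auto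
  then show ?thesis
    unfolding nn_integral_power_count[OF M N v] p sums_unique[OF sums_poisson_pgf, symmetric] .
qed

lemma poisson_process_measurable_card:
  assumes "poisson_process M \<rho> \<eta>" "B \<in> sets borel" "bounded B"
  shows "(\<lambda>s. card (\<eta> s \<inter> B)) \<in> measurable M (count_space UNIV)"
proof -
  interpret prob_space M using assms by (simp add: poisson_process_def)
  have "disjoint_family_on (\<lambda>i. B) {..<1::nat}" by (auto simp: disjoint_family_on_def)
  then have "indep_vars (\<lambda>_. count_space UNIV) (\<lambda>i s. card (\<eta> s \<inter> B)) {..<1::nat}"
    using assms unfolding poisson_process_def by (elim conjE allE[of _ "\<lambda>_. B"] allE[of _ "1::nat"]) auto
  then show ?thesis by (auto simp: indep_vars_def)
qed

text \<open>On the level sets of \<open>g\<close> the product is a product of powers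
  \<open>v i ^ N i\<close>, where the counts \<open>N i\<close> of disjoint regions are independent
  and Poisson. The expectation therefore factorises into generating functions, and the exponents add
  up to the integral.\<close>

lemma poisson_process_laplace_simple:
  fixes \<eta> :: "'s \<Rightarrow> (real^'n) set"
  assumes P: "poisson_process M \<rho> \<eta>" and \<rho>: "\<rho> \<ge> 0" and B: "B \<in> sets borel" "bounded B"
    and g[measurable]: "g \<in> borel_measurable borel" and fin: "finite (g ` B)"
    and g01: "\<And>x. 0 \<le> g x \<and> g x \<le> 1"
  shows "(\<lambda>s. \<Prod>x\<in>\<eta> s \<inter> B. g x) \<in> borel_measurable M"
    and "(\<integral>\<^sup>+ s. ennreal (\<Prod>x\<in>\<eta> s \<inter> B. g x) \<partial>M) = ennreal (exp (- \<rho> * (\<integral>x\<in>B. (1 - g x) \<partial>lborel)))"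
proof -
  interpret prob_space M using P by (simp add: poisson_process_def)
  obtain m :: nat and v where v: "bij_betw v {..<m} (g ` B)"
    using ex_bij_betw_nat_finite[OF fin] by (metis atLeast0LessThan)
  define C where "C i = B \<inter> g -` {v i}" for i
  have C: "C i \<in> sets borel" "bounded (C i)" for i
    using B measurable_sets[OF g, of "{v i}"] by (auto simp: C_def intro: bounded_Int)
  have inj: "v i = v j \<longleftrightarrow> i = j" if "i < m" "j < m" for i j
    using v that by (auto simp: bij_betw_def inj_on_def)
  have disj: "disjoint_family_on C {..<m}"
    using inj by (auto simp: disjoint_family_on_def C_def)
  have BU: "B = (\<Union>i\<in>{..<m}. C i)"
    using v by (fastforce simp: C_def bij_betw_def)
  have v01: "0 \<le> v i" "v i \<le> 1" if "i < m" for i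
  proof -
    have "v i \<in> g ` B" using v that by (auto simp: bij_betw_def)
    then show "0 \<le> v i" "v i \<le> 1" using g01 by auto
  qed
  have prod_eq: "(\<Prod>x\<in>\<eta> s \<inter> B. g x) = (\<Prod>i<m. v i ^ card (\<eta> s \<inter> C i))" if s: "s \<in> space M" for s
  proof -
    have fins: "finite (\<eta> s \<inter> B)" using P s B by (auto simp: poisson_process_def locally_finite_set_def)
    have "\<eta> s \<inter> B = (\<Union>i\<in>{..<m}. \<eta> s \<inter> C i)" using BU by blast
    then have "(\<Prod>x\<in>\<eta> s \<inter> B. g x) = (\<Prod>x\<in>(\<Union>i\<in>{..<m}. \<eta> s \<inter> C i). g x)" by simp
    also have "\<dots> = (\<Prod>i<m. \<Prod>x\<in>\<eta> s \<inter> C i. g x)"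
    proof (rule prod.UNION_disjoint)
      show "\<forall>i\<in>{..<m}. finite (\<eta> s \<inter> C i)" using fins by (auto simp: C_def Int_assoc[symmetric])
    qed (use disj in \<open>auto simp: disjoint_family_on_def\<close>)
    also have "\<dots> = (\<Prod>i<m. v i ^ card (\<eta> s \<inter> C i))"
      by (intro prod.cong refl) (auto simp: C_def)
    finally show ?thesis .
  qed
  have card_meas[measurable]: "(\<lambda>s. card (\<eta> s \<inter> C i)) \<in> measurable M (count_space UNIV)" for i
    using poisson_process_measurable_card[OF P C] .
  show "(\<lambda>s. \<Prod>x\<in>\<eta> s \<inter> B. g x) \<in> borel_measurable M"
    by (subst measurable_cong[OF prod_eq]) auto
  have ind: "indep_vars (\<lambda>_. count_space UNIV) (\<lambda>i s. card (\<eta> s \<inter> C i)) {..<m}"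
    using P C disj unfolding poisson_process_def by blast
  have ind2: "indep_vars (\<lambda>_. borel) (\<lambda>i s. (\<lambda>k. ennreal (v i ^ k)) (card (\<eta> s \<inter> C i))) {..<m}"
    by (rule indep_vars_compose2[OF ind]) auto
  have ms: "set_integrable lborel (C i) (\<lambda>x. 1 - g x)" for i
  proof -
    have "emeasure lborel (C i) < \<infinity>" using C by (intro emeasure_bounded_finite)
    moreover have "(\<lambda>x. indicator (C i) x *\<^sub>R (1 - g x)) \<in> borel_measurable lborel"
      using C(1) by measurable
    ultimately show ?thesis unfolding set_integrable_def using C(1) g01
      by (intro integrableI_bounded_set_indicator[where B=1] ) (auto simp: abs_le_iff intro: order_trans)
  qed
  have "(\<integral>\<^sup>+ s. ennreal (\<Prod>x\<in>\<eta> s \<inter> B. g x) \<partial>M) = (\<integral>\<^sup>+ s. (\<Prod>i<m. ennreal (v i ^ card (\<eta> s \<inter> C i))) \<partial>M)"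
    by (intro nn_integral_cong) (auto simp: prod_eq intro!: prod_ennreal[symmetric] zero_le_power v01)
  also have "\<dots> = (\<Prod>i<m. \<integral>\<^sup>+ s. ennreal (v i ^ card (\<eta> s \<inter> C i)) \<partial>M)"
    by (rule indep_vars_nn_integral[OF _ ind2]) auto
  also have "\<dots> = (\<Prod>i<m. ennreal (exp (- (\<rho> * measure lborel (C i)) * (1 - v i))))"
    using P C \<rho> v01
    by (intro prod.cong refl nn_integral_power_poisson_count) (auto simp: poisson_process_def prob_space_axioms)
  also have "\<dots> = ennreal (exp (\<Sum>i<m. - (\<rho> * measure lborel (C i)) * (1 - v i)))"
    by (simp add: prod_ennreal exp_sum)
  also have "(\<Sum>i<m. - (\<rho> * measure lborel (C i)) * (1 - v i)) = - \<rho> * (\<Sum>i<m. \<integral>x\<in>C i. (1 - g x) \<partial>lborel)"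
  proof -
    have "(\<integral>x\<in>C i. (1 - g x) \<partial>lborel) = measure lborel (C i) * (1 - v i)" for i
    proof -
      have "(\<integral>x\<in>C i. (1 - g x) \<partial>lborel) = (\<integral>x\<in>C i. (1 - v i) \<partial>lborel)"
        using C by (intro set_lebesgue_integral_cong) (auto simp: C_def)
      also have "\<dots> = measure lborel (C i) * (1 - v i)"
        using C(1) emeasure_bounded_finite[OF C(2)]
        unfolding set_lebesgue_integral_def by (simp add: integrable_real_indicator)
      finally show ?thesis .
    qed
    then show ?thesis by (simp add: sum_distrib_left sum_negf mult.assoc)
  qed
  also have "(\<Sum>i<m. \<integral>x\<in>C i. (1 - g x) \<partial>lborel) = (\<integral>x\<in>B. (1 - g x) \<partial>lborel)"
    unfolding BU using disj C ms
    by (intro set_integral_finite_Union[symmetric]) auto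
  finally show "(\<integral>\<^sup>+ s. ennreal (\<Prod>x\<in>\<eta> s \<inter> B. g x) \<partial>M) = ennreal (exp (- \<rho> * (\<integral>x\<in>B. (1 - g x) \<partial>lborel)))" .
qed

text \<open>Rounding \<open>g\<close> down to multiples of \<open>1 / Suc m\<close> gives functions
  with finitely many values in [0,1] that converge pointwise. Both sides of the simple case pass to
  the limit by dominated convergence, with the constant 1 and the indicator of \<open>B\<close> as
  majorants.\<close>

lemma poisson_process_laplace:
  fixes \<eta> :: "'s \<Rightarrow> (real^'n) set"
  assumes P: "poisson_process M \<rho> \<eta>" and \<rho>: "\<rho> \<ge> 0" and B: "B \<in> sets borel" "bounded B"
    and g[measurable]: "g \<in> borel_measurable borel"
    and g01: "\<And>x. 0 \<le> g x \<and> g x \<le> 1"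
  shows "(\<lambda>s. \<Prod>x\<in>\<eta> s \<inter> B. g x) \<in> borel_measurable M"
    and "(\<integral>\<^sup>+ s. ennreal (\<Prod>x\<in>\<eta> s \<inter> B. g x) \<partial>M) = ennreal (exp (- \<rho> * (\<integral>x\<in>B. (1 - g x) \<partial>lborel)))"
proof -
  interpret prob_space M using P by (simp add: poisson_process_def)
  define h where "h m x = real_of_int \<lfloor>real (Suc m) * g x\<rfloor> / real (Suc m)" for m x
  have h[measurable]: "h m \<in> borel_measurable borel" for m unfolding h_def by measurable
  have h01: "0 \<le> h m x \<and> h m x \<le> 1" for m x
  proof -
    have "real_of_int \<lfloor>real (Suc m) * g x\<rfloor> \<le> real (Suc m) * g x" by simp
    also have "\<dots> \<le> real (Suc m)" using g01[of x] by (intro mult_left_le) auto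
    finally show ?thesis using g01[of x] by (auto simp: h_def field_simps)
  qed
  have hfin: "finite (h m ` B)" for m
  proof (rule finite_subset)
    show "h m ` B \<subseteq> (\<lambda>k. real_of_int k / real (Suc m)) ` {0..int (Suc m)}"
    proof safe
      fix x
      have "real (Suc m) * g x \<le> real (Suc m)" using g01[of x] by (intro mult_left_le) auto
      from floor_mono[OF this] have "\<lfloor>real (Suc m) * g x\<rfloor> \<le> int (Suc m)" by linarith
      then have "\<lfloor>real (Suc m) * g x\<rfloor> \<in> {0..int (Suc m)}"
        using g01[of x] by simp
      then show "h m x \<in> (\<lambda>k. real_of_int k / real (Suc m)) ` {0..int (Suc m)}" by (auto simp: h_def)
    qed
  qed simp
  have lim: "(\<lambda>m. h m x) \<longlonglongrightarrow> g x" for x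
  proof (rule tendsto_sandwich)
    show "(\<lambda>m. g x - 1 / real (Suc m)) \<longlonglongrightarrow> g x"
      by (rule tendsto_eq_intros LIMSEQ_inverse_real_of_nat[unfolded inverse_eq_divide] | simp)+
    show "\<forall>\<^sub>F m in sequentially. h m x \<le> g x"
      unfolding h_def by (intro always_eventually allI) (simp add: pos_divide_le_eq mult.commute del: of_nat_Suc)
    show "\<forall>\<^sub>F m in sequentially. g x - 1 / real (Suc m) \<le> h m x"
    proof (intro always_eventually allI)
      fix m
      have "real (Suc m) * g x - 1 \<le> real_of_int \<lfloor>real (Suc m) * g x\<rfloor>" by linarith
      then have "(real (Suc m) * g x - 1) / real (Suc m) \<le> h m x"
        unfolding h_def by (intro divide_right_mono) auto
      then show "g x - 1 / real (Suc m) \<le> h m x" by (simp add: diff_divide_distrib del: of_nat_Suc)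
    qed
  qed simp
  have limp: "(\<lambda>m. \<Prod>x\<in>\<eta> s \<inter> B. h m x) \<longlonglongrightarrow> (\<Prod>x\<in>\<eta> s \<inter> B. g x)" for s
    by (intro tendsto_prod lim)
  note S = poisson_process_laplace_simple[OF P \<rho> B h hfin h01]
  note [measurable] = S(1)
  show m[measurable]: "(\<lambda>s. \<Prod>x\<in>\<eta> s \<inter> B. g x) \<in> borel_measurable M"
    by (rule borel_measurable_LIMSEQ_real[OF limp S(1)])
  have p01: "0 \<le> (\<Prod>x\<in>\<eta> s \<inter> B. h m x)" "(\<Prod>x\<in>\<eta> s \<inter> B. h m x) \<le> 1" for s m
    using h01 by (auto intro: prod_nonneg prod_le_1)
  have "(\<lambda>m. \<integral>\<^sup>+ s. ennreal (\<Prod>x\<in>\<eta> s \<inter> B. h m x) \<partial>M) \<longlonglongrightarrow> (\<integral>\<^sup>+ s. ennreal (\<Prod>x\<in>\<eta> s \<inter> B. g x) \<partial>M)"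
    using limp p01
    by (intro nn_integral_dominated_convergence[where w="\<lambda>_. 1"])
       (auto simp: emeasure_space_1 intro!: AE_I2 tendsto_ennrealI ennreal_le_1[THEN iffD2])
  moreover have "(\<lambda>m. \<integral>x\<in>B. (1 - h m x) \<partial>lborel) \<longlonglongrightarrow> (\<integral>x\<in>B. (1 - g x) \<partial>lborel)"
    unfolding set_lebesgue_integral_def
  proof (rule integral_dominated_convergence[where w="indicator B"])
    show "integrable lborel (indicator B :: _ \<Rightarrow> real)"
      using B(1) emeasure_bounded_finite[OF B(2)] by (intro integrable_real_indicator) auto
    show "AE x in lborel. (\<lambda>i. indicator B x *\<^sub>R (1 - h i x)) \<longlonglongrightarrow> indicator B x *\<^sub>R (1 - g x)"
      by (intro AE_I2 tendsto_intros lim)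
    show "AE x in lborel. norm (indicator B x *\<^sub>R (1 - h m x)) \<le> indicator B x" for m
      using h01[of m] by (intro AE_I2) (auto simp: indicator_def)
  qed (use B in measurable)
  then have "(\<lambda>m. ennreal (exp (- \<rho> * (\<integral>x\<in>B. (1 - h m x) \<partial>lborel)))) \<longlonglongrightarrow> ennreal (exp (- \<rho> * (\<integral>x\<in>B. (1 - g x) \<partial>lborel)))"
    by (intro tendsto_intros tendsto_ennrealI)
  ultimately show "(\<integral>\<^sup>+ s. ennreal (\<Prod>x\<in>\<eta> s \<inter> B. g x) \<partial>M) = ennreal (exp (- \<rho> * (\<integral>x\<in>B. (1 - g x) \<partial>lborel)))"
    unfolding S(2) using LIMSEQ_unique by blast
qed

section \<open>Uniqueness of the marked Poisson process\<close>

text \<open>The void probabilities of a Poisson process on the product space with intensity measure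
  \<rho> dx times \<nu>. On bounded sets this measure is finite for a probability law \<nu>, so the
  real-valued \<open>measure\<close> loses nothing there.\<close>

definition has_poisson_voids :: "real \<Rightarrow> real measure \<Rightarrow> ((real^'n) \<times> real) set measure \<Rightarrow> bool" where
  "has_poisson_voids \<rho> \<nu> P \<longleftrightarrow> sets P = sets config_space \<and>
     (\<forall>A. A \<in> sets borel \<longrightarrow> bounded A \<longrightarrow>
       emeasure P (void A) = ennreal (exp (- \<rho> * measure (lborel \<Otimes>\<^sub>M \<nu>) A)))"

lemma has_poisson_voids_unique:
  fixes P P' :: "((real^'n) \<times> real) set measure"
  assumes "has_poisson_voids \<rho> \<nu> P" "has_poisson_voids \<rho>' \<nu>' P'"
    and "\<And>A :: ((real^'n) \<times> real) set. A \<in> sets borel \<Longrightarrow> bounded A \<Longrightarrow>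
      \<rho> * measure (lborel \<Otimes>\<^sub>M \<nu>) A = \<rho>' * measure (lborel \<Otimes>\<^sub>M \<nu>') A"
  shows "P = P'"
proof (rule config_measure_eqI)
  show "emeasure P configs \<noteq> \<infinity>"
    using assms(1) unfolding has_poisson_voids_def
    by (elim conjE allE[of _ "{}"]) (simp add: void_empty)
qed (use assms in \<open>auto simp: has_poisson_voids_def\<close>)

lemma space_enumeration_space:
  "space (enumeration_space :: (nat \<Rightarrow> real^'n) measure) = {x. inj x \<and> locally_finite_set (range x)}"
  unfolding enumeration_space_def by (simp add: space_restrict_space space_PiM)

lemma measurable_enumeration_component [measurable]:
  "(\<lambda>x. x i) \<in> measurable enumeration_space borel"
  unfolding enumeration_space_def
  by (intro measurable_restrict_space1 measurable_component_singleton) simp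

lemma measurable_mark_enumeration:
  fixes Q :: "(nat \<Rightarrow> real^'n) measure"
  assumes Q: "sets Q = sets enumeration_space" and \<nu>: "sets \<nu> = sets borel"
  shows "(\<lambda>(x, e). range (\<lambda>i. (x i, e i))) \<in> measurable (Q \<Otimes>\<^sub>M (\<Pi>\<^sub>M i\<in>(UNIV::nat set). \<nu>)) config_space"
    and "\<And>A. A \<in> sets borel \<Longrightarrow>
      {w\<in>space (Q \<Otimes>\<^sub>M (\<Pi>\<^sub>M i\<in>(UNIV::nat set). \<nu>)). \<forall>i. (fst w i, snd w i) \<notin> A} \<in> sets (Q \<Otimes>\<^sub>M (\<Pi>\<^sub>M i\<in>(UNIV::nat set). \<nu>))"
proof -
  let ?N = "\<Pi>\<^sub>M i\<in>(UNIV::nat set). \<nu>"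
  have sp: "space Q = space enumeration_space" using sets_eq_imp_space_eq[OF Q] .
  have "(\<lambda>x. x i) \<in> measurable Q borel" for i
    unfolding measurable_cong_sets[OF Q refl] by (rule measurable_enumeration_component)
  then have [measurable]: "(\<lambda>w. fst w i) \<in> measurable (Q \<Otimes>\<^sub>M ?N) borel" for i
    by (rule measurable_compose[OF measurable_fst])
  have "(\<lambda>e. e i) \<in> measurable ?N borel" for i
    unfolding measurable_cong_sets[OF refl \<nu>[symmetric]] by (rule measurable_component_singleton) simp
  then have [measurable]: "(\<lambda>w. snd w i) \<in> measurable (Q \<Otimes>\<^sub>M ?N) borel" for i
    by (rule measurable_compose[OF measurable_snd])
  have [measurable]: "(\<lambda>w. (fst w i, snd w i)) \<in> measurable (Q \<Otimes>\<^sub>M ?N) borel" for i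
    by (simp add: borel_prod[symmetric])
  show *: "{w\<in>space (Q \<Otimes>\<^sub>M ?N). \<forall>i. (fst w i, snd w i) \<notin> A} \<in> sets (Q \<Otimes>\<^sub>M ?N)"
    if [measurable]: "A \<in> sets borel" for A
    by measurable
  show "(\<lambda>(x, e). range (\<lambda>i. (x i, e i))) \<in> measurable (Q \<Otimes>\<^sub>M ?N) config_space"
  proof (rule measurable_config_spaceI)
    fix w assume "w \<in> space (Q \<Otimes>\<^sub>M ?N)"
    then have w: "inj (fst w)" "locally_finite_set (range (fst w))"
      by (auto simp: space_pair_measure sp space_enumeration_space)
    have "fst ` range (\<lambda>i. (fst w i, snd w i)) = range (fst w)" by (auto simp: image_image)
    moreover have "inj_on fst (range (\<lambda>i. (fst w i, snd w i)))"
      using w(1) by (auto simp: inj_on_def)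
    ultimately show "(case w of (x, e) \<Rightarrow> range (\<lambda>i. (x i, e i))) \<in> configs"
      using w by (simp add: configs_def case_prod_beta)
  next
    fix A :: "((real^'n) \<times> real) set" assume "A \<in> sets borel"
    moreover have "{w\<in>space (Q \<Otimes>\<^sub>M ?N). (case w of (x, e) \<Rightarrow> range (\<lambda>i. (x i, e i))) \<inter> A = {}}
      = {w\<in>space (Q \<Otimes>\<^sub>M ?N). \<forall>i. (fst w i, snd w i) \<notin> A}" by (auto simp: case_prod_beta)
    ultimately show "{w\<in>space (Q \<Otimes>\<^sub>M ?N). (case w of (x, e) \<Rightarrow> range (\<lambda>i. (x i, e i))) \<inter> A = {}} \<in> sets (Q \<Otimes>\<^sub>M ?N)"
      using * by simp
  qed
qed

text \<open>Given the points, the marks are independent, so the conditional probability of a void in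
  \<open>A\<close> is the product over the points of \<open>g x\<close>, the probability that the
  mark at x avoids the slice of \<open>A\<close>. Averaging over the points gives the Laplace
  functional at \<open>g\<close>, and the integral of \<open>1 - g\<close> is the product measure of
  \<open>A\<close> by Fubini.\<close>

lemma is_PPP_has_poisson_voids:
  fixes P :: "((real^'n) \<times> real) set measure"
  assumes P: "is_PPP \<rho> \<nu> P" and \<rho>: "\<rho> > 0" and "prob_space \<nu>" and \<nu>: "sets \<nu> = sets borel"
  shows "has_poisson_voids \<rho> \<nu> P"
proof -
  interpret \<nu>: prob_space \<nu> by fact
  let ?N = "\<Pi>\<^sub>M i\<in>(UNIV::nat set). \<nu>"
  let ?f = "\<lambda>(x :: nat \<Rightarrow> real^'n, e). range (\<lambda>i. (x i, e i :: real))"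
  obtain Q :: "(nat \<Rightarrow> real^'n) measure" where Q: "sets Q = sets enumeration_space"
    and pp: "poisson_process Q \<rho> range" and PQ: "P = distr (Q \<Otimes>\<^sub>M ?N) config_space ?f"
    using P unfolding is_PPP_def by blast
  interpret Q: prob_space Q using pp by (simp add: poisson_process_def)
  interpret N: product_prob_space "\<lambda>_::nat. \<nu>" UNIV by unfold_locales
  have sp: "space Q = space enumeration_space" using sets_eq_imp_space_eq[OF Q] .
  have sp\<nu>: "space \<nu> = UNIV" using sets_eq_imp_space_eq[OF \<nu>] by simp
  note f = measurable_mark_enumeration[OF Q \<nu>]
  have "emeasure P (void A) = ennreal (exp (- \<rho> * measure (lborel \<Otimes>\<^sub>M \<nu>) A))"
    if A: "A \<in> sets borel" "bounded A" for A
  proof -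
    obtain r where "\<And>z. z \<in> A \<Longrightarrow> norm z \<le> r"
      using A(2) unfolding bounded_iff by blast
    then have r: "x \<in> cball 0 r" if "(x, e) \<in> A" for x e
      using that norm_fst_le[of x e] by (metis mem_cball_0 order_trans)
    define B :: "(real^'n) set" where "B = cball 0 r"
    have B: "B \<in> sets borel" "bounded B" by (auto simp: B_def)
    define g where "g x = 1 - measure \<nu> (Pair x -` A)" for x
    have Ap: "A \<in> sets (lborel \<Otimes>\<^sub>M \<nu>)"
    proof -
      have "sets (lborel \<Otimes>\<^sub>M \<nu>) = sets (borel \<Otimes>\<^sub>M borel :: ((real^'n) \<times> real) measure)"
        by (intro sets_pair_measure_cong) (auto simp: \<nu>)
      then show ?thesis using A(1) unfolding borel_prod by blast
    qed
    have slice[measurable]: "Pair x -` A \<in> sets \<nu>" for x using sets_Pair1[OF Ap] .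
    have [measurable]: "(\<lambda>x. measure \<nu> (Pair x -` A)) \<in> borel_measurable borel"
      using \<nu>.measurable_emeasure_Pair[OF Ap] unfolding measure_def by simp
    have g[measurable]: "g \<in> borel_measurable borel" unfolding g_def by measurable
    have g01: "0 \<le> g x \<and> g x \<le> 1" for x by (simp add: g_def)
    have "emeasure P (void A) = emeasure (Q \<Otimes>\<^sub>M ?N) (?f -` void A \<inter> space (Q \<Otimes>\<^sub>M ?N))"
      unfolding PQ using A by (intro emeasure_distr f(1)) auto
    also have "?f -` void A \<inter> space (Q \<Otimes>\<^sub>M ?N) = {w\<in>space (Q \<Otimes>\<^sub>M ?N). \<forall>i. (fst w i, snd w i) \<notin> A}"
      using measurable_space[OF f(1)] by (auto simp: void_def case_prod_beta disjoint_iff)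
    also have "emeasure (Q \<Otimes>\<^sub>M ?N) \<dots> = (\<integral>\<^sup>+ x. emeasure ?N (Pair x -` {w\<in>space (Q \<Otimes>\<^sub>M ?N). \<forall>i. (fst w i, snd w i) \<notin> A}) \<partial>Q)"
      using f(2)[OF A(1)] by (rule N.P.emeasure_pair_measure_alt)
    also have "\<dots> = (\<integral>\<^sup>+ x. ennreal (\<Prod>y\<in>range x \<inter> B. g y) \<partial>Q)"
    proof (rule nn_integral_cong)
      fix x assume x: "x \<in> space Q"
      then have inj: "inj x" and lf: "locally_finite_set (range x)" by (auto simp: sp space_enumeration_space)
      \<comment> \<open>Only the finitely many points in the ball \<open>B\<close> below
        \<open>A\<close> constrain their marks, so the event is a finite-dimensional cylinder of the
        infinite product.\<close>
      define J where "J = {i. x i \<in> B}"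
      have "finite (range x \<inter> B)" using lf B by (auto simp: locally_finite_set_def)
      moreover have im: "range x \<inter> B = x ` J" by (auto simp: J_def)
      ultimately have J: "finite J" using inj by (metis finite_imageD inj_on_subset top_greatest)
      have "Pair x -` {w\<in>space (Q \<Otimes>\<^sub>M ?N). \<forall>i. (fst w i, snd w i) \<notin> A}
        = {e\<in>space ?N. \<forall>i\<in>J. e i \<in> space \<nu> - Pair (x i) -` A}"
        using x r by (auto simp: space_pair_measure J_def B_def space_PiM sp\<nu>)
      also have "emeasure ?N \<dots> = (\<Prod>i\<in>J. emeasure \<nu> (space \<nu> - Pair (x i) -` A))"
        using J by (intro N.emeasure_PiM_Collect) auto
      also have "\<dots> = (\<Prod>i\<in>J. ennreal (g (x i)))"
        by (simp add: \<nu>.emeasure_eq_measure \<nu>.prob_compl g_def)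
      also have "\<dots> = ennreal (\<Prod>i\<in>J. g (x i))" using g01 by (simp add: prod_ennreal)
      also have "(\<Prod>i\<in>J. g (x i)) = (\<Prod>y\<in>range x \<inter> B. g y)"
        unfolding im using inj by (subst prod.reindex) (auto simp: inj_on_def)
      finally show "emeasure ?N (Pair x -` {w\<in>space (Q \<Otimes>\<^sub>M ?N). \<forall>i. (fst w i, snd w i) \<notin> A}) = ennreal (\<Prod>y\<in>range x \<inter> B. g y)" .
    qed
    also have "\<dots> = ennreal (exp (- \<rho> * (\<integral>x\<in>B. (1 - g x) \<partial>lborel)))"
      using poisson_process_laplace(2)[OF pp _ B g g01] \<rho> by simp
    also have "(\<integral>x\<in>B. (1 - g x) \<partial>lborel) = measure (lborel \<Otimes>\<^sub>M \<nu>) A"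
    proof -
      have "emeasure (lborel \<Otimes>\<^sub>M \<nu>) A = (\<integral>\<^sup>+ x. emeasure \<nu> (Pair x -` A) \<partial>lborel)"
        by (rule \<nu>.emeasure_pair_measure_alt[OF Ap])
      also have "\<dots> = (\<integral>\<^sup>+ x. ennreal (indicator B x *\<^sub>R (1 - g x)) \<partial>lborel)"
      proof (rule nn_integral_cong)
        fix x
        have "Pair x -` A = {}" if "x \<notin> B" using r that by (auto simp: B_def)
        then show "emeasure \<nu> (Pair x -` A) = ennreal (indicator B x *\<^sub>R (1 - g x))"
          by (cases "x \<in> B") (auto simp: g_def \<nu>.emeasure_eq_measure)
      qed
      finally have "measure (lborel \<Otimes>\<^sub>M \<nu>) A = enn2real (\<integral>\<^sup>+ x. ennreal (indicator B x *\<^sub>R (1 - g x)) \<partial>lborel)"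
        by (simp add: measure_def)
      also have "\<dots> = (\<integral>x\<in>B. (1 - g x) \<partial>lborel)"
        unfolding set_lebesgue_integral_def using B g01
        by (subst integral_eq_nn_integral) (auto simp: indicator_def)
      finally show ?thesis by simp
    qed
    finally show ?thesis .
  qed
  then show ?thesis by (simp add: has_poisson_voids_def PQ)
qed

text \<open>Once the coefficients below k vanish, dividing by \<open>z ^ k\<close> and letting z
  tend to 0 from the right isolates the coefficient k. It serves to recover a law on the natural
  numbers from its generating function on [0,1].\<close>

lemma power_series_eq_0_on_unit_interval:
  fixes c :: "nat \<Rightarrow> real"
  assumes bd: "\<And>k. \<bar>c k\<bar> \<le> 1" and z: "\<And>z. 0 \<le> z \<Longrightarrow> z < 1 \<Longrightarrow> (\<lambda>k. c k * z ^ k) sums 0"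
  shows "c k = 0"
proof (induction k rule: less_induct)
  case (less k)
  define b where "b n = c (n + k)" for n
  have sm: "(\<lambda>n. b n * x ^ n) sums (\<Sum>n. b n * x ^ n)" if "norm x < 1" for x :: real
  proof (rule summable_sums, rule summable_comparison_test')
    show "summable (\<lambda>n. \<bar>x\<bar> ^ n)" using that by (simp add: summable_geometric)
    show "norm (b n * x ^ n) \<le> \<bar>x\<bar> ^ n" for n
      using bd by (auto simp: abs_mult power_abs b_def intro: mult_left_le_one_le)
  qed
  have lim: "((\<lambda>x. \<Sum>n. b n * x ^ n) \<longlongrightarrow> b 0) (at 0)"
    by (rule powser_limit_0[of 1]) (use sm in auto)
  have 0: "(\<Sum>n. b n * x ^ n) = 0" if "0 < x" "x < 1" for x
  proof -
    have "(\<lambda>n. c n * x ^ n) sums 0" using z that by simp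
    moreover have "(\<Sum>i<k. c i * x ^ i) = 0" using less by simp
    ultimately have "(\<lambda>n. c (n + k) * x ^ (n + k)) sums 0"
      using sums_split_initial_segment[of "\<lambda>n. c n * x ^ n" 0 k] by simp
    then have "(\<lambda>n. x ^ k * (b n * x ^ n)) sums (x ^ k * 0)"
      by (simp add: b_def power_add mult_ac)
    then have "(\<lambda>n. b n * x ^ n) sums 0"
      using that by (subst (asm) sums_mult_iff) auto
    then show ?thesis by (simp add: sums_iff)
  qed
  have "((\<lambda>x. \<Sum>n. b n * x ^ n) \<longlongrightarrow> b 0) (at_right 0)"
    using lim by (simp add: filterlim_at_split)
  moreover have "((\<lambda>x. \<Sum>n. b n * x ^ n) \<longlongrightarrow> 0) (at_right 0)"
    using 0 by (intro tendsto_eventually eventually_at_rightI[of 0 1]) auto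
  ultimately have "b 0 = 0" using tendsto_unique by (metis trivial_limit_at_right_real)
  then show ?case by (simp add: b_def)
qed

lemma poisson_of_pgf:
  assumes M: "prob_space M" and N[measurable]: "N \<in> measurable M (count_space UNIV)" and a: "a \<ge> 0"
    and pgf: "\<And>v. 0 \<le> v \<Longrightarrow> v \<le> 1 \<Longrightarrow> (\<integral>\<^sup>+ s. ennreal (v ^ N s) \<partial>M) = ennreal (exp (- a * (1 - v)))"
  shows "measure M {s\<in>space M. N s = k} = a ^ k / fact k * exp (- a)"
proof -
  interpret prob_space M by fact
  let ?q = "\<lambda>k. a ^ k / fact k * exp (- a)"
  have q: "(\<lambda>k. ?q k * v ^ k) sums exp (- a * (1 - v))" for v by (rule sums_poisson_pgf)
  have q1: "0 \<le> ?q k" "?q k \<le> 1" for k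
  proof -
    show 0: "0 \<le> ?q k" for k using a by simp
    have s: "?q sums 1" using q[of 1] by simp
    show "?q k \<le> 1" using sum_le_suminf[of ?q "{k}"] s 0 sums_unique[OF s] by (simp add: sums_iff)
  qed
  have p: "(\<lambda>k. measure M {s\<in>space M. N s = k} * v ^ k) sums exp (- a * (1 - v))" if v: "0 \<le> v" "v \<le> 1" for v
  proof -
    have "(\<Sum>k. ennreal (measure M {s\<in>space M. N s = k} * v ^ k)) = ennreal (exp (- a * (1 - v)))"
      using pgf[OF v] unfolding nn_integral_power_count[OF M N v(1)] .
    moreover have "(\<lambda>k. ennreal (measure M {s\<in>space M. N s = k} * v ^ k)) sums
        (\<Sum>k. ennreal (measure M {s\<in>space M. N s = k} * v ^ k))"
      by (rule summable_sums[OF summableI])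
    ultimately have "(\<lambda>k. ennreal (measure M {s\<in>space M. N s = k} * v ^ k)) sums ennreal (exp (- a * (1 - v)))"
      by simp
    then show ?thesis by (rule sums_ennreal[THEN iffD1, rotated 2]) (use v in auto)
  qed
  have "measure M {s\<in>space M. N s = k} - ?q k = 0"
  proof (rule power_series_eq_0_on_unit_interval[where c="\<lambda>k. measure M {s\<in>space M. N s = k} - ?q k"])
    show "\<bar>measure M {s\<in>space M. N s = k} - ?q k\<bar> \<le> 1" for k
      using q1[of k] prob_le_1[of "{s\<in>space M. N s = k}"] measure_nonneg[of M "{s\<in>space M. N s = k}"] by linarith
    show "(\<lambda>k. (measure M {s\<in>space M. N s = k} - ?q k) * z ^ k) sums 0" if "0 \<le> z" "z < 1" for z
      using sums_diff[OF p[of z] q[of z]] that by (simp add: algebra_simps)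
  qed
  then show ?thesis by simp
qed

text \<open>Independence comes for free from the one-dimensional laws. The void probabilities
  \<open>exp (- \<rho> |B|)\<close> are multiplicative over disjoint sets, so void events inside
  disjoint regions are independent; they are stable under intersection and generate the counts of
  their regions, so the counts are independent too.\<close>

lemma poisson_processI:
  fixes \<eta> :: "'s \<Rightarrow> (real^'n) set"
  assumes M: "prob_space M" and \<rho>: "\<rho> \<ge> 0"
    and lf: "\<And>s. s \<in> space M \<Longrightarrow> locally_finite_set (\<eta> s)"
    and meas: "\<And>B. B \<in> sets borel \<Longrightarrow> bounded B \<Longrightarrow> (\<lambda>s. card (\<eta> s \<inter> B)) \<in> measurable M (count_space UNIV)"
    and pgf: "\<And>B v. B \<in> sets borel \<Longrightarrow> bounded B \<Longrightarrow> 0 \<le> v \<Longrightarrow> v \<le> 1 \<Longrightarrow>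
      (\<integral>\<^sup>+ s. ennreal (v ^ card (\<eta> s \<inter> B)) \<partial>M) = ennreal (exp (- (\<rho> * measure lborel B) * (1 - v)))"
  shows "poisson_process M \<rho> \<eta>"
proof -
  interpret prob_space M by fact
  have poi: "prob {s\<in>space M. card (\<eta> s \<inter> B) = k} = (\<rho> * measure lborel B) ^ k / fact k * exp (- (\<rho> * measure lborel B))"
    if "B \<in> sets borel" "bounded B" for B k
    using that \<rho> by (intro poisson_of_pgf M meas pgf) auto
  have fin: "finite (\<eta> s \<inter> B)" if "s \<in> space M" "bounded B" for s B
    using lf that by (auto simp: locally_finite_set_def)
  let ?V = "\<lambda>A. {s\<in>space M. \<eta> s \<inter> A = {}}"
  have V0: "?V A = {s\<in>space M. card (\<eta> s \<inter> A) = 0}" if "bounded A" for A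
    using fin that by auto
  have V: "prob (?V A) = exp (- (\<rho> * measure lborel A))" if "A \<in> sets borel" "bounded A" for A
    using poi[OF that, of 0] that by (simp add: V0)
  have Vev: "?V A \<in> events" if "A \<in> sets borel" "bounded A" for A
    unfolding V0[OF that(2)] using meas[OF that] by measurable
  have "indep_vars (\<lambda>_. count_space UNIV) (\<lambda>i s. card (\<eta> s \<inter> B i)) {..<m}"
    if B: "\<forall>i<m. B i \<in> sets borel \<and> bounded (B i)" and disj: "disjoint_family_on B {..<m}"
    for B :: "nat \<Rightarrow> (real^'n) set" and m
  proof -
    define G where "G i = {?V A' | A'. A' \<in> sets borel \<and> A' \<subseteq> B i}" for i
    have "indep_sets G {..<m}"
    proof (rule indep_setsI)
      show "G i \<subseteq> events" if "i \<in> {..<m}" for i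
        using that B Vev unfolding G_def by (auto intro: bounded_subset)
    next
      fix A and J :: "nat set" assume J: "J \<noteq> {}" "J \<subseteq> {..<m}" "finite J" "\<forall>j\<in>J. A j \<in> G j"
      then have "\<forall>j\<in>J. \<exists>A'. A j = ?V A' \<and> A' \<in> sets borel \<and> A' \<subseteq> B j" by (auto simp: G_def)
      from bchoice[OF this] obtain A' where
        "\<forall>j\<in>J. A j = ?V (A' j) \<and> A' j \<in> sets borel \<and> A' j \<subseteq> B j" ..
      then have A': "\<And>j. j \<in> J \<Longrightarrow> A j = ?V (A' j)" "\<And>j. j \<in> J \<Longrightarrow> A' j \<in> sets borel"
        "\<And>j. j \<in> J \<Longrightarrow> A' j \<subseteq> B j" by auto
      have bA: "bounded (A' j)" if "j \<in> J" for j using A'(3)[OF that] B J that by (auto intro: bounded_subset)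
      have "(\<Inter>j\<in>J. A j) = ?V (\<Union>j\<in>J. A' j)" using J(1) A'(1) by auto
      then have "prob (\<Inter>j\<in>J. A j) = exp (- (\<rho> * measure lborel (\<Union>j\<in>J. A' j)))"
        using A'(2) bA J(3) by (simp only:) (intro V sets.finite_UN bounded_UN ballI; simp)
      also have "measure lborel (\<Union>j\<in>J. A' j) = (\<Sum>j\<in>J. measure lborel (A' j))"
      proof (rule measure_finite_Union)
        show "disjoint_family_on A' J"
          using disj A'(3) J(2) unfolding disjoint_family_on_def by blast
        show "emeasure lborel (A' j) \<noteq> \<infinity>" if "j \<in> J" for j
          using emeasure_bounded_finite[OF bA[OF that]] by auto
      qed (use J A' in auto)
      also have "exp (- (\<rho> * (\<Sum>j\<in>J. measure lborel (A' j)))) = (\<Prod>j\<in>J. exp (- (\<rho> * measure lborel (A' j))))"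
        by (simp add: sum_distrib_left sum_negf[symmetric] exp_sum J)
      also have "\<dots> = (\<Prod>j\<in>J. prob (A j))"
        using A' bA by (intro prod.cong) (auto simp: V)
      finally show "prob (\<Inter>j\<in>J. A j) = (\<Prod>j\<in>J. prob (A j))" .
    qed
    then have "indep_sets (\<lambda>i. sigma_sets (space M) (G i)) {..<m}"
    proof (rule indep_sets_sigma)
      show "Int_stable (G i)" for i
      proof (rule Int_stableI)
        fix a b assume "a \<in> G i" "b \<in> G i"
        then obtain A1 A2 where "a = ?V A1" "b = ?V A2" "A1 \<in> sets borel" "A2 \<in> sets borel" "A1 \<subseteq> B i" "A2 \<subseteq> B i"
          by (auto simp: G_def)
        moreover have "?V A1 \<inter> ?V A2 = ?V (A1 \<union> A2)" by auto
        ultimately show "a \<inter> b \<in> G i" unfolding G_def by (intro CollectI exI[of _ "A1 \<union> A2"]) auto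
      qed
    qed
    then have "indep_sets (\<lambda>i. {(\<lambda>s. card (\<eta> s \<inter> B i)) -` A \<inter> space M |A. A \<in> sets (count_space UNIV)}) {..<m}"
    proof (rule indep_sets_mono_sets)
      fix i assume "i \<in> {..<m}"
      then have Bi: "B i \<in> sets borel" "bounded (B i)" using B by auto
      have GP: "G i \<subseteq> Pow (space M)" by (auto simp: G_def)
      interpret S: sigma_algebra "space M" "sigma_sets (space M) (G i)" by (rule sigma_algebra_sigma_sets[OF GP])
      have k: "{s\<in>space M. card (\<eta> s \<inter> B i) = k} \<in> sigma_sets (space M) (G i)" for k
        unfolding G_def using Bi fin by (intro card_eq_generated_by_voids) auto
      have "(\<lambda>s. card (\<eta> s \<inter> B i)) -` A \<inter> space M \<in> sigma_sets (space M) (G i)" for A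
      proof -
        have "(\<lambda>s. card (\<eta> s \<inter> B i)) -` A \<inter> space M = (\<Union>k\<in>A. {s\<in>space M. card (\<eta> s \<inter> B i) = k})" by auto
        also have "\<dots> \<in> sigma_sets (space M) (G i)" using k by (intro S.countable_UN'') auto
        finally show ?thesis .
      qed
      then show "{(\<lambda>s. card (\<eta> s \<inter> B i)) -` A \<inter> space M |A. A \<in> sets (count_space UNIV)} \<subseteq> sigma_sets (space M) (G i)"
        by auto
    qed
    then show ?thesis using B meas by (auto simp: indep_vars_def2)
  qed
  then show ?thesis unfolding poisson_process_def using M lf poi by blast
qed

section \<open>Existence of the Poisson process\<close>

lemma nn_integral_PiM_finite_prod:
  assumes "\<And>i. i \<in> I \<Longrightarrow> prob_space (M i)" and J: "finite J" "J \<subseteq> I"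
    and f: "\<And>i. i \<in> J \<Longrightarrow> f i \<in> borel_measurable (M i)"
  shows "(\<integral>\<^sup>+ u. (\<Prod>i\<in>J. f i (u i)) \<partial>PiM I M) = (\<Prod>i\<in>J. integral\<^sup>N (M i) (f i))"
proof -
  \<comment> \<open>Outside \<open>I\<close> nothing is known about \<open>M\<close>; a Dirac
    measure as filler makes every member of the family a probability space, as the locale of
    infinite products demands.\<close>
  define M' where "M' i = (if i \<in> I then M i else return (count_space UNIV) undefined)" for i
  have M': "prob_space (M' i)" for i
    using assms(1) by (auto simp: M'_def intro!: prob_space_return)
  interpret product_prob_space M' I
    by (intro product_prob_spaceI M')
  have eq: "PiM I M = PiM I M'" by (intro PiM_cong) (auto simp: M'_def)
  have fm: "f i \<in> borel_measurable (M' i)" if "i \<in> J" for i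
    using f J that by (auto simp: M'_def)
  have "(\<integral>\<^sup>+ u. (\<Prod>i\<in>J. f i (u i)) \<partial>PiM J M')
    = (\<integral>\<^sup>+ u. (\<Prod>i\<in>J. f i (u i)) \<partial>distr (PiM I M') (PiM J M') (\<lambda>x. restrict x J))"
    by (simp only: distr_PiM_restrict_finite[OF J])
  also have "\<dots> = (\<integral>\<^sup>+ x. (\<Prod>i\<in>J. f i (restrict x J i)) \<partial>PiM I M')"
  proof (rule nn_integral_distr)
    show "(\<lambda>x. restrict x J) \<in> measurable (PiM I M') (PiM J M')"
      using J by (intro measurable_restrict_subset) auto
    show "(\<lambda>u. \<Prod>i\<in>J. f i (u i)) \<in> borel_measurable (distr (PiM I M') (PiM J M') (\<lambda>x. restrict x J))"
      unfolding distr_PiM_restrict_finite[OF J] using fm J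
      by (intro borel_measurable_prod_ennreal measurable_compose[OF measurable_component_singleton]) auto
  qed
  also have "\<dots> = (\<integral>\<^sup>+ u. (\<Prod>i\<in>J. f i (u i)) \<partial>PiM I M')" by simp
  finally have "(\<integral>\<^sup>+ u. (\<Prod>i\<in>J. f i (u i)) \<partial>PiM J M') = (\<integral>\<^sup>+ u. (\<Prod>i\<in>J. f i (u i)) \<partial>PiM I M')" .
  moreover have "(\<integral>\<^sup>+ u. (\<Prod>i\<in>J. f i (u i)) \<partial>PiM J M') = (\<Prod>i\<in>J. integral\<^sup>N (M' i) (f i))"
    using J fm by (intro product_nn_integral_prod) auto
  moreover have "(\<Prod>i\<in>J. integral\<^sup>N (M' i) (f i)) = (\<Prod>i\<in>J. integral\<^sup>N (M i) (f i))"
    using J by (intro prod.cong) (auto simp: M'_def)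
  ultimately show ?thesis using eq by simp
qed

section \<open>Unit annuli and the independent cloud of uniform points\<close>

definition annulus :: "nat \<Rightarrow> (real^'n) set" where
  "annulus k = {x. real k \<le> norm x \<and> norm x < real k + 1}"

lemma annulus_sets [measurable]: "annulus k \<in> sets borel"
  unfolding annulus_def by measurable

lemma bounded_annulus: "bounded (annulus k)"
  by (rule bounded_subset[of "ball 0 (real k + 1)"]) (auto simp: annulus_def)

lemma disjoint_annuli: "disjoint_family annulus"
  by (auto simp: disjoint_family_on_def annulus_def)

text \<open>A ball of radius 1/2 centred on the middle sphere fits into every annulus. The bound is
  uniform in k, which later gives a common bound below 1 on the probability that an annulus is
  empty.\<close>

lemma content_annulus_ge:
  "measure lborel (ball (0 :: real^'n) (1/2)) \<le> measure lborel (annulus k :: (real^'n) set)"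
proof -
  obtain c :: "real^'n" where c: "norm c = real k + 1/2"
    using vector_choose_size[of "real k + 1/2"] by auto
  have "ball c (1/2) \<subseteq> annulus k"
  proof
    fix x assume "x \<in> ball c (1/2)"
    then have "norm (c - x) < 1/2" by (simp add: dist_norm)
    then show "x \<in> annulus k"
      using norm_triangle_ineq2[of c x] norm_triangle_ineq2[of x c] c
      by (auto simp: annulus_def norm_minus_commute)
  qed
  then have "measure lborel (ball c (1/2)) \<le> measure lborel (annulus k :: (real^'n) set)"
    using emeasure_bounded_finite[OF bounded_annulus, of k] by (intro measure_mono_fmeasurable) (auto simp: fmeasurable_def)
  then show ?thesis by (simp add: content_ball)
qed

lemma content_annulus_pos: "measure lborel (annulus k :: (real^'n) set) > 0"
  by (rule less_le_trans[OF content_ball_pos content_annulus_ge]) simp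

lemma emeasure_annulus: "emeasure lborel (annulus k :: (real^'n) set) = ennreal (measure lborel (annulus k :: (real^'n) set))"
proof (rule emeasure_eq_ennreal_measure)
  have "emeasure lborel (annulus k :: (real^'n) set) < \<infinity>"
    by (rule emeasure_bounded_finite[OF bounded_annulus])
  then show "emeasure lborel (annulus k :: (real^'n) set) \<noteq> \<top>" by auto
qed

lemma emeasure_annulus_Int:
  fixes B :: "(real^'n) set"
  shows "emeasure lborel (annulus k \<inter> B) \<noteq> \<top>"
proof -
  have "emeasure lborel (annulus k \<inter> B) < \<infinity>"
    by (rule emeasure_bounded_finite[OF bounded_subset[OF bounded_annulus Int_lower1]])
  then show ?thesis by auto
qed

definition annulus_count :: "'n::finite itself \<Rightarrow> real \<Rightarrow> nat \<Rightarrow> nat pmf" where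
  "annulus_count _ \<rho> k = poisson_pmf (\<rho> * measure lborel (annulus k :: (real^'n) set))"

definition annulus_point :: "nat \<Rightarrow> (real^'n) measure" where
  "annulus_point m = uniform_measure lborel (annulus (fst (prod_decode m)))"

text \<open>The annulus \<open>k\<close> receives the points \<open>u (prod_encode (k, i))\<close> with \<open>i < N k\<close>, where the
  number \<open>N k\<close> is Poisson and the \<open>u\<close> are independent and uniform.\<close>

definition cloud :: "real \<Rightarrow> ((nat \<Rightarrow> nat) \<times> (nat \<Rightarrow> real^'n)) measure" where
  "cloud \<rho> = (\<Pi>\<^sub>M k\<in>UNIV. measure_pmf (annulus_count TYPE('n) \<rho> k)) \<Otimes>\<^sub>M (\<Pi>\<^sub>M m\<in>UNIV. annulus_point m)"

definition cloud_index :: "(nat \<Rightarrow> nat) \<Rightarrow> nat set" where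
  "cloud_index N = {m. snd (prod_decode m) < N (fst (prod_decode m))}"

lemma prob_space_annulus_point: "prob_space (annulus_point m :: (real^'n) measure)"
  unfolding annulus_point_def
  using content_annulus_pos[of "fst (prod_decode m)", where 'n='n]
  by (intro prob_space_uniform_measure) (auto simp: emeasure_annulus)

lemma sets_annulus_point [simp, measurable_cong]: "sets (annulus_point m) = sets borel"
  by (simp add: annulus_point_def)

lemma space_annulus_point [simp]: "space (annulus_point m) = UNIV"
  by (simp add: annulus_point_def)

lemma pmf_annulus_count:
  assumes "\<rho> > 0"
  shows "pmf (annulus_count TYPE('n::finite) \<rho> k) n =
    (\<rho> * measure lborel (annulus k :: (real^'n) set)) ^ n / fact n * exp (- (\<rho> * measure lborel (annulus k :: (real^'n) set)))"
  using assms content_annulus_pos[of k, where 'n='n] unfolding annulus_count_def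
  by (intro pmf_poisson) simp

text \<open>One uniform point of annulus k falls into \<open>B\<close> with probability
  \<open>p\<close>; this is its contribution to the generating function of the number of points in
  \<open>B\<close>.\<close>

lemma nn_integral_annulus_point_step:
  fixes B :: "(real^'n) set" and m :: nat and v :: real
  assumes B[measurable]: "B \<in> sets borel" and v: "0 \<le> v" "v \<le> 1"
  defines "k \<equiv> fst (prod_decode m)"
  defines "p \<equiv> measure lborel (B \<inter> annulus k) / measure lborel (annulus k :: (real^'n) set)"
  shows "(\<integral>\<^sup>+ x. ennreal (if x \<in> B then v else 1) \<partial>annulus_point m) = ennreal (1 - (1 - v) * p)"
    and "0 \<le> 1 - (1 - v) * p"
proof -
  interpret prob_space "annulus_point m :: (real^'n) measure" by (rule prob_space_annulus_point)
  have e: "emeasure (annulus_point m) B = ennreal p"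
  proof -
    have "emeasure (annulus_point m) B = emeasure lborel (annulus k \<inter> B) / emeasure lborel (annulus k :: (real^'n) set)"
      unfolding annulus_point_def k_def by (subst emeasure_uniform_measure) auto
    also have "emeasure lborel (annulus k \<inter> B) = ennreal (measure lborel (annulus k \<inter> B))"
      by (rule emeasure_eq_ennreal_measure[OF emeasure_annulus_Int])
    finally show ?thesis
      unfolding emeasure_annulus p_def using content_annulus_pos[of k, where 'n='n]
      by (simp add: divide_ennreal Int_commute)
  qed
  then have mp: "prob B = p"
    using content_annulus_pos[of k, where 'n='n] by (simp add: measure_def p_def)
  have p: "0 \<le> p" "p \<le> 1" using mp prob_le_1[of B] by auto
  have "(1 - v) * p \<le> 1" using v p by (intro mult_le_one) auto
  then show nn: "0 \<le> 1 - (1 - v) * p" by simp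
  have "(\<integral>\<^sup>+ x. ennreal (if x \<in> B then v else 1) \<partial>annulus_point m)
    = (\<integral>\<^sup>+ x. ennreal v * indicator B x + indicator (- B) x \<partial>annulus_point m)"
    by (intro nn_integral_cong) (auto simp: indicator_def)
  also have "\<dots> = ennreal v * emeasure (annulus_point m) B + emeasure (annulus_point m) (- B)"
    by (subst nn_integral_add)
      (auto simp: nn_integral_cmult_indicator intro!: borel_measurable_times_ennreal borel_measurable_indicator)
  also have "emeasure (annulus_point m) (- B) = ennreal (1 - p)"
    using prob_compl[of B] mp by (simp add: emeasure_eq_measure Compl_eq_Diff_UNIV)
  also have "ennreal v * emeasure (annulus_point m) B + ennreal (1 - p) = ennreal (v * p + (1 - p))"
    using v p by (simp add: e ennreal_mult' ennreal_plus)
  also have "v * p + (1 - p) = 1 - (1 - v) * p" by (simp add: algebra_simps)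
  finally show "(\<integral>\<^sup>+ x. ennreal (if x \<in> B then v else 1) \<partial>annulus_point m) = ennreal (1 - (1 - v) * p)" .
qed

definition cloud_upto :: "(nat \<Rightarrow> nat) \<Rightarrow> nat \<Rightarrow> nat set" where
  "cloud_upto N K = prod_encode ` (SIGMA k:{..<K}. {..<N k})"

lemma finite_cloud_upto [simp]: "finite (cloud_upto N K)"
  by (simp add: cloud_upto_def)

lemma mem_cloud_upto: "m \<in> cloud_upto N K \<longleftrightarrow> m \<in> cloud_index N \<and> fst (prod_decode m) < K"
proof
  assume "m \<in> cloud_index N \<and> fst (prod_decode m) < K"
  then have "prod_decode m \<in> (SIGMA k:{..<K}. {..<N k})" by (cases "prod_decode m") (auto simp: cloud_index_def)
  then have "prod_encode (prod_decode m) \<in> cloud_upto N K" unfolding cloud_upto_def by (rule imageI)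
  then show "m \<in> cloud_upto N K" by simp
qed (auto simp: cloud_upto_def cloud_index_def)

lemma prod_cloud_upto:
  "(\<Prod>m\<in>cloud_upto N K. f m) = (\<Prod>k<K. \<Prod>i<N k. f (prod_encode (k, i)))"
proof -
  have "(\<Prod>m\<in>cloud_upto N K. f m) = (\<Prod>p\<in>(SIGMA k:{..<K}. {..<N k}). f (prod_encode p))"
    unfolding cloud_upto_def by (subst prod.reindex) (auto intro: inj_on_subset[OF inj_prod_encode])
  also have "\<dots> = (\<Prod>k<K. \<Prod>i<N k. f (prod_encode (k, i)))"
    by (subst prod.Sigma) (auto simp: case_prod_beta)
  finally show ?thesis .
qed

lemma sets_PiM_annulus_count [measurable_cong]:
  "sets (\<Pi>\<^sub>M k\<in>UNIV. measure_pmf (annulus_count d \<rho> k)) = sets (\<Pi>\<^sub>M k\<in>UNIV. count_space UNIV)"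
  by (intro sets_PiM_cong) auto

lemma sets_PiM_annulus_point [measurable_cong]:
  "sets (\<Pi>\<^sub>M m\<in>UNIV. annulus_point m) = sets (\<Pi>\<^sub>M m\<in>(UNIV::nat set). borel)"
  by (intro sets_PiM_cong) auto

lemma cloud_measurable [measurable]:
  "(\<lambda>w. fst w k) \<in> measurable (cloud \<rho>) (count_space UNIV)"
  "(\<lambda>w. snd w m) \<in> measurable (cloud \<rho>) borel"
proof -
  show "(\<lambda>w. fst w k) \<in> measurable (cloud \<rho>) (count_space UNIV)"
    unfolding cloud_def
    by (rule measurable_compose[OF measurable_fst])
      (simp add: measurable_cong_sets[OF sets_PiM_annulus_count refl])
  show "(\<lambda>w. snd w m) \<in> measurable (cloud \<rho>) borel"
    unfolding cloud_def
    by (rule measurable_compose[OF measurable_snd])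
      (simp add: measurable_cong_sets[OF sets_PiM_annulus_point refl])
qed

text \<open>Poisson thinning. Given the numbers \<open>N k\<close>, each point of annulus k lies in
  \<open>B\<close> with probability \<open>p k\<close>, so its annulus contributes the power
  \<open>(1 - (1 - v) * p k) ^ N k\<close>. Averaging over the Poisson number gives an exponential
  whose exponent involves only the volume of \<open>B\<close> inside the annulus, and these volumes
  add up because the ball of radius K is covered by the first K annuli.\<close>

lemma pgf_cloud_upto:
  fixes B :: "(real^'n) set"
  assumes \<rho>: "\<rho> > 0" and B: "B \<in> sets borel" "B \<subseteq> ball 0 (real K)" and v: "0 \<le> v" "v \<le> 1"
  shows "(\<integral>\<^sup>+ w. ennreal (v ^ card {m \<in> cloud_upto (fst w) K. snd w m \<in> B}) \<partial>cloud \<rho>)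
    = ennreal (exp (- (\<rho> * measure lborel B) * (1 - v)))"
proof -
  note [measurable] = B(1)
  let ?P = "\<lambda>k. measure_pmf (annulus_count TYPE('n) \<rho> k)"
  let ?U = "\<lambda>m. annulus_point m :: (real^'n) measure"
  interpret U: product_prob_space ?U UNIV
    by (intro product_prob_spaceI prob_space_annulus_point)
  interpret P: product_prob_space ?P UNIV
    by (intro product_prob_spaceI prob_space_measure_pmf)
  let ?a = "\<lambda>k. measure lborel (annulus k :: (real^'n) set)"
  define p where "p k = measure lborel (B \<inter> annulus k) / ?a k" for k
  define h where "h x = (if x \<in> B then v else 1)" for x
  have h0: "0 \<le> h x" for x using v by (simp add: h_def)
  have [measurable]: "h \<in> borel_measurable borel" unfolding h_def by measurable
  have q0: "0 \<le> 1 - (1 - v) * p k" for k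
    using nn_integral_annulus_point_step(2)[OF B(1) v, of "prod_encode (k, 0)"] by (simp add: p_def)
  have pw: "v ^ card {m \<in> cloud_upto N K. u m \<in> B} = (\<Prod>k<K. \<Prod>i<N k. h (u (prod_encode (k, i))))" for N u
  proof -
    have "v ^ card {m \<in> cloud_upto N K. u m \<in> B} = (\<Prod>m\<in>cloud_upto N K. h (u m))"
      unfolding h_def by (subst prod.If_cases) (auto simp: Int_def intro!: arg_cong[where f="\<lambda>A. v ^ card A"])
    then show ?thesis by (simp add: prod_cloud_upto)
  qed
  have m1: "(\<lambda>w. ennreal (\<Prod>k<K. \<Prod>i<fst w k. h (snd w (prod_encode (k, i))))) \<in> borel_measurable (cloud \<rho> :: ((nat \<Rightarrow> nat) \<times> (nat \<Rightarrow> real^'n)) measure)"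
  proof -
    \<comment> \<open>The number of factors is itself random, so measurability is obtained by
      splitting according to the countably many values of \<open>fst w k\<close>.\<close>
    have "(\<lambda>w. \<Prod>i<fst w k. h (snd w (prod_encode (k, i)))) \<in> borel_measurable (cloud \<rho>)" for k
      by (rule measurable_compose_countable[where f="\<lambda>n w. \<Prod>i<n. h (snd w (prod_encode (k, i)))" and g="\<lambda>w. fst w k"])
        measurable
    then show ?thesis by measurable
  qed
  have "(\<integral>\<^sup>+ w. ennreal (v ^ card {m \<in> cloud_upto (fst w) K. snd w m \<in> B}) \<partial>cloud \<rho>)
     = (\<integral>\<^sup>+ N. \<integral>\<^sup>+ u. ennreal (\<Prod>k<K. \<Prod>i<N k. h (u (prod_encode (k, i)))) \<partial>PiM UNIV ?U \<partial>PiM UNIV ?P)"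
    unfolding pw using m1 unfolding cloud_def by (subst U.P.nn_integral_fst[symmetric]) auto
  also have "\<dots> = (\<integral>\<^sup>+ N. (\<Prod>k<K. ennreal ((1 - (1 - v) * p k) ^ N k)) \<partial>PiM UNIV ?P)"
  proof (rule nn_integral_cong)
    fix N :: "nat \<Rightarrow> nat"
    have "(\<integral>\<^sup>+ u. ennreal (\<Prod>k<K. \<Prod>i<N k. h (u (prod_encode (k, i)))) \<partial>PiM UNIV ?U)
      = (\<integral>\<^sup>+ u. (\<Prod>m\<in>cloud_upto N K. ennreal (h (u m))) \<partial>PiM UNIV ?U)"
      by (simp add: prod_cloud_upto prod_ennreal prod_nonneg h0)
    also have "\<dots> = (\<Prod>m\<in>cloud_upto N K. \<integral>\<^sup>+ x. ennreal (h x) \<partial>?U m)"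
    proof (rule nn_integral_PiM_finite_prod)
      show "(\<lambda>x. ennreal (h x)) \<in> borel_measurable (?U m)" for m
        unfolding measurable_cong_sets[OF sets_annulus_point refl] by measurable
    qed (auto intro: prob_space_annulus_point)
    also have "\<dots> = (\<Prod>m\<in>cloud_upto N K. ennreal (1 - (1 - v) * p (fst (prod_decode m))))"
      unfolding h_def p_def by (intro prod.cong refl nn_integral_annulus_point_step(1) B v)
    also have "\<dots> = (\<Prod>k<K. ennreal ((1 - (1 - v) * p k) ^ N k))"
      unfolding prod_cloud_upto using q0 by (simp add: ennreal_power)
    finally show "(\<integral>\<^sup>+ u. ennreal (\<Prod>k<K. \<Prod>i<N k. h (u (prod_encode (k, i)))) \<partial>PiM UNIV ?U)
      = (\<Prod>k<K. ennreal ((1 - (1 - v) * p k) ^ N k))" .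
  qed
  also have "\<dots> = (\<Prod>k<K. \<integral>\<^sup>+ n. ennreal ((1 - (1 - v) * p k) ^ n) \<partial>?P k)"
    by (rule nn_integral_PiM_finite_prod) (auto intro: prob_space_measure_pmf)
  also have "\<dots> = (\<Prod>k<K. ennreal (exp (- (\<rho> * ?a k) * (1 - (1 - (1 - v) * p k)))))"
  proof (intro prod.cong refl nn_integral_power_poisson_count[OF prob_space_measure_pmf _ _ q0])
    fix k n
    have "measure (?P k) {s. s = n} = pmf (annulus_count TYPE('n) \<rho> k) n"
      by (simp add: measure_pmf_single)
    then show "measure (?P k) {s \<in> space (?P k). s = n} = (\<rho> * ?a k) ^ n / fact n * exp (- (\<rho> * ?a k))"
      using pmf_annulus_count[OF \<rho>, of k n, where 'n='n] by simp
  qed (use \<rho> in auto)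
  also have "\<dots> = ennreal (\<Prod>k<K. exp (- (\<rho> * (1 - v)) * measure lborel (B \<inter> annulus k)))"
  proof (subst prod_ennreal)
    have "?a k * (1 - (1 - (1 - v) * p k)) = (1 - v) * measure lborel (B \<inter> annulus k)" for k
      using content_annulus_pos[of k, where 'n='n] by (simp add: p_def)
    then have "- (\<rho> * ?a k) * (1 - (1 - (1 - v) * p k)) = - (\<rho> * (1 - v)) * measure lborel (B \<inter> annulus k)" for k
      by (simp only: mult_minus_left mult.assoc)
    then show "ennreal (\<Prod>k<K. exp (- (\<rho> * ?a k) * (1 - (1 - (1 - v) * p k)))) =
      ennreal (\<Prod>k<K. exp (- (\<rho> * (1 - v)) * measure lborel (B \<inter> annulus k)))" by (simp only:)
  qed auto
  also have "(\<Prod>k<K. exp (- (\<rho> * (1 - v)) * measure lborel (B \<inter> annulus k)))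
     = exp (- (\<rho> * (1 - v)) * (\<Sum>k<K. measure lborel (B \<inter> annulus k)))"
    by (simp add: exp_sum[symmetric] sum_distrib_left)
  also have "(\<Sum>k<K. measure lborel (B \<inter> annulus k)) = measure lborel B"
  proof -
    have "B = (\<Union>k<K. B \<inter> annulus k)"
    proof -
      have "\<exists>k<K. x \<in> annulus k" if "x \<in> B" for x
      proof (intro exI conjI)
        have nx: "norm x < real K" using that B(2) by auto
        have f: "real (nat \<lfloor>norm x\<rfloor>) = real_of_int \<lfloor>norm x\<rfloor>" by simp
        show "x \<in> annulus (nat \<lfloor>norm x\<rfloor>)" unfolding annulus_def mem_Collect_eq f by linarith
        have "real (nat \<lfloor>norm x\<rfloor>) < real K" unfolding f using nx by linarith
        then show "nat \<lfloor>norm x\<rfloor> < K" by (simp only: of_nat_less_iff)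
      qed
      then show ?thesis by blast
    qed
    then have "measure lborel B = measure lborel (\<Union>k<K. B \<inter> annulus k)" by simp
    also have "\<dots> = (\<Sum>k<K. measure lborel (B \<inter> annulus k))"
    proof (rule measure_finite_Union)
      show "disjoint_family_on (\<lambda>k. B \<inter> annulus k) {..<K}"
        using disjoint_annuli unfolding disjoint_family_on_def by blast
      show "emeasure lborel (B \<inter> annulus k) \<noteq> \<infinity>" for k
        using emeasure_annulus_Int[of k B] by (simp add: Int_commute)
    qed auto
    finally show ?thesis by simp
  qed
  finally show ?thesis by (simp add: mult_ac)
qed

lemma AE_pair_fst:
  assumes "AE x in M1. P x" "sigma_finite_measure M2"
  shows "AE w in M1 \<Otimes>\<^sub>M M2. P (fst w)"
proof -
  interpret M2: sigma_finite_measure M2 by fact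
  from AE_E[OF assms(1)] obtain N where N: "{x \<in> space M1. \<not> P x} \<subseteq> N" "emeasure M1 N = 0" "N \<in> sets M1" by blast
  have "emeasure (M1 \<Otimes>\<^sub>M M2) (N \<times> space M2) = 0"
    using N by (subst M2.emeasure_pair_measure_Times) auto
  then show ?thesis using N
    by (intro AE_I[of _ _ "N \<times> space M2"]) (auto simp: space_pair_measure)
qed

lemma AE_pair_snd:
  assumes "AE y in M2. P y" "sigma_finite_measure M2"
  shows "AE w in M1 \<Otimes>\<^sub>M M2. P (snd w)"
proof -
  interpret M2: sigma_finite_measure M2 by fact
  from AE_E[OF assms(1)] obtain N where N: "{x \<in> space M2. \<not> P x} \<subseteq> N" "emeasure M2 N = 0" "N \<in> sets M2" by blast
  have "emeasure (M1 \<Otimes>\<^sub>M M2) (space M1 \<times> N) = 0"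
    using N by (subst M2.emeasure_pair_measure_Times) auto
  then show ?thesis using N
    by (intro AE_I[of _ _ "space M1 \<times> N"]) (auto simp: space_pair_measure)
qed

text \<open>With the value x of coordinate m fixed, the point m' is still uniform and has no atom at
  x; Fubini then makes the coincidence a null event.\<close>

lemma AE_annulus_points_distinct:
  assumes mm: "m \<noteq> m'"
  shows "AE u in (\<Pi>\<^sub>M m\<in>(UNIV::nat set). annulus_point m :: (real^'n) measure). u m \<noteq> u m'"
proof -
  let ?U = "\<lambda>m::nat. annulus_point m :: (real^'n) measure"
  let ?I = "UNIV - {m}"
  interpret U: product_prob_space ?U ?I
    by (intro product_prob_spaceI prob_space_annulus_point)
  interpret V: prob_space "PiM UNIV ?U" by (intro prob_space_PiM prob_space_annulus_point)
  \<comment> \<open>Reinserting coordinate m identifies the full product with the product of that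
    coordinate and all the others, which allows Fubini.\<close>
  have D: "distr (?U m \<Otimes>\<^sub>M PiM ?I ?U) (PiM UNIV ?U) (\<lambda>(x, X). X(m := x)) = PiM UNIV ?U"
    using distr_pair_PiM_eq_PiM[of ?I ?U m] by (simp add: prob_space_annulus_point insert_absorb)
  have cm: "(\<lambda>u. u i) \<in> measurable (PiM UNIV ?U) borel" for i
    unfolding measurable_cong_sets[OF sets_PiM_annulus_point refl] by simp
  have E: "{u \<in> space (PiM UNIV ?U). u m = u m'} \<in> sets (PiM UNIV ?U)"
    using cm by measurable
  have T: "(\<lambda>(x, X). X(m := x)) \<in> measurable (?U m \<Otimes>\<^sub>M PiM ?I ?U) (PiM UNIV ?U)"
    using measurable_fun_upd[of UNIV ?I m "\<lambda>w. snd w" "?U m \<Otimes>\<^sub>M PiM ?I ?U" ?U "\<lambda>w. fst w"]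
    by (auto simp: case_prod_beta' insert_absorb)
  let ?S = "(\<lambda>(x, X). X(m := x)) -` {u \<in> space (PiM UNIV ?U). u m = u m'} \<inter> space (?U m \<Otimes>\<^sub>M PiM ?I ?U)"
  have S: "?S \<in> sets (?U m \<Otimes>\<^sub>M PiM ?I ?U)" using T E by (rule measurable_sets)
  have "emeasure (PiM UNIV ?U) {u \<in> space (PiM UNIV ?U). u m = u m'} = emeasure (?U m \<Otimes>\<^sub>M PiM ?I ?U) ?S"
    using emeasure_distr[OF T E] unfolding D .
  also have "\<dots> = (\<integral>\<^sup>+ x. emeasure (PiM ?I ?U) (Pair x -` ?S) \<partial>?U m)"
    using S by (rule U.P.emeasure_pair_measure_alt)
  also have "\<dots> = (\<integral>\<^sup>+ x. 0 \<partial>?U m)"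
  proof (rule nn_integral_cong)
    fix x
    have "Pair x -` ?S \<subseteq> {X \<in> space (PiM ?I ?U). X m' \<in> {x}}"
      using mm by (auto simp: space_pair_measure)
    then have "emeasure (PiM ?I ?U) (Pair x -` ?S) \<le> emeasure (PiM ?I ?U) {X \<in> space (PiM ?I ?U). X m' \<in> {x}}"
    proof (rule emeasure_mono)
      have [measurable]: "(\<lambda>X. X m') \<in> measurable (PiM ?I ?U) borel"
        unfolding measurable_cong_sets[OF refl sets_annulus_point[of m', symmetric]]
        using mm by (intro measurable_component_singleton) auto
      show "{X \<in> space (PiM ?I ?U). X m' \<in> {x}} \<in> sets (PiM ?I ?U)" by measurable
    qed
    also have "\<dots> = emeasure (?U m') {x}"
      using mm by (intro U.emeasure_PiM_Collect_single) auto
    also have "\<dots> = 0"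
    proof -
      have "emeasure lborel (annulus k \<inter> {x}) \<le> emeasure lborel {x}" for k by (intro emeasure_mono) auto
      then show ?thesis unfolding annulus_point_def by (subst emeasure_uniform_measure) auto
    qed
    finally show "emeasure (PiM ?I ?U) (Pair x -` ?S) = 0" by simp
  qed
  finally have "emeasure (PiM UNIV ?U) {u \<in> space (PiM UNIV ?U). u m = u m'} = 0" by simp
  then show ?thesis using E by (intro AE_I[OF _ _ E]) auto
qed

text \<open>The probability that L consecutive annuli are all empty is at most \<open>q ^ L\<close>
  with a single q < 1. Infinitely many points are required because the process is to be enumerated
  injectively by the natural numbers.\<close>

lemma AE_annulus_count_infinite:
  assumes \<rho>: "\<rho> > 0"
  shows "AE N in (\<Pi>\<^sub>M k\<in>(UNIV::nat set). measure_pmf (annulus_count TYPE('n::finite) \<rho> k)). \<exists>k\<ge>K. N k \<noteq> 0"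
proof -
  let ?P = "\<lambda>k. measure_pmf (annulus_count TYPE('n) \<rho> k)"
  interpret P: product_prob_space ?P UNIV
    by (intro product_prob_spaceI prob_space_measure_pmf)
  define q where "q = exp (- (\<rho> * measure lborel (ball (0 :: real^'n) (1/2))))"
  have q: "0 < q" "q < 1" using \<rho> content_ball_pos[of "1/2" "0 :: real^'n"] by (auto simp: q_def)
  let ?S = "{N \<in> space (PiM UNIV ?P). \<forall>k\<ge>K. N k = 0}"
  have "emeasure (PiM UNIV ?P) ?S \<le> ennreal (q ^ L)" for L
  proof -
    have "emeasure (PiM UNIV ?P) ?S \<le> emeasure (PiM UNIV ?P) {N \<in> space (PiM UNIV ?P). \<forall>k\<in>{K..<K+L}. N k \<in> {0}}"
      by (intro emeasure_mono) auto
    also have "\<dots> = (\<Prod>k\<in>{K..<K+L}. emeasure (?P k) {0})"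
      by (intro P.emeasure_PiM_Collect) auto
    also have "\<dots> = (\<Prod>k\<in>{K..<K+L}. ennreal (exp (- (\<rho> * measure lborel (annulus k :: (real^'n) set)))))"
      using pmf_annulus_count[OF \<rho>, of _ 0, where 'n='n] by (simp add: emeasure_pmf_single)
    also have "\<dots> \<le> (\<Prod>k\<in>{K..<K+L}. ennreal q)"
      unfolding q_def using \<rho> content_annulus_ge by (intro prod_mono_ennreal) (simp add: ennreal_leI)
    also have "\<dots> = ennreal (q ^ L)" using q by (simp add: ennreal_power)
    finally show ?thesis .
  qed
  moreover have "(\<lambda>L. ennreal (q ^ L)) \<longlonglongrightarrow> ennreal 0"
    using q by (intro tendsto_ennrealI LIMSEQ_realpow_zero) auto
  ultimately have "emeasure (PiM UNIV ?P) ?S \<le> ennreal 0"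
    by (intro LIMSEQ_le_const) auto
  then show ?thesis
    by (intro AE_I[where N="?S"]) auto
qed

text \<open>The almost sure event on which the cloud can be enumerated. The last conjunct has to be
  demanded explicitly, since the product space also contains sequences that leave their annuli; it
  is what ties a bounded region to finitely many indices.\<close>

definition cloud_good :: "(nat \<Rightarrow> nat) \<times> (nat \<Rightarrow> real^'n) \<Rightarrow> bool" where
  "cloud_good w \<longleftrightarrow> (\<forall>m m'. m \<noteq> m' \<longrightarrow> snd w m \<noteq> snd w m') \<and>
     (\<forall>K. \<exists>k\<ge>K. fst w k \<noteq> 0) \<and> (\<forall>m. snd w m \<in> annulus (fst (prod_decode m)))"

lemma cloud_good_measurable [measurable]: "Measurable.pred (cloud \<rho>) cloud_good"
  unfolding cloud_good_def by measurable

lemma prob_space_cloud: "prob_space (cloud \<rho>)"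
  unfolding cloud_def
  by (intro prob_space_pair prob_space_PiM prob_space_measure_pmf prob_space_annulus_point)

lemma AE_cloud_good:
  assumes "\<rho> > 0"
  shows "AE w in (cloud \<rho> :: ((nat \<Rightarrow> nat) \<times> (nat \<Rightarrow> real^'n)) measure). cloud_good w"
proof -
  interpret U: prob_space "PiM UNIV annulus_point :: (nat \<Rightarrow> real^'n) measure"
    by (intro prob_space_PiM prob_space_annulus_point)
  have 1: "AE u in (\<Pi>\<^sub>M m\<in>(UNIV::nat set). annulus_point m :: (real^'n) measure). \<forall>m m'. m \<noteq> m' \<longrightarrow> u m \<noteq> u m'"
    using AE_annulus_points_distinct by (auto simp: AE_all_countable)
  have 2: "AE u in (\<Pi>\<^sub>M m\<in>(UNIV::nat set). annulus_point m :: (real^'n) measure). \<forall>m. u m \<in> annulus (fst (prod_decode m))"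
    unfolding AE_all_countable
  proof
    fix m
    have "AE x in (annulus_point m :: (real^'n) measure). x \<in> annulus (fst (prod_decode m))"
      unfolding annulus_point_def by (rule AE_uniform_measureI) auto
    then show "AE u in (\<Pi>\<^sub>M m\<in>(UNIV::nat set). annulus_point m :: (real^'n) measure). u m \<in> annulus (fst (prod_decode m))"
      by (intro AE_PiM_component prob_space_annulus_point) auto
  qed
  have 3: "AE N in (\<Pi>\<^sub>M k\<in>(UNIV::nat set). measure_pmf (annulus_count TYPE('n) \<rho> k)). \<forall>K. \<exists>k\<ge>K. N k \<noteq> 0"
    using AE_annulus_count_infinite[OF assms] by (auto simp: AE_all_countable)
  show ?thesis
    using AE_pair_snd[OF 1 U.sigma_finite_measure_axioms, of "\<Pi>\<^sub>M k\<in>UNIV. measure_pmf (annulus_count TYPE('n) \<rho> k)"]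
      AE_pair_snd[OF 2 U.sigma_finite_measure_axioms, of "\<Pi>\<^sub>M k\<in>UNIV. measure_pmf (annulus_count TYPE('n) \<rho> k)"]
      AE_pair_fst[OF 3 U.sigma_finite_measure_axioms]
    unfolding cloud_def by eventually_elim (auto simp: cloud_good_def)
qed

text \<open>This is \<open>enumerate\<close> of \<open>cloud_index N\<close> when that set is
  infinite. Spelling out the recursion with \<open>LEAST\<close> lets measurability in the cloud be
  proved by induction on the index.\<close>

fun cloud_nth :: "(nat \<Rightarrow> nat) \<Rightarrow> nat \<Rightarrow> nat" where
  "cloud_nth N 0 = (LEAST m. m \<in> cloud_index N)"
| "cloud_nth N (Suc j) = (LEAST m. m \<in> cloud_index N \<and> cloud_nth N j < m)"

lemma cloud_nth_eq_enumerate: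
  assumes "infinite (cloud_index N)"
  shows "cloud_nth N = enumerate (cloud_index N)"
proof
  fix j show "cloud_nth N j = enumerate (cloud_index N) j"
    by (induction j) (use assms in \<open>auto simp: enumerate_0 enumerate_Suc''\<close>)
qed

lemma measurable_cloud_nth [measurable]:
  "(\<lambda>w. cloud_nth (fst w) j) \<in> measurable (cloud \<rho>) (count_space UNIV)"
proof (induction j)
  case 0
  show ?case unfolding cloud_nth.simps cloud_index_def mem_Collect_eq by measurable
next
  case (Suc j)
  note [measurable] = Suc
  show ?case unfolding cloud_nth.simps cloud_index_def mem_Collect_eq by measurable
qed

lemma cloud_good_infinite:
  assumes "cloud_good w"
  shows "infinite (cloud_index (fst w))"
proof
  assume "finite (cloud_index (fst w))"
  then have "finite ((\<lambda>m. fst (prod_decode m)) ` cloud_index (fst w))" by simp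
  moreover have "{k. fst w k \<noteq> 0} \<subseteq> (\<lambda>m. fst (prod_decode m)) ` cloud_index (fst w)"
  proof
    fix k assume "k \<in> {k. fst w k \<noteq> 0}"
    then have "prod_encode (k, 0) \<in> cloud_index (fst w)" by (simp add: cloud_index_def)
    then show "k \<in> (\<lambda>m. fst (prod_decode m)) ` cloud_index (fst w)" by (rule rev_image_eqI) simp
  qed
  ultimately have "finite {k. fst w k \<noteq> 0}" using finite_subset by blast
  then show False using assms by (auto simp: cloud_good_def finite_nat_set_iff_bounded) (meson leD)
qed

text \<open>The values must be injective and locally finite for every w, not only almost surely, in
  order to define a map into \<open>enumeration_space\<close>. The equally spaced points on an axis
  are a default for the null event where \<open>cloud_good\<close> fails.\<close>

definition cloud_enum :: "(nat \<Rightarrow> nat) \<times> (nat \<Rightarrow> real^'n) \<Rightarrow> nat \<Rightarrow> real^'n" where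
  "cloud_enum w = (if cloud_good w then (\<lambda>j. snd w (cloud_nth (fst w) j)) else (\<lambda>j. real j *\<^sub>R axis undefined 1))"

lemma range_cloud_enum:
  assumes "cloud_good w"
  shows "range (cloud_enum w) = snd w ` cloud_index (fst w)"
proof -
  have "range (cloud_nth (fst w)) = cloud_index (fst w)"
    using cloud_good_infinite[OF assms] by (simp add: cloud_nth_eq_enumerate range_enumerate)
  then show ?thesis using assms by (simp add: cloud_enum_def image_image[symmetric])
qed

lemma card_range_cloud_enum_Int:
  assumes w: "cloud_good w" and B: "B \<subseteq> ball 0 (real K)"
  shows "finite (range (cloud_enum w) \<inter> B)"
    and "card (range (cloud_enum w) \<inter> B) = card {m \<in> cloud_upto (fst w) K. snd w m \<in> B}"
proof -
  have "fst (prod_decode m) < K" if "snd w m \<in> B" for m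
  proof -
    have "real (fst (prod_decode m)) \<le> norm (snd w m)" using w by (auto simp: cloud_good_def annulus_def)
    also have "\<dots> < real K" using that B by auto
    finally show ?thesis by simp
  qed
  then have eq: "range (cloud_enum w) \<inter> B = snd w ` {m \<in> cloud_upto (fst w) K. snd w m \<in> B}"
    by (auto simp: range_cloud_enum[OF w] mem_cloud_upto)
  show "finite (range (cloud_enum w) \<inter> B)" unfolding eq by simp
  have "inj_on (snd w) {m \<in> cloud_upto (fst w) K. snd w m \<in> B}"
    using w by (auto simp: cloud_good_def inj_on_def)
  then show "card (range (cloud_enum w) \<inter> B) = card {m \<in> cloud_upto (fst w) K. snd w m \<in> B}"
    unfolding eq by (rule card_image)
qed

lemma bounded_subset_nat_ball:
  fixes B :: "'a::real_normed_vector set"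
  assumes "bounded B"
  obtains K :: nat where "B \<subseteq> ball 0 (real K)"
proof -
  obtain r where "\<And>x. x \<in> B \<Longrightarrow> norm x \<le> r" using assms unfolding bounded_iff by blast
  moreover obtain K :: nat where "r < real K" using reals_Archimedean2 by blast
  ultimately have "B \<subseteq> ball 0 (real K)" by fastforce
  then show ?thesis using that by blast
qed

lemma cloud_enum_in_space: "cloud_enum w \<in> space enumeration_space"
proof (cases "cloud_good w")
  case True
  have "inj (cloud_enum w)"
  proof (rule injI)
    fix i j assume "cloud_enum w i = cloud_enum w j"
    then have "snd w (cloud_nth (fst w) i) = snd w (cloud_nth (fst w) j)" using True by (simp add: cloud_enum_def)
    then have "cloud_nth (fst w) i = cloud_nth (fst w) j" using True by (auto simp: cloud_good_def)
    then show "i = j"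
      using strict_mono_enumerate[OF cloud_good_infinite[OF True]]
      by (simp add: cloud_nth_eq_enumerate[OF cloud_good_infinite[OF True]] strict_mono_eq)
  qed
  moreover have "locally_finite_set (range (cloud_enum w))"
    unfolding locally_finite_set_def
  proof (intro allI impI)
    fix B :: "(real^'a) set" assume "bounded B"
    then obtain K :: nat where "B \<subseteq> ball 0 (real K)" by (rule bounded_subset_nat_ball)
    then show "finite (range (cloud_enum w) \<inter> B)" by (rule card_range_cloud_enum_Int(1)[OF True])
  qed
  ultimately show ?thesis by (simp add: space_enumeration_space)
next
  case False
  then have e: "cloud_enum w = (\<lambda>j. real j *\<^sub>R axis undefined 1)" by (simp add: cloud_enum_def)
  have "inj (cloud_enum w)" unfolding e by (auto simp: inj_def axis_eq_0_iff)
  moreover have "locally_finite_set (range (cloud_enum w))"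
    unfolding locally_finite_set_def
  proof (intro allI impI)
    fix B :: "(real^'a) set" assume "bounded B"
    then obtain K :: nat where K: "B \<subseteq> ball 0 (real K)" by (rule bounded_subset_nat_ball)
    have "range (cloud_enum w) \<inter> B \<subseteq> cloud_enum w ` {..<K}"
      using K by (auto simp: e norm_axis_1)
    then show "finite (range (cloud_enum w) \<inter> B)" by (rule finite_subset) simp
  qed
  ultimately show ?thesis by (simp add: space_enumeration_space)
qed

lemma measurable_cloud_enum [measurable]: "cloud_enum \<in> measurable (cloud \<rho>) enumeration_space"
  unfolding enumeration_space_def
proof (rule measurable_restrict_space2)
  show "cloud_enum \<in> space (cloud \<rho>) \<rightarrow> {x. inj x \<and> locally_finite_set (range x)}"
    using cloud_enum_in_space by (auto simp: space_enumeration_space)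
  show "cloud_enum \<in> measurable (cloud \<rho>) (\<Pi>\<^sub>M i\<in>UNIV. borel)"
  proof (rule measurable_PiM_single')
    fix i :: nat
    have [measurable]: "(\<lambda>w. snd w (cloud_nth (fst w) i)) \<in> measurable (cloud \<rho>) borel"
      by (rule measurable_compose_countable[where f="\<lambda>n w. snd w n" and g="\<lambda>w. cloud_nth (fst w) i"]) measurable
    have eq: "(\<lambda>w. cloud_enum w i) = (\<lambda>w. if cloud_good w then snd w (cloud_nth (fst w) i) else real i *\<^sub>R axis undefined 1)"
      by (auto simp: cloud_enum_def)
    show "(\<lambda>w. cloud_enum w i) \<in> measurable (cloud \<rho>) borel"
      unfolding eq by measurable
  qed (auto simp: space_PiM)
qed

text \<open>The process is the image of the cloud under its enumeration. By
  \<open>poisson_processI\<close> only the generating function of a single count has to be checked,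
  and for a set inside the ball of radius K this count almost surely concerns just the first K
  annuli.\<close>

theorem poisson_process_exists:
  assumes \<rho>: "\<rho> > 0"
  shows "\<exists>Q :: (nat \<Rightarrow> real^'n) measure. sets Q = sets enumeration_space \<and> poisson_process Q \<rho> range"
proof (intro exI conjI)
  let ?C = "cloud \<rho> :: ((nat \<Rightarrow> nat) \<times> (nat \<Rightarrow> real^'n)) measure"
  let ?Q = "distr ?C enumeration_space cloud_enum"
  interpret C: prob_space ?C by (rule prob_space_cloud)
  show "sets ?Q = sets enumeration_space" by simp
  \<comment> \<open>Counts of the range are generated by its voids, and a void of the range is a
    countable intersection of events on single coordinates.\<close>
  have cm: "(\<lambda>x. card (range x \<inter> B)) \<in> measurable enumeration_space (count_space UNIV)"
    if B: "B \<in> sets borel" "bounded B" for B :: "(real^'n) set"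
  proof (subst measurable_count_space_eq2_countable, safe)
    fix k :: nat
    let ?S = "space (enumeration_space :: (nat \<Rightarrow> real^'n) measure)"
    have "{x \<in> ?S. card (range x \<inter> B) = k} \<in> sigma_sets ?S {{x \<in> ?S. range x \<inter> A' = {}} | A'. A' \<in> sets borel \<and> A' \<subseteq> B}"
      using B by (intro card_eq_generated_by_voids) (auto simp: space_enumeration_space locally_finite_set_def)
    also have "\<dots> \<subseteq> sets enumeration_space"
    proof (rule sets.sigma_sets_subset, safe)
      fix A' :: "(real^'n) set" assume [measurable]: "A' \<in> sets borel"
      have "{x \<in> ?S. range x \<inter> A' = {}} = {x \<in> ?S. \<forall>i. x i \<notin> A'}" by auto
      also have "\<dots> \<in> sets enumeration_space" by measurable
      finally show "{x \<in> ?S. range x \<inter> A' = {}} \<in> sets enumeration_space" .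
    qed
    finally show "(\<lambda>x. card (range x \<inter> B)) -` {k} \<inter> ?S \<in> sets enumeration_space"
      by (simp add: vimage_def Int_def conj_commute)
  qed auto
  show "poisson_process ?Q \<rho> range"
  proof (rule poisson_processI)
    show "prob_space ?Q" by (intro C.prob_space_distr measurable_cloud_enum)
    show "0 \<le> \<rho>" using \<rho> by simp
    show "locally_finite_set (range s)" if "s \<in> space ?Q" for s
      using that by (simp add: space_enumeration_space)
    show "(\<lambda>s. card (range s \<inter> B)) \<in> measurable ?Q (count_space UNIV)"
      if "B \<in> sets borel" "bounded B" for B
      using cm[OF that] by simp
    show "(\<integral>\<^sup>+ s. ennreal (v ^ card (range s \<inter> B)) \<partial>?Q) = ennreal (exp (- (\<rho> * measure lborel B) * (1 - v)))"
      if B: "B \<in> sets borel" "bounded B" and v: "0 \<le> v" "v \<le> 1" for B :: "(real^'n) set" and v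
    proof -
      obtain K :: nat where K: "B \<subseteq> ball 0 (real K)" using B(2) by (rule bounded_subset_nat_ball)
      note [measurable] = cm[OF B]
      have "(\<integral>\<^sup>+ s. ennreal (v ^ card (range s \<inter> B)) \<partial>?Q) = (\<integral>\<^sup>+ w. ennreal (v ^ card (range (cloud_enum w) \<inter> B)) \<partial>?C)"
        by (subst nn_integral_distr) auto
      also have "\<dots> = (\<integral>\<^sup>+ w. ennreal (v ^ card {m \<in> cloud_upto (fst w) K. snd w m \<in> B}) \<partial>?C)"
        using AE_cloud_good[OF \<rho>, where 'n='n]
        by (intro nn_integral_cong_AE) (auto elim!: eventually_mono simp: card_range_cloud_enum_Int[OF _ K])
      also have "\<dots> = ennreal (exp (- (\<rho> * measure lborel B) * (1 - v)))"
        by (rule pgf_cloud_upto[OF \<rho> B(1) K v])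
      finally show ?thesis .
    qed
  qed
qed

text \<open>Resolves the definite description: a law exists by the construction above, and any two
  candidates have the same void probabilities and hence coincide.\<close>

theorem PPP_has_poisson_voids:
  assumes "\<rho> > 0" "prob_space \<nu>" "sets \<nu> = sets borel"
  shows "has_poisson_voids \<rho> \<nu> (PPP \<rho> \<nu> :: ((real^'n) \<times> real) set measure)"
proof -
  obtain P :: "((real^'n) \<times> real) set measure" where P: "is_PPP \<rho> \<nu> P"
    using poisson_process_exists[OF assms(1)] unfolding is_PPP_def by blast
  have "P' = P" if "is_PPP \<rho> \<nu> P'" for P'
    using is_PPP_has_poisson_voids[OF that assms] is_PPP_has_poisson_voids[OF P assms]
    by (rule has_poisson_voids_unique) simp
  then have "PPP \<rho> \<nu> = P" unfolding PPP_def using P by (intro the_equality)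
  then show ?thesis using is_PPP_has_poisson_voids[OF P assms] by simp
qed

lemma has_poisson_voids_prob_space:
  assumes "has_poisson_voids \<rho> \<nu> P"
  shows "prob_space P"
proof
  have "space P = configs"
    using assms sets_eq_imp_space_eq[of P config_space] by (simp add: has_poisson_voids_def)
  then show "emeasure P (space P) = 1"
    using assms unfolding has_poisson_voids_def by (elim conjE allE[of _ "{}"]) simp
qed

section \<open>Clusters as chains of marked points\<close>

text \<open>The edge condition on marked points instead of sites, which avoids \<open>mark\<close>.
  The requirement that the endpoints differ is dropped, since loops do not affect
  reachability.\<close>

definition near :: "real \<Rightarrow> real \<Rightarrow> (real^'n) \<times> real \<Rightarrow> (real^'n) \<times> real \<Rightarrow> bool" where
  "near \<zeta> \<beta> p q \<longleftrightarrow>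
     norm (fst p - fst q) + \<beta> * (\<bar>snd p\<bar> + \<bar>snd q\<bar> + \<bar>snd p - snd q\<bar>) \<le> \<zeta>"

definition links :: "real \<Rightarrow> real \<Rightarrow> ((real^'n) \<times> real) set \<Rightarrow> (((real^'n) \<times> real) \<times> ((real^'n) \<times> real)) set" where
  "links \<zeta> \<beta> \<omega> = {(p, q). p \<in> \<omega> \<and> q \<in> \<omega> \<and> near \<zeta> \<beta> p q}"

definition cluster :: "real \<Rightarrow> real \<Rightarrow> ((real^'n) \<times> real) set \<Rightarrow> (real^'n) \<times> real \<Rightarrow> ((real^'n) \<times> real) set" where
  "cluster \<zeta> \<beta> \<omega> p = {q. (p, q) \<in> (links \<zeta> \<beta> \<omega>)\<^sup>*}"

lemma configs_subset: "\<omega> \<in> configs \<Longrightarrow> \<omega>' \<subseteq> \<omega> \<Longrightarrow> \<omega>' \<in> configs"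
  unfolding configs_def locally_finite_set_def
  by (auto intro: inj_on_subset) (meson finite_subset image_mono Int_mono order_refl)

lemma mark_eq: "\<omega> \<in> configs \<Longrightarrow> p \<in> \<omega> \<Longrightarrow> mark \<omega> (fst p) = snd p"
  unfolding mark_def configs_def
  by (rule the_equality) (auto simp: inj_on_def, metis prod.collapse fst_conv snd_conv)

lemma cluster_subset: "p \<in> \<omega> \<Longrightarrow> cluster \<zeta> \<beta> \<omega> p \<subseteq> \<omega>"
proof
  fix q assume p: "p \<in> \<omega>" and "q \<in> cluster \<zeta> \<beta> \<omega> p"
  then have "(p, q) \<in> (links \<zeta> \<beta> \<omega>)\<^sup>*" by (simp add: cluster_def)
  then show "q \<in> \<omega>" by (induction rule: rtrancl_induct) (auto simp: p links_def)
qed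

lemma component_eq_cluster:
  assumes \<omega>: "\<omega> \<in> configs" and p: "p \<in> \<omega>"
  shows "component \<zeta> \<beta> \<omega> (fst p) = fst ` cluster \<zeta> \<beta> \<omega> p"
proof (intro subset_antisym subsetI)
  fix y assume "y \<in> component \<zeta> \<beta> \<omega> (fst p)"
  then have "(fst p, y) \<in> (graph_edges \<zeta> \<beta> \<omega>)\<^sup>*" by (simp add: component_def)
  then show "y \<in> fst ` cluster \<zeta> \<beta> \<omega> p"
  proof (induction rule: rtrancl_induct)
    case base
    show ?case by (auto simp: cluster_def)
  next
    case (step y z)
    then obtain q where q: "q \<in> cluster \<zeta> \<beta> \<omega> p" "y = fst q" by blast
    have "q \<in> \<omega>" using cluster_subset[OF p] q(1) by blast
    moreover obtain r where "r \<in> \<omega>" "z = fst r" using step(2) by (auto simp: graph_edges_def)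
    ultimately have "(q, r) \<in> links \<zeta> \<beta> \<omega>"
      using step(2) q(2) mark_eq[OF \<omega>] by (auto simp: graph_edges_def links_def near_def)
    then have "r \<in> cluster \<zeta> \<beta> \<omega> p" using q(1) by (auto simp: cluster_def)
    then show ?case using \<open>z = fst r\<close> by blast
  qed
next
  fix y assume "y \<in> fst ` cluster \<zeta> \<beta> \<omega> p"
  then obtain q where "(p, q) \<in> (links \<zeta> \<beta> \<omega>)\<^sup>*" "y = fst q" by (auto simp: cluster_def)
  moreover have "(fst p, fst q) \<in> (graph_edges \<zeta> \<beta> \<omega>)\<^sup>*" if "(p, q) \<in> (links \<zeta> \<beta> \<omega>)\<^sup>*" for q
    using that
  proof (induction rule: rtrancl_induct)
    case (step q r)
    \<comment> \<open>A link from a point to itself is not an edge of the graph; it corresponds to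
      staying at the same site.\<close>
    have "(fst q, fst r) \<in> graph_edges \<zeta> \<beta> \<omega> \<or> fst q = fst r"
      using step(2) mark_eq[OF \<omega>] by (auto simp: graph_edges_def links_def near_def)
    then show ?case using step(3) by (metis rtrancl.rtrancl_into_rtrancl)
  qed auto
  ultimately show "y \<in> component \<zeta> \<beta> \<omega> (fst p)" by (auto simp: component_def)
qed

lemma percolates_iff_cluster:
  assumes "\<omega> \<in> configs"
  shows "percolates \<zeta> \<beta> \<omega> \<longleftrightarrow> (\<exists>p\<in>\<omega>. \<not> bounded (fst ` cluster \<zeta> \<beta> \<omega> p))"
  unfolding percolates_def using component_eq_cluster[OF assms] by auto

lemma cluster_mono:
  assumes "\<omega> \<subseteq> \<omega>'" "\<zeta> \<le> \<zeta>'"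
  shows "cluster \<zeta> \<beta> \<omega> p \<subseteq> cluster \<zeta>' \<beta> \<omega>' p"
proof -
  have "links \<zeta> \<beta> \<omega> \<subseteq> links \<zeta>' \<beta> \<omega>'" using assms by (auto simp: links_def near_def)
  from rtrancl_mono[OF this] show ?thesis by (auto simp: cluster_def)
qed

lemma percolates_mono:
  assumes "\<omega>' \<in> configs" "\<omega> \<subseteq> \<omega>'" "\<zeta> \<le> \<zeta>'" "percolates \<zeta> \<beta> \<omega>"
  shows "percolates \<zeta>' \<beta> \<omega>'"
proof -
  have "\<omega> \<in> configs" using assms configs_subset by blast
  then obtain p where "p \<in> \<omega>" "\<not> bounded (fst ` cluster \<zeta> \<beta> \<omega> p)" using assms percolates_iff_cluster by blast
  then have "p \<in> \<omega>'" "\<not> bounded (fst ` cluster \<zeta>' \<beta> \<omega>' p)"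
    using assms(2) bounded_subset[OF _ image_mono[OF cluster_mono[OF assms(2,3)]]] by blast+
  then show ?thesis using assms(1) percolates_iff_cluster by blast
qed

lemma near_norm_le: "near \<zeta> \<beta> p q \<Longrightarrow> \<beta> \<ge> 0 \<Longrightarrow> norm (fst p - fst q) \<le> \<zeta>"
  unfolding near_def by (smt (verit) mult_nonneg_nonneg abs_ge_zero)

lemma near_mark_le:
  assumes "near \<zeta> \<beta> p q" "\<beta> > 0"
  shows "\<bar>snd p\<bar> \<le> \<zeta> / \<beta>" "\<bar>snd q\<bar> \<le> \<zeta> / \<beta>"
proof -
  have "\<beta> * (\<bar>snd p\<bar> + \<bar>snd q\<bar> + \<bar>snd p - snd q\<bar>) \<le> \<zeta>"
    using assms(1) norm_ge_zero[of "fst p - fst q"] unfolding near_def by linarith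
  then have "\<bar>snd p\<bar> + \<bar>snd q\<bar> + \<bar>snd p - snd q\<bar> \<le> \<zeta> / \<beta>"
    using assms(2) by (simp add: field_simps)
  then show "\<bar>snd p\<bar> \<le> \<zeta> / \<beta>" "\<bar>snd q\<bar> \<le> \<zeta> / \<beta>" by linarith+
qed

text \<open>Only finitely many points are removed, and the cluster of a removed point is attached to
  the rest through finitely many neighbours, so one of the remaining pieces is unbounded.\<close>

lemma percolates_outside_ball:
  assumes \<omega>: "\<omega> \<in> configs" and \<beta>: "\<beta> \<ge> 0"
  shows "percolates \<zeta> \<beta> (\<omega> \<inter> {p. K \<le> norm (fst p)}) \<longleftrightarrow> percolates \<zeta> \<beta> \<omega>"
proof
  assume "percolates \<zeta> \<beta> (\<omega> \<inter> {p. K \<le> norm (fst p)})"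
  then show "percolates \<zeta> \<beta> \<omega>" by (rule percolates_mono[OF \<omega>, rotated 2]) auto
next
  assume perc: "percolates \<zeta> \<beta> \<omega>"
  then obtain p where p: "p \<in> \<omega>" "\<not> bounded (fst ` cluster \<zeta> \<beta> \<omega> p)" using percolates_iff_cluster[OF \<omega>] by blast
  define \<omega>' where "\<omega>' = \<omega> \<inter> {p. K \<le> norm (fst p)}"
  define F where "F = \<omega> \<inter> {p. norm (fst p) < K}"
  define S where "S = insert p {q\<in>\<omega>'. \<exists>f\<in>F. near \<zeta> \<beta> f q}"
  have \<omega>': "\<omega>' \<in> configs" unfolding \<omega>'_def by (rule configs_subset[OF \<omega>]) auto
  show "percolates \<zeta> \<beta> (\<omega> \<inter> {p. K \<le> norm (fst p)})"
  proof (rule ccontr)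
    assume "\<not> ?thesis"
    then have bd: "bounded (fst ` cluster \<zeta> \<beta> \<omega>' q)" if "q \<in> \<omega>'" for q
      using that percolates_iff_cluster[OF \<omega>'] by (auto simp: \<omega>'_def)
    have "finite {q\<in>\<omega>'. \<exists>f\<in>F. near \<zeta> \<beta> f q}"
    proof (rule finite_subset)
      show "{q\<in>\<omega>'. \<exists>f\<in>F. near \<zeta> \<beta> f q} \<subseteq> \<omega> \<inter> {q. norm (fst q) \<le> K + \<zeta>}"
      proof safe
        fix x e x' e' assume "(x, e) \<in> \<omega>'" "(x', e') \<in> F" "near \<zeta> \<beta> (x', e') (x, e)"
        then show "norm (fst (x, e)) \<le> K + \<zeta>"
          using near_norm_le[of \<zeta> \<beta> "(x', e')" "(x, e)"] \<beta> norm_triangle_ineq2[of x x']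
          by (auto simp: F_def norm_minus_commute)
      qed (auto simp: \<omega>'_def)
      show "finite (\<omega> \<inter> {q. norm (fst q) \<le> K + \<zeta>})"
        by (rule finite_config_Int[OF \<omega>], rule bounded_subset[of "cball 0 (K + \<zeta>)"]) auto
    qed
    then have finS: "finite S" by (simp add: S_def)
    have sub: "cluster \<zeta> \<beta> \<omega> p \<subseteq> F \<union> (\<Union>q\<in>S. cluster \<zeta> \<beta> \<omega>' q)"
    proof
      fix r assume "r \<in> cluster \<zeta> \<beta> \<omega> p"
      then have "(p, r) \<in> (links \<zeta> \<beta> \<omega>)\<^sup>*" by (simp add: cluster_def)
      then show "r \<in> F \<union> (\<Union>q\<in>S. cluster \<zeta> \<beta> \<omega>' q)"
      proof (induction rule: rtrancl_induct)
        case base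
        show ?case by (auto simp: S_def cluster_def)
      next
        case (step r s)
        have s: "s \<in> \<omega>" "r \<in> \<omega>" "near \<zeta> \<beta> r s" using step(2) by (auto simp: links_def)
        show ?case
        proof (cases "s \<in> F")
          case False
          then have s': "s \<in> \<omega>'" using s by (auto simp: F_def \<omega>'_def)
          show ?thesis
          proof (cases "r \<in> F")
            case True
            then have "s \<in> S" using s s' by (auto simp: S_def)
            then show ?thesis by (auto simp: cluster_def)
          next
            case False
            then have "(r, s) \<in> links \<zeta> \<beta> \<omega>'" using s s' by (auto simp: links_def F_def \<omega>'_def)
            moreover obtain q where "q \<in> S" "(q, r) \<in> (links \<zeta> \<beta> \<omega>')\<^sup>*"
              using step(3) False by (auto simp: cluster_def)
            ultimately have "(q, s) \<in> (links \<zeta> \<beta> \<omega>')\<^sup>*" by simp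
            then show ?thesis using \<open>q \<in> S\<close> by (auto simp: cluster_def)
          qed
        qed simp
      qed
    qed
    have "bounded (fst ` F)" by (rule bounded_subset[of "ball 0 K"]) (auto simp: F_def)
    moreover have "bounded (fst ` cluster \<zeta> \<beta> \<omega>' q)" if "q \<in> S" for q
    proof (cases "q \<in> \<omega>'")
      case False
      \<comment> \<open>This happens only when q is the starting point p and was itself removed; it
        then has no links in \<open>\<omega>'\<close>.\<close>
      have "cluster \<zeta> \<beta> \<omega>' q = {q}"
      proof -
        have "(q, r) \<notin> links \<zeta> \<beta> \<omega>'" for r using False by (auto simp: links_def)
        then show ?thesis unfolding cluster_def by (auto elim: converse_rtranclE)
      qed
      then show ?thesis by simp
    qed (rule bd)
    ultimately have "bounded (fst ` (F \<union> (\<Union>q\<in>S. cluster \<zeta> \<beta> \<omega>' q)))"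
      using finS by (simp add: image_Un image_UN bounded_UN)
    then show False using p(2) bounded_subset[OF _ image_mono[OF sub]] by blast
  qed
qed

lemma links_bounded_marks:
  assumes "\<beta> > 0"
  shows "links \<zeta> \<beta> (\<omega> \<inter> {p. \<bar>snd p\<bar> \<le> \<zeta> / \<beta>}) = links \<zeta> \<beta> \<omega>"
  unfolding links_def using near_mark_le[OF _ assms, of \<zeta>] by blast

text \<open>A point with a link has mark at most \<open>\<zeta> / \<beta>\<close>, so the truncation
  leaves \<open>links\<close> unchanged and loses only points without links; the start of an
  unbounded cluster is not one of them.\<close>

lemma percolates_bounded_marks:
  assumes \<omega>: "\<omega> \<in> configs" and \<beta>: "\<beta> > 0"
  shows "percolates \<zeta> \<beta> (\<omega> \<inter> {p. \<bar>snd p\<bar> \<le> \<zeta> / \<beta>}) \<longleftrightarrow> percolates \<zeta> \<beta> \<omega>"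
proof
  assume "percolates \<zeta> \<beta> (\<omega> \<inter> {p. \<bar>snd p\<bar> \<le> \<zeta> / \<beta>})"
  then show "percolates \<zeta> \<beta> \<omega>" by (rule percolates_mono[OF \<omega>, rotated 2]) auto
next
  assume "percolates \<zeta> \<beta> \<omega>"
  then obtain p where p: "p \<in> \<omega>" "\<not> bounded (fst ` cluster \<zeta> \<beta> \<omega> p)" using percolates_iff_cluster[OF \<omega>] by blast
  have "\<exists>q. (p, q) \<in> links \<zeta> \<beta> \<omega>"
  proof (rule ccontr)
    assume "\<not> ?thesis"
    then have "cluster \<zeta> \<beta> \<omega> p \<subseteq> {p}" unfolding cluster_def by (auto elim: converse_rtranclE)
    then have "bounded (fst ` cluster \<zeta> \<beta> \<omega> p)" by (meson finite.emptyI finite.insertI finite_imageI finite_imp_bounded finite_subset)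
    then show False using p by simp
  qed
  then have "p \<in> \<omega> \<inter> {p. \<bar>snd p\<bar> \<le> \<zeta> / \<beta>}"
    using links_bounded_marks[OF \<beta>, of \<zeta> \<omega>] by (auto simp: links_def)
  moreover have "\<omega> \<inter> {p. \<bar>snd p\<bar> \<le> \<zeta> / \<beta>} \<in> configs" by (rule configs_subset[OF \<omega>]) auto
  moreover have "cluster \<zeta> \<beta> (\<omega> \<inter> {p. \<bar>snd p\<bar> \<le> \<zeta> / \<beta>}) p = cluster \<zeta> \<beta> \<omega> p"
    unfolding cluster_def links_bounded_marks[OF \<beta>] ..
  ultimately show "percolates \<zeta> \<beta> (\<omega> \<inter> {p. \<bar>snd p\<bar> \<le> \<zeta> / \<beta>})"
    using p(2) percolates_iff_cluster by metis
qed

definition rescale :: "real \<Rightarrow> real \<Rightarrow> (real^'n) \<times> real \<Rightarrow> (real^'n) \<times> real" where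
  "rescale \<zeta> t p = (fst p /\<^sub>R \<zeta>, snd p / t)"

lemma near_rescale:
  assumes "\<zeta> > 0" "\<beta> > 0"
  shows "near 1 1 (rescale \<zeta> (\<zeta> / \<beta>) p) (rescale \<zeta> (\<zeta> / \<beta>) q) \<longleftrightarrow> near \<zeta> \<beta> p q"
proof -
  have 1: "norm (fst p /\<^sub>R \<zeta> - fst q /\<^sub>R \<zeta>) = norm (fst p - fst q) / \<zeta>"
    using assms by (simp add: scaleR_diff_right[symmetric] divide_inverse_commute)
  have 2: "\<bar>a / (\<zeta> / \<beta>)\<bar> = \<beta> * \<bar>a\<bar> / \<zeta>" for a using assms by (simp add: abs_mult)
  have 3: "snd p / (\<zeta> / \<beta>) - snd q / (\<zeta> / \<beta>) = (snd p - snd q) / (\<zeta> / \<beta>)" by (simp add: diff_divide_distrib left_diff_distrib)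
  show ?thesis
    unfolding near_def rescale_def fst_conv snd_conv 1 3 2 using assms by (simp add: field_simps)
qed

lemma bounded_scaleR_iff:
  fixes S :: "'a::real_normed_vector set"
  assumes "c \<noteq> 0"
  shows "bounded ((\<lambda>x. c *\<^sub>R x) ` S) \<longleftrightarrow> bounded S"
proof
  assume "bounded ((\<lambda>x. c *\<^sub>R x) ` S)"
  then have "bounded ((\<lambda>x. inverse c *\<^sub>R x) ` (\<lambda>x. c *\<^sub>R x) ` S)" by (rule bounded_scaling)
  then show "bounded S" using assms by (simp add: image_image)
qed (rule bounded_scaling)

lemma inj_rescale: "\<zeta> \<noteq> 0 \<Longrightarrow> t \<noteq> 0 \<Longrightarrow> inj (rescale \<zeta> t)"
  by (auto simp: inj_def rescale_def)

lemma rescale_configs: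
  fixes \<omega> :: "((real^'n) \<times> real) set"
  assumes \<omega>: "\<omega> \<in> configs" and "\<zeta> \<noteq> 0" "t \<noteq> 0"
  shows "rescale \<zeta> t ` \<omega> \<in> configs"
proof -
  have "inj_on fst (rescale \<zeta> t ` \<omega>)"
    using \<omega> assms by (auto simp: configs_def rescale_def inj_on_def)
  moreover have "locally_finite_set (fst ` rescale \<zeta> t ` \<omega>)"
    unfolding locally_finite_set_def
  proof (intro allI impI)
    fix B :: "(real^'n) set" assume "bounded B"
    then have "finite (fst ` \<omega> \<inter> (\<lambda>x. \<zeta> *\<^sub>R x) ` B)"
      using \<omega> by (auto simp: configs_def locally_finite_set_def bounded_scaling)
    then have "finite ((\<lambda>x. x /\<^sub>R \<zeta>) ` (fst ` \<omega> \<inter> (\<lambda>x. \<zeta> *\<^sub>R x) ` B))" by simp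
    moreover have "fst ` rescale \<zeta> t ` \<omega> \<inter> B \<subseteq> (\<lambda>x. x /\<^sub>R \<zeta>) ` (fst ` \<omega> \<inter> (\<lambda>x. \<zeta> *\<^sub>R x) ` B)"
    proof
      fix y assume "y \<in> fst ` rescale \<zeta> t ` \<omega> \<inter> B"
      then obtain p where p: "p \<in> \<omega>" "y = fst p /\<^sub>R \<zeta>" "y \<in> B" by (auto simp: rescale_def)
      then have "fst p = \<zeta> *\<^sub>R y" using assms by simp
      then show "y \<in> (\<lambda>x. x /\<^sub>R \<zeta>) ` (fst ` \<omega> \<inter> (\<lambda>x. \<zeta> *\<^sub>R x) ` B)" using p by blast
    qed
    ultimately show "finite (fst ` rescale \<zeta> t ` \<omega> \<inter> B)" by (rule rev_finite_subset)
  qed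
  ultimately show ?thesis by (simp add: configs_def)
qed

lemma percolates_rescale:
  fixes \<omega> :: "((real^'n) \<times> real) set"
  assumes \<omega>: "\<omega> \<in> configs" and \<zeta>: "\<zeta> > 0" and \<beta>: "\<beta> > 0"
  shows "percolates 1 1 (rescale \<zeta> (\<zeta> / \<beta>) ` \<omega>) \<longleftrightarrow> percolates \<zeta> \<beta> \<omega>"
proof -
  let ?T = "rescale \<zeta> (\<zeta> / \<beta>) :: (real^'n) \<times> real \<Rightarrow> _"
  have inj: "inj ?T" using \<zeta> \<beta> by (intro inj_rescale) auto
  have nr: "near 1 1 (?T p) (?T q) \<longleftrightarrow> near \<zeta> \<beta> p q" for p q by (rule near_rescale[OF \<zeta> \<beta>])
  have links: "links 1 1 (?T ` \<omega>) = map_prod ?T ?T ` links \<zeta> \<beta> \<omega>"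
  proof (intro subset_antisym subsetI)
    fix x assume "x \<in> links 1 1 (?T ` \<omega>)"
    then obtain p q where "p \<in> \<omega>" "q \<in> \<omega>" "x = (?T p, ?T q)" "near 1 1 (?T p) (?T q)"
      by (auto simp: links_def)
    then show "x \<in> map_prod ?T ?T ` links \<zeta> \<beta> \<omega>"
      by (intro image_eqI[of _ _ "(p, q)"]) (auto simp: links_def nr)
  qed (auto simp: links_def nr)
  have cl: "cluster 1 1 (?T ` \<omega>) (?T p) = ?T ` cluster \<zeta> \<beta> \<omega> p" for p
  proof (intro subset_antisym subsetI)
    fix q assume "q \<in> cluster 1 1 (?T ` \<omega>) (?T p)"
    then have "(?T p, q) \<in> (links 1 1 (?T ` \<omega>))\<^sup>*" by (simp add: cluster_def)
    then show "q \<in> ?T ` cluster \<zeta> \<beta> \<omega> p"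
    proof (induction rule: rtrancl_induct)
      case (step q r)
      from step(3) obtain q0 where q0: "q = ?T q0" "(p, q0) \<in> (links \<zeta> \<beta> \<omega>)\<^sup>*"
        unfolding cluster_def by blast
      from step(2)[unfolded links] obtain s where s: "(q, r) = map_prod ?T ?T s" "s \<in> links \<zeta> \<beta> \<omega>"
        by (rule imageE)
      have "q = ?T (fst s)" "r = ?T (snd s)" using s(1) by (simp_all add: map_prod_def split_beta)
      moreover have "fst s = q0" using calculation(1) q0(1) injD[OF inj] by metis
      moreover have "(fst s, snd s) \<in> links \<zeta> \<beta> \<omega>" using s(2) by simp
      ultimately have "r = ?T (snd s)" "(p, snd s) \<in> (links \<zeta> \<beta> \<omega>)\<^sup>*"
        using q0(2) by (auto intro: rtrancl_into_rtrancl)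
      then show ?case unfolding cluster_def by blast
    qed (auto simp: cluster_def)
  next
    fix q assume "q \<in> ?T ` cluster \<zeta> \<beta> \<omega> p"
    then obtain q' where "q = ?T q'" "(p, q') \<in> (links \<zeta> \<beta> \<omega>)\<^sup>*" by (auto simp: cluster_def)
    moreover have "(?T p, ?T q') \<in> (links 1 1 (?T ` \<omega>))\<^sup>*" if "(p, q') \<in> (links \<zeta> \<beta> \<omega>)\<^sup>*" for q'
      using that
    proof (induction rule: rtrancl_induct)
      case (step q r)
      have "(?T q, ?T r) \<in> links 1 1 (?T ` \<omega>)" unfolding links using step(2) by (intro image_eqI[of _ _ "(q, r)"]) auto
      then show ?case using step(3) by simp
    qed simp
    ultimately show "q \<in> cluster 1 1 (?T ` \<omega>) (?T p)" by (simp add: cluster_def)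
  qed
  have "fst ` ?T ` C = (\<lambda>x. inverse \<zeta> *\<^sub>R x) ` fst ` C" for C by (simp add: image_image rescale_def)
  then have bd: "bounded (fst ` ?T ` C) \<longleftrightarrow> bounded (fst ` C)" for C
    using \<zeta> by (simp add: bounded_scaleR_iff)
  have "?T ` \<omega> \<in> configs" using \<omega> \<zeta> \<beta> by (intro rescale_configs) auto
  then show ?thesis using \<omega> by (simp add: percolates_iff_cluster cl bd)
qed

section \<open>Measurability of percolation\<close>

definition chain :: "real \<Rightarrow> real \<Rightarrow> nat \<Rightarrow> (nat \<Rightarrow> (real^'n) \<times> real) \<Rightarrow> ((real^'n) \<times> real) set \<Rightarrow> bool" where
  "chain \<zeta> \<beta> n f \<omega> \<longleftrightarrow> (\<forall>i\<le>n. f i \<in> \<omega>) \<and> (\<forall>i<n. near \<zeta> \<beta> (f i) (f (Suc i)))"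

lemma chain_mono: "chain \<zeta> \<beta> n f \<omega> \<Longrightarrow> \<zeta> \<le> \<zeta>' \<Longrightarrow> chain \<zeta>' \<beta> n f \<omega>"
  unfolding chain_def near_def by (meson order_trans)

lemma chain_cluster:
  assumes "chain \<zeta> \<beta> n f \<omega>"
  shows "f n \<in> cluster \<zeta> \<beta> \<omega> (f 0)"
proof -
  have "(f 0, f i) \<in> (links \<zeta> \<beta> \<omega>)\<^sup>*" if "i \<le> n" for i
    using that
  proof (induction i)
    case (Suc i)
    then have "(f i, f (Suc i)) \<in> links \<zeta> \<beta> \<omega>" using assms by (auto simp: chain_def links_def)
    then show ?case using Suc by (auto intro: rtrancl_into_rtrancl)
  qed simp
  then show ?thesis by (simp add: cluster_def)
qed

lemma cluster_chain:
  assumes "p \<in> \<omega>" "q \<in> cluster \<zeta> \<beta> \<omega> p"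
  obtains n f where "chain \<zeta> \<beta> n f \<omega>" "f 0 = p" "f n = q"
proof -
  have "(p, q) \<in> (links \<zeta> \<beta> \<omega>)\<^sup>*" using assms by (simp add: cluster_def)
  then obtain n where "(p, q) \<in> links \<zeta> \<beta> \<omega> ^^ n" using rtrancl_imp_relpow by blast
  then obtain f where f: "f 0 = p" "f n = q" "\<And>i. i < n \<Longrightarrow> (f i, f (Suc i)) \<in> links \<zeta> \<beta> \<omega>"
    unfolding relpow_fun_conv by blast
  have "f i \<in> \<omega>" if "i \<le> n" for i
  proof (cases i)
    case 0
    then show ?thesis using f(1) assms(1) by simp
  next
    case (Suc j)
    then show ?thesis using f(3)[of j] that by (auto simp: links_def)
  qed
  then have "chain \<zeta> \<beta> n f \<omega>" using f(3) by (auto simp: chain_def links_def)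
  then show ?thesis using that f by blast
qed

text \<open>Expresses percolation by quantifiers over natural numbers, up to the existence of a
  chain of fixed length. For the converse, only finitely many points lie within M of the origin; if
  all their clusters were bounded, chains from there could not reach arbitrarily far.\<close>

lemma percolates_iff_chain:
  fixes \<omega> :: "((real^'n) \<times> real) set"
  assumes \<omega>: "\<omega> \<in> configs"
  shows "percolates \<zeta> \<beta> \<omega> \<longleftrightarrow>
    (\<exists>M::nat. \<forall>R::nat. \<exists>n f. chain \<zeta> \<beta> n f \<omega> \<and> norm (fst (f 0)) \<le> real M \<and> real R \<le> norm (fst (f n)))"
proof
  assume "percolates \<zeta> \<beta> \<omega>"
  then obtain p where p: "p \<in> \<omega>" "\<not> bounded (fst ` cluster \<zeta> \<beta> \<omega> p)" using percolates_iff_cluster[OF \<omega>] by blast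
  obtain M :: nat where M: "norm (fst p) \<le> real M" using real_arch_simple by blast
  show "\<exists>M::nat. \<forall>R::nat. \<exists>n f. chain \<zeta> \<beta> n f \<omega> \<and> norm (fst (f 0)) \<le> real M \<and> real R \<le> norm (fst (f n))"
  proof (rule exI[of _ M], rule allI)
    fix R :: nat
    have "\<exists>q\<in>cluster \<zeta> \<beta> \<omega> p. real R \<le> norm (fst q)"
    proof (rule ccontr)
      assume "\<not> ?thesis"
      then have "\<forall>x\<in>fst ` cluster \<zeta> \<beta> \<omega> p. norm x \<le> real R" by force
      then show False using p(2) unfolding bounded_iff by blast
    qed
    then obtain q where q: "q \<in> cluster \<zeta> \<beta> \<omega> p" "real R \<le> norm (fst q)" by blast
    obtain n f where "chain \<zeta> \<beta> n f \<omega>" "f 0 = p" "f n = q" using cluster_chain[OF p(1) q(1)] by blast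
    then show "\<exists>n f. chain \<zeta> \<beta> n f \<omega> \<and> norm (fst (f 0)) \<le> real M \<and> real R \<le> norm (fst (f n))"
      using M q(2) by blast
  qed
next
  assume "\<exists>M::nat. \<forall>R::nat. \<exists>n f. chain \<zeta> \<beta> n f \<omega> \<and> norm (fst (f 0)) \<le> real M \<and> real R \<le> norm (fst (f n))"
  then obtain M :: nat where M: "\<And>R::nat. \<exists>n f. chain \<zeta> \<beta> n f \<omega> \<and> norm (fst (f 0)) \<le> real M \<and> real R \<le> norm (fst (f n))"
    by blast
  show "percolates \<zeta> \<beta> \<omega>"
  proof (rule ccontr)
    assume "\<not> percolates \<zeta> \<beta> \<omega>"
    then have bd: "bounded (fst ` cluster \<zeta> \<beta> \<omega> p)" if "p \<in> \<omega>" for p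
      using that percolates_iff_cluster[OF \<omega>] by blast
    define F where "F = \<omega> \<inter> {p. norm (fst p) \<le> real M}"
    have "finite F" unfolding F_def
      by (rule finite_config_Int[OF \<omega>], rule bounded_subset[of "cball 0 (real M)"]) auto
    then have "bounded (\<Union>p\<in>F. fst ` cluster \<zeta> \<beta> \<omega> p)"
      using bd by (intro bounded_UN) (auto simp: F_def)
    then obtain b where b: "\<And>p q. p \<in> F \<Longrightarrow> q \<in> cluster \<zeta> \<beta> \<omega> p \<Longrightarrow> norm (fst q) \<le> b"
      unfolding bounded_iff by blast
    obtain R :: nat where R: "b < real R" using reals_Archimedean2 by blast
    obtain n f where f: "chain \<zeta> \<beta> n f \<omega>" "norm (fst (f 0)) \<le> real M" "real R \<le> norm (fst (f n))"
      using M by blast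
    have "f 0 \<in> F" using f(1,2) by (auto simp: chain_def F_def)
    then have "norm (fst (f n)) \<le> b" using b chain_cluster[OF f(1)] by blast
    then show False using f(3) R by linarith
  qed
qed

text \<open>The distance of the sites changes by at most 2 \<epsilon>, and the three absolute values
  by \<epsilon>, \<epsilon> and 2 \<epsilon>, which explains the factor
  \<open>2 + 4 * \<beta>\<close>.\<close>

lemma near_perturb:
  assumes "near \<zeta> \<beta> p q" "dist p p' < \<epsilon>" "dist q q' < \<epsilon>" "\<beta> \<ge> 0"
  shows "near (\<zeta> + (2 + 4 * \<beta>) * \<epsilon>) \<beta> p' q'"
proof -
  have d: "dist (fst p) (fst p') < \<epsilon>" "dist (snd p) (snd p') < \<epsilon>" "dist (fst q) (fst q') < \<epsilon>" "dist (snd q) (snd q') < \<epsilon>"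
    using assms(2,3) dist_fst_le[of p p'] dist_snd_le[of p p'] dist_fst_le[of q q'] dist_snd_le[of q q'] by linarith+
  have "dist (fst p') (fst q') \<le> dist (fst p) (fst q) + 2 * \<epsilon>"
    using d(1,3) dist_triangle[of "fst p'" "fst q'" "fst p"] dist_triangle[of "fst p" "fst q'" "fst q"]
      dist_commute[of "fst p" "fst p'"] by linarith
  then have 1: "norm (fst p' - fst q') \<le> norm (fst p - fst q) + 2 * \<epsilon>" by (simp add: dist_norm)
  have "\<bar>snd p'\<bar> + \<bar>snd q'\<bar> + \<bar>snd p' - snd q'\<bar> \<le> \<bar>snd p\<bar> + \<bar>snd q\<bar> + \<bar>snd p - snd q\<bar> + 4 * \<epsilon>"
    using d(2,4) unfolding dist_real_def by linarith
  from mult_left_mono[OF this assms(4)]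
  have "\<beta> * (\<bar>snd p'\<bar> + \<bar>snd q'\<bar> + \<bar>snd p' - snd q'\<bar>) \<le> \<beta> * (\<bar>snd p\<bar> + \<bar>snd q\<bar> + \<bar>snd p - snd q\<bar>) + 4 * \<beta> * \<epsilon>"
    by (simp add: algebra_simps)
  then show ?thesis using 1 assms(1) unfolding near_def by (simp add: algebra_simps)
qed

text \<open>If each of the finitely many candidates failed at some stage, none would be left at the
  largest of these stages. This is the compactness step of the measurability proof.\<close>

lemma ex_uniform_witness_finite:
  assumes "finite S" and ex: "\<And>m. \<exists>y\<in>S. \<Phi> m y" and mono: "\<And>m y. \<Phi> (Suc m) y \<Longrightarrow> \<Phi> m y"
  shows "\<exists>y\<in>S. \<forall>m::nat. \<Phi> m y"
proof (rule ccontr)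
  assume "\<not> ?thesis"
  then have "\<forall>y\<in>S. \<exists>m. \<not> \<Phi> m y" by blast
  from bchoice[OF this] obtain k where k: "\<forall>y\<in>S. \<not> \<Phi> (k y) y" ..
  have le: "\<Phi> n y \<Longrightarrow> m \<le> n \<Longrightarrow> \<Phi> m y" for m n y
    by (induction n) (auto simp: le_Suc_eq intro: mono)
  obtain y where y: "y \<in> S" "\<Phi> (Max (k ` S)) y" using ex by blast
  have "k y \<le> Max (k ` S)" using y(1) assms(1) by simp
  then show False using le[OF y(2)] k y(1) by blast
qed

lemma le_of_le_add_inverse_Suc:
  fixes a b c :: real
  assumes "\<And>m. a \<le> b + c * (1 / real (Suc m))"
  shows "a \<le> b"
proof -
  have "(\<lambda>m. b + c * (1 / real (Suc m))) \<longlonglongrightarrow> b + c * 0"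
    by (intro tendsto_intros LIMSEQ_inverse_real_of_nat[unfolded inverse_eq_divide])
  then show ?thesis using assms LIMSEQ_le_const[of _ "b + c * 0" a] by auto
qed

lemma chain_norm_le:
  assumes "chain \<zeta> \<beta> n f \<omega>" "\<beta> \<ge> 0" "i \<le> n"
  shows "norm (fst (f i)) \<le> norm (fst (f 0)) + real i * \<zeta>"
  using assms(3)
proof (induction i)
  case (Suc i)
  have "norm (fst (f i) - fst (f (Suc i))) \<le> \<zeta>"
    using assms Suc by (intro near_norm_le) (auto simp: chain_def)
  then have "norm (fst (f (Suc i))) \<le> norm (fst (f i)) + \<zeta>"
    using norm_triangle_ineq2[of "fst (f (Suc i))" "fst (f i)"] by (simp add: norm_minus_commute)
  then show ?case using Suc by (simp add: algebra_simps)
qed simp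

text \<open>The chains form an uncountable family. They are replaced by finite lists of centres from
  a countable dense set whose small balls are all hit and which satisfy the conditions up to a slack
  of order \<open>\<epsilon> m\<close>. The conditions are closed, and a locally finite
  configuration offers only finitely many candidate chains, so one chain works for every m and
  satisfies the conditions exactly in the limit.\<close>

lemma chain_event_measurable:
  assumes \<beta>: "\<beta> \<ge> 0"
  shows "{\<omega>\<in>configs. \<exists>f. chain \<zeta> \<beta> n f \<omega> \<and> norm (fst (f 0)) \<le> M \<and> R \<le> norm (fst (f n))}
    \<in> sets (config_space :: ((real^'n) \<times> real) set measure)" (is "?E \<in> _")
proof -
  obtain D :: "((real^'n) \<times> real) set" where D: "countable D" "\<And>x e. e > 0 \<Longrightarrow> \<exists>d\<in>D. dist d x < e"
    using countable_dense_points by blast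
  define \<epsilon> where "\<epsilon> m = 1 / real (Suc m)" for m
  have \<epsilon>: "0 < \<epsilon> m" "\<epsilon> m \<le> 1" "\<epsilon> (Suc m) \<le> \<epsilon> m" for m by (auto simp: \<epsilon>_def field_simps)
  define c where "c = 2 + 4 * \<beta>"
  have c: "c > 0" using \<beta> by (simp add: c_def)
  \<comment> \<open>Passing from points to centres costs a slack of \<open>c * \<epsilon> m\<close>,
    and passing back from centres to points costs it again; hence the factors 2 here and the single
    slack in \<open>Dn\<close>.\<close>
  define \<Phi> where "\<Phi> \<omega> m f \<longleftrightarrow> chain (\<zeta> + 2 * c * \<epsilon> m) \<beta> n f \<omega> \<and> norm (fst (f 0)) \<le> M + 2 * \<epsilon> m \<and> R - 2 * \<epsilon> m \<le> norm (fst (f n))"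
    for \<omega> m and f :: "nat \<Rightarrow> (real^'n) \<times> real"
  define Dn where "Dn m = {ds\<in>lists D. length ds = Suc n \<and> (\<forall>i<n. near (\<zeta> + c * \<epsilon> m) \<beta> (ds!i) (ds!Suc i)) \<and>
     norm (fst (ds!0)) \<le> M + \<epsilon> m \<and> R - \<epsilon> m \<le> norm (fst (ds!n))}" for m
  have cDn: "countable (Dn m)" for m
    by (rule countable_subset[of _ "lists D"]) (use D in \<open>auto simp: Dn_def\<close>)
  let ?S = "{\<omega>\<in>configs. \<forall>m. \<exists>ds\<in>Dn m. \<forall>i\<in>{..n}. \<omega> \<inter> ball (ds!i) (\<epsilon> m) \<noteq> {}}"
  have fd: "norm (fst x) \<le> norm (fst y) + e" if "dist x y < e" for x y :: "(real^'n) \<times> real" and e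
    using that dist_fst_le[of x y] norm_triangle_ineq2[of "fst x" "fst y"] unfolding dist_norm by linarith
  have "?E = ?S"
  proof (intro subset_antisym subsetI)
    fix \<omega> assume "\<omega> \<in> ?E"
    then obtain f where \<omega>: "\<omega> \<in> configs" and f: "chain \<zeta> \<beta> n f \<omega>" "norm (fst (f 0)) \<le> M" "R \<le> norm (fst (f n))" by blast
    have "\<exists>ds\<in>Dn m. \<forall>i\<in>{..n}. \<omega> \<inter> ball (ds!i) (\<epsilon> m) \<noteq> {}" for m
    proof -
      have "\<forall>x. \<exists>d. d \<in> D \<and> dist d x < \<epsilon> m" using D(2) \<epsilon> by blast
      from choice[OF this] obtain h where h: "\<And>x. h x \<in> D" "\<And>x. dist (h x) x < \<epsilon> m" by blast
      define ds where "ds = map (\<lambda>i. h (f i)) [0..<Suc n]"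
      have nth: "ds ! i = h (f i)" if "i \<le> n" for i using that unfolding ds_def by (subst nth_map) (auto simp del: upt_Suc)
      have "near (\<zeta> + c * \<epsilon> m) \<beta> (h (f i)) (h (f (Suc i)))" if "i < n" for i
        unfolding c_def using f(1) that h(2) \<beta> by (intro near_perturb[of _ _ "f i" "f (Suc i)"]) (auto simp: chain_def dist_commute)
      moreover have "norm (fst (h (f 0))) \<le> M + \<epsilon> m" using fd[OF h(2)[of "f 0"]] f(2) by linarith
      moreover have "R - \<epsilon> m \<le> norm (fst (h (f n)))"
        using fd[of "f n" "h (f n)" "\<epsilon> m"] h(2)[of "f n"] f(3) by (simp add: dist_commute)
      moreover have "ds \<in> lists D" using h(1) by (intro in_listsI) (simp only: ds_def set_map, blast)
      moreover have "length ds = Suc n" by (simp add: ds_def)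
      ultimately have "ds \<in> Dn m" unfolding Dn_def using nth by simp
      moreover have "f i \<in> \<omega> \<inter> ball (ds!i) (\<epsilon> m)" if "i \<le> n" for i
        using f(1) h(2)[of "f i"] nth that by (auto simp: chain_def)
      ultimately show ?thesis by blast
    qed
    then show "\<omega> \<in> ?S" using \<omega> by blast
  next
    fix \<omega> assume "\<omega> \<in> ?S"
    then have \<omega>: "\<omega> \<in> configs" and S: "\<And>m. \<exists>ds\<in>Dn m. \<forall>i\<in>{..n}. \<omega> \<inter> ball (ds!i) (\<epsilon> m) \<noteq> {}" by auto
    \<comment> \<open>A chain that starts within \<open>\<bar>M\<bar> + 2\<close> of the origin and
      makes n steps of length at most \<open>\<bar>\<zeta> + 2 * c\<bar>\<close> stays in this ball,
      whatever m is. The finite set \<open>W\<close> of candidates therefore does not depend on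
      m.\<close>
    define b where "b = \<bar>M\<bar> + 2 + real n * \<bar>\<zeta> + 2 * c\<bar>"
    define W where "W = \<omega> \<inter> {p. norm (fst p) \<le> b}"
    have "finite W" unfolding W_def
      by (rule finite_config_Int[OF \<omega>], rule bounded_subset[of "cball 0 b"]) auto
    then have fin: "finite (PiE {..n} (\<lambda>_. W))" by (intro finite_PiE) auto
    have ex: "\<exists>y\<in>PiE {..n} (\<lambda>_. W). \<Phi> \<omega> m y" for m
    proof -
      obtain ds where ds: "ds \<in> Dn m" "\<forall>i\<in>{..n}. \<exists>y. y \<in> \<omega> \<inter> ball (ds!i) (\<epsilon> m)" using S[of m] by blast
      from bchoice[OF ds(2)] obtain y where y: "\<And>i. i \<le> n \<Longrightarrow> y i \<in> \<omega>" "\<And>i. i \<le> n \<Longrightarrow> dist (ds!i) (y i) < \<epsilon> m" by auto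
      have near: "near (\<zeta> + 2 * c * \<epsilon> m) \<beta> (y i) (y (Suc i))" if "i < n" for i
        using near_perturb[of "\<zeta> + c * \<epsilon> m" \<beta> "ds!i" "ds!Suc i" "y i" "\<epsilon> m" "y (Suc i)"] ds(1) y(2) that \<beta>
        by (simp add: Dn_def c_def algebra_simps)
      have ch: "chain (\<zeta> + 2 * c * \<epsilon> m) \<beta> n y \<omega>" using near y(1) by (auto simp: chain_def)
      have y0: "norm (fst (y 0)) \<le> M + 2 * \<epsilon> m"
        using fd[of "y 0" "ds!0" "\<epsilon> m"] y(2)[of 0] ds(1) by (simp add: Dn_def dist_commute)
      have yn: "R - 2 * \<epsilon> m \<le> norm (fst (y n))"
        using fd[of "ds!n" "y n" "\<epsilon> m"] y(2)[of n] ds(1) by (simp add: Dn_def)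
      have W: "y i \<in> W" if "i \<le> n" for i
      proof -
        have "2 * c * \<epsilon> m \<le> 2 * c * 1" using c \<epsilon>(2) by (intro mult_left_mono) auto
        then have "\<zeta> + 2 * c * \<epsilon> m \<le> \<bar>\<zeta> + 2 * c\<bar>" by linarith
        then have "real i * (\<zeta> + 2 * c * \<epsilon> m) \<le> real n * \<bar>\<zeta> + 2 * c\<bar>"
          using that by (meson abs_ge_zero mult_left_mono mult_right_mono of_nat_0_le_iff of_nat_mono order_trans)
        then have "norm (fst (y i)) \<le> b"
          using chain_norm_le[OF ch \<beta> that] y0 \<epsilon>(2)[of m] unfolding b_def by linarith
        then show ?thesis using y(1) that by (auto simp: W_def)
      qed
      \<comment> \<open>Restriction to the indices that matter puts the chain into a finite set of
        functions.\<close>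
      have "\<Phi> \<omega> m (restrict y {..n})"
        using ch y0 yn by (auto simp: \<Phi>_def chain_def)
      moreover have "restrict y {..n} \<in> PiE {..n} (\<lambda>_. W)" using W by auto
      ultimately show ?thesis by blast
    qed
    have mono: "\<Phi> \<omega> m y" if "\<Phi> \<omega> (Suc m) y" for m y
    proof -
      have "2 * c * \<epsilon> (Suc m) \<le> 2 * c * \<epsilon> m" using c \<epsilon>(3) by (intro mult_left_mono) auto
      then have le: "\<zeta> + 2 * c * \<epsilon> (Suc m) \<le> \<zeta> + 2 * c * \<epsilon> m" by linarith
      note * = that[unfolded \<Phi>_def]
      have "chain (\<zeta> + 2 * c * \<epsilon> m) \<beta> n y \<omega>" by (rule chain_mono[OF conjunct1[OF *] le])
      moreover have "norm (fst (y 0)) \<le> M + 2 * \<epsilon> m" "R - 2 * \<epsilon> m \<le> norm (fst (y n))"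
        using conjunct2[OF *] \<epsilon>(3)[of m] by linarith+
      ultimately show ?thesis unfolding \<Phi>_def by blast
    qed
    have "\<exists>f\<in>PiE {..n} (\<lambda>_. W). \<forall>m. \<Phi> \<omega> m f" by (rule ex_uniform_witness_finite[OF fin ex mono])
    then obtain f where f: "\<And>m. \<Phi> \<omega> m f" by blast
    have f1: "chain (\<zeta> + 2 * c * (1 / real (Suc m))) \<beta> n f \<omega>" "norm (fst (f 0)) \<le> M + 2 * (1 / real (Suc m))" for m
      using f[of m] unfolding \<Phi>_def \<epsilon>_def by blast+
    have "near \<zeta> \<beta> (f i) (f (Suc i))" if "i < n" for i
      unfolding near_def
    proof (rule le_of_le_add_inverse_Suc)
      show "norm (fst (f i) - fst (f (Suc i))) + \<beta> * (\<bar>snd (f i)\<bar> + \<bar>snd (f (Suc i))\<bar> + \<bar>snd (f i) - snd (f (Suc i))\<bar>)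
        \<le> \<zeta> + 2 * c * (1 / real (Suc m))" for m
        using f1(1)[of m] that unfolding chain_def near_def by blast
    qed
    then have "chain \<zeta> \<beta> n f \<omega>" using f1(1)[of 0] unfolding chain_def by blast
    moreover have "norm (fst (f 0)) \<le> M"
      by (rule le_of_le_add_inverse_Suc[OF f1(2)])
    moreover have "R \<le> norm (fst (f n))"
    proof (rule le_of_le_add_inverse_Suc)
      fix m show "R \<le> norm (fst (f n)) + 2 * (1 / real (Suc m))"
        using f[of m] unfolding \<Phi>_def \<epsilon>_def by linarith
    qed
    ultimately show "\<omega> \<in> ?E" using \<omega> by blast
  qed
  moreover have "?S \<in> sets config_space"
  proof -
    have hit: "{\<omega>\<in>configs. \<omega> \<inter> ball d r \<noteq> {}} \<in> sets config_space" for d :: "(real^'n) \<times> real" and r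
    proof -
      have "space config_space - void (ball d r) \<in> sets config_space" by (intro sets.compl_sets void_measurable) simp
      also have "space config_space - void (ball d r) = {\<omega>\<in>configs. \<omega> \<inter> ball d r \<noteq> {}}" by (auto simp: void_def)
      finally show ?thesis .
    qed
    have "{\<omega>\<in>space config_space. \<forall>m. \<exists>ds\<in>Dn m. \<forall>i\<in>{..n}. \<omega> \<inter> ball (ds!i) (\<epsilon> m) \<noteq> {}} \<in> sets config_space"
      by (intro sets.sets_Collect_countable_All sets.sets_Collect_countable_Ex' sets.sets_Collect_finite_All)
        (simp_all add: hit cDn)
    then show ?thesis by simp
  qed
  ultimately show ?thesis by simp
qed

lemma percolates_measurable:
  assumes "\<beta> \<ge> 0"
  shows "{\<omega>\<in>configs. percolates \<zeta> \<beta> \<omega>} \<in> sets (config_space :: ((real^'n) \<times> real) set measure)"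
proof -
  let ?C = "config_space :: ((real^'n) \<times> real) set measure"
  have "{\<omega>\<in>space ?C. \<exists>M::nat. \<forall>R::nat. \<exists>n. \<exists>f. chain \<zeta> \<beta> n f \<omega> \<and> norm (fst (f 0)) \<le> real M \<and> real R \<le> norm (fst (f n))} \<in> sets ?C"
    using chain_event_measurable[OF assms]
    by (intro sets.sets_Collect_countable_All sets.sets_Collect_countable_Ex) simp
  also have "{\<omega>\<in>space ?C. \<exists>M::nat. \<forall>R::nat. \<exists>n. \<exists>f. chain \<zeta> \<beta> n f \<omega> \<and> norm (fst (f 0)) \<le> real M \<and> real R \<le> norm (fst (f n))}
    = {\<omega>\<in>configs. percolates \<zeta> \<beta> \<omega>}"
    using percolates_iff_chain by auto
  finally show ?thesis .
qed

section \<open>Zero-one law and scaling\<close>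

lemma sets_lborel_pair:
  assumes "sets \<nu> = sets borel"
  shows "sets (lborel \<Otimes>\<^sub>M \<nu>) = sets (borel :: ((real^'n) \<times> real) measure)"
proof -
  have "sets (lborel \<Otimes>\<^sub>M \<nu>) = sets (borel \<Otimes>\<^sub>M borel :: ((real^'n) \<times> real) measure)"
    by (intro sets_pair_measure_cong) (auto simp: assms)
  then show ?thesis unfolding borel_prod .
qed

lemma emeasure_bounded_pair:
  fixes A :: "((real^'n) \<times> real) set"
  assumes "prob_space \<nu>" "sets \<nu> = sets borel" "bounded A"
  shows "emeasure (lborel \<Otimes>\<^sub>M \<nu>) A \<noteq> \<infinity>"
proof -
  interpret \<nu>: prob_space \<nu> by fact
  obtain K :: nat where K: "fst ` A \<subseteq> ball 0 (real K)" using bounded_fst[OF assms(3)] by (rule bounded_subset_nat_ball)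
  have "emeasure (lborel \<Otimes>\<^sub>M \<nu>) A \<le> emeasure (lborel \<Otimes>\<^sub>M \<nu>) (ball (0::real^'n) (real K) \<times> space \<nu>)"
  proof (rule emeasure_mono)
    show "A \<subseteq> ball 0 (real K) \<times> space \<nu>"
      using K sets_eq_imp_space_eq[OF assms(2)] by auto
    show "ball (0::real^'n) (real K) \<times> space \<nu> \<in> sets (lborel \<Otimes>\<^sub>M \<nu>)"
      by (intro pair_measureI) auto
  qed
  also have "\<dots> = emeasure lborel (ball (0::real^'n) (real K)) * emeasure \<nu> (space \<nu>)"
    by (rule \<nu>.emeasure_pair_measure_Times) auto
  also have "\<dots> < \<infinity>"
    using emeasure_bounded_finite[OF bounded_ball, of "0::real^'n" "real K"] by (simp add: \<nu>.emeasure_space_1)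
  finally show ?thesis by auto
qed

lemma space_has_poisson_voids: "has_poisson_voids \<rho> \<nu> P \<Longrightarrow> space P = configs"
  using sets_eq_imp_space_eq[of P config_space] by (simp add: has_poisson_voids_def)

lemma emeasure_void:
  "has_poisson_voids \<rho> \<nu> P \<Longrightarrow> A \<in> sets borel \<Longrightarrow> bounded A \<Longrightarrow>
    emeasure P (void A) = ennreal (exp (- \<rho> * measure (lborel \<Otimes>\<^sub>M \<nu>) A))"
  by (simp add: has_poisson_voids_def)

lemma emeasure_void_disjoint:
  fixes A B :: "((real^'n) \<times> real) set"
  assumes P: "has_poisson_voids \<rho> \<nu> P" and \<nu>: "prob_space \<nu>" "sets \<nu> = sets borel"
    and A: "A \<in> sets borel" "bounded A" and B: "B \<in> sets borel" "bounded B" and "A \<inter> B = {}"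
  shows "emeasure P (void A \<inter> void B) = emeasure P (void A) * emeasure P (void B)"
proof -
  have "measure (lborel \<Otimes>\<^sub>M \<nu>) (A \<union> B) = measure (lborel \<Otimes>\<^sub>M \<nu>) A + measure (lborel \<Otimes>\<^sub>M \<nu>) B"
    by (rule measure_Union[OF emeasure_bounded_pair[OF \<nu> A(2)] emeasure_bounded_pair[OF \<nu> B(2)]])
      (unfold sets_lborel_pair[OF \<nu>(2)], fact A(1), fact B(1), fact)
  then have "emeasure P (void (A \<union> B)) = ennreal (exp (- \<rho> * measure (lborel \<Otimes>\<^sub>M \<nu>) A) * exp (- \<rho> * measure (lborel \<Otimes>\<^sub>M \<nu>) B))"
    using A B by (simp add: emeasure_void[OF P] exp_add[symmetric] algebra_simps)
  then show ?thesis using A B by (simp add: void_Int emeasure_void[OF P] ennreal_mult)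
qed

lemma measurable_config_restrict:
  assumes Y: "Y \<in> sets borel"
  shows "(\<lambda>\<omega>. \<omega> \<inter> Y) \<in> measurable config_space (config_space :: ((real^'n) \<times> real) set measure)"
proof (rule measurable_config_spaceI)
  show "\<omega> \<inter> Y \<in> configs" if "\<omega> \<in> space config_space" for \<omega>
    using that by (intro configs_subset[of \<omega> "\<omega> \<inter> Y"]) auto
  fix A :: "((real^'n) \<times> real) set" assume "A \<in> sets borel"
  then have "void (Y \<inter> A) \<in> sets config_space" using Y by (intro void_measurable) auto
  moreover have "{\<omega>\<in>space config_space. \<omega> \<inter> Y \<inter> A = {}} = void (Y \<inter> A)" by (auto simp: void_def)
  ultimately show "{\<omega>\<in>space config_space. \<omega> \<inter> Y \<inter> A = {}} \<in> sets config_space" by simp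
qed

text \<open>Percolation can be decided from the points outside a ball that contains the sites of
  \<open>A\<close>. Voids outside this ball are independent of the void of \<open>A\<close>, and by
  the uniqueness principle so is every event that depends on the outside only.\<close>

lemma percolates_indep_void:
  fixes P :: "((real^'n) \<times> real) set measure"
  assumes P: "has_poisson_voids \<rho> \<nu> P" and \<nu>: "prob_space \<nu>" "sets \<nu> = sets borel" and \<beta>: "\<beta> \<ge> 0"
    and A: "A \<in> sets borel" "bounded A"
  shows "emeasure P (void A \<inter> {\<omega>\<in>configs. percolates \<zeta> \<beta> \<omega>}) = emeasure P (void A) * emeasure P {\<omega>\<in>configs. percolates \<zeta> \<beta> \<omega>}"
proof -
  let ?E = "{\<omega>\<in>configs. percolates \<zeta> \<beta> \<omega>} :: ((real^'n) \<times> real) set set"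
  interpret P: prob_space P by (rule has_poisson_voids_prob_space[OF P])
  have sP: "sets P = sets config_space" using P by (simp add: has_poisson_voids_def)
  have spP: "space P = configs" by (rule space_has_poisson_voids[OF P])
  obtain K :: nat where K: "fst ` A \<subseteq> ball 0 (real K)" using bounded_fst[OF A(2)] by (rule bounded_subset_nat_ball)
  define Y where "Y = {p :: (real^'n) \<times> real. real K \<le> norm (fst p)}"
  have Y: "Y \<in> sets borel"
  proof -
    have "closed Y" unfolding Y_def by (intro closed_Collect_le continuous_intros)
    then show ?thesis by simp
  qed
  let ?r = "\<lambda>\<omega>. \<omega> \<inter> Y"
  have r: "?r \<in> measurable P config_space"
    using measurable_config_restrict[OF Y] by (simp add: measurable_cong_sets[OF sP refl])
  have pre: "?r -` void B \<inter> space P = void (Y \<inter> B)" for B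
    by (auto simp: spP void_def intro: configs_subset)
  have V: "void B \<in> sets P" if "B \<in> sets borel" for B using that by (simp add: sP)
  \<comment> \<open>\<open>?M1\<close> is the law of the outside configuration on the event
    \<open>void A\<close>, and \<open>?M2\<close> is its unconditional law times the probability of
    \<open>void A\<close>.\<close>
  let ?M1 = "distr (density P (indicator (void A))) config_space ?r"
  let ?M2 = "distr (scale_measure (emeasure P (void A)) P) config_space ?r"
  have m1: "emeasure ?M1 X = emeasure P (void A \<inter> (?r -` X \<inter> space P))" if "X \<in> sets config_space" for X
    using that r V[OF A(1)] measurable_sets[OF r that]
    by (subst emeasure_distr) (auto simp: emeasure_restricted measurable_density_eq1)
  have m2: "emeasure ?M2 X = emeasure P (void A) * emeasure P (?r -` X \<inter> space P)" if "X \<in> sets config_space" for X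
    using that r by (subst emeasure_distr) (auto simp: measurable_def space_scale_measure)
  have "?M1 = ?M2"
  proof (rule config_measure_eqI)
    fix B :: "((real^'n) \<times> real) set" assume B: "B \<in> sets borel" "bounded B"
    have dis: "A \<inter> (Y \<inter> B) = {}" using K by (force simp: Y_def)
    have "emeasure P (void A \<inter> void (Y \<inter> B)) = emeasure P (void A) * emeasure P (void (Y \<inter> B))"
      using A B Y by (intro emeasure_void_disjoint[OF P \<nu> _ _ _ _ dis]) (auto intro: bounded_subset)
    then show "emeasure ?M1 (void B) = emeasure ?M2 (void B)"
      using B by (simp add: m1 m2 pre)
  next
    have "emeasure P X \<noteq> \<infinity>" for X by simp
    moreover have "configs \<in> sets (config_space :: ((real^'n) \<times> real) set measure)" using sets.top[of config_space] by simp
    ultimately show "emeasure ?M1 configs \<noteq> \<infinity>" by (simp add: m1)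
  qed auto
  then have "emeasure P (void A \<inter> (?r -` ?E \<inter> space P)) = emeasure P (void A) * emeasure P (?r -` ?E \<inter> space P)"
    by (simp only: m1[OF percolates_measurable[OF \<beta>], symmetric] m2[OF percolates_measurable[OF \<beta>], symmetric])
  moreover have "?r -` ?E \<inter> space P = ?E"
  proof -
    have "\<omega> \<inter> Y \<in> configs \<and> (percolates \<zeta> \<beta> (\<omega> \<inter> Y) \<longleftrightarrow> percolates \<zeta> \<beta> \<omega>)" if "\<omega> \<in> configs" for \<omega>
      unfolding Y_def using percolates_outside_ball[OF that \<beta>] configs_subset[OF that Int_lower1] by blast
    then show ?thesis unfolding spP by blast
  qed
  ultimately show ?thesis by simp
qed

text \<open>Independence of percolation from every bounded void extends to all events, in particular
  to percolation itself, so its probability equals its own square.\<close>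

theorem percolates_zero_one:
  fixes P :: "((real^'n) \<times> real) set measure"
  assumes P: "has_poisson_voids \<rho> \<nu> P" and \<nu>: "prob_space \<nu>" "sets \<nu> = sets borel" and \<beta>: "\<beta> \<ge> 0"
  shows "measure P {\<omega>\<in>configs. percolates \<zeta> \<beta> \<omega>} = 0 \<or> measure P {\<omega>\<in>configs. percolates \<zeta> \<beta> \<omega>} = 1"
proof -
  let ?E = "{\<omega>\<in>configs. percolates \<zeta> \<beta> \<omega>} :: ((real^'n) \<times> real) set set"
  interpret P: prob_space P by (rule has_poisson_voids_prob_space[OF P])
  have sP: "sets P = sets config_space" using P by (simp add: has_poisson_voids_def)
  have E: "?E \<in> sets P" using percolates_measurable[OF \<beta>] by (simp add: sP)
  have V: "void B \<in> sets P" if "B \<in> sets borel" for B using that by (simp add: sP)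
  let ?M1 = "density P (indicator ?E)"
  let ?M2 = "scale_measure (emeasure P ?E) P"
  have m1: "emeasure ?M1 X = emeasure P (?E \<inter> X)" if "X \<in> sets P" for X
    using that E by (intro emeasure_restricted)
  have "?M1 = ?M2"
  proof (rule config_measure_eqI)
    fix B :: "((real^'n) \<times> real) set" assume B: "B \<in> sets borel" "bounded B"
    then show "emeasure ?M1 (void B) = emeasure ?M2 (void B)"
      using percolates_indep_void[OF P \<nu> \<beta> B, of \<zeta>] m1[OF V[OF B(1)]] by (simp add: Int_commute mult.commute)
  next
    have "configs \<in> sets P" using sets.top[of P] by (simp add: space_has_poisson_voids[OF P])
    then show "emeasure ?M1 configs \<noteq> \<infinity>" by (simp add: m1)
  qed (auto simp: sP)
  then have "emeasure P ?E = emeasure P ?E * emeasure P ?E"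
    using m1[OF E] by simp
  then have "ennreal (measure P ?E) = ennreal (measure P ?E * measure P ?E)"
    by (simp add: P.emeasure_eq_measure ennreal_mult)
  then have "measure P ?E = measure P ?E * measure P ?E" by (subst (asm) ennreal_inj) auto
  then show ?thesis by auto
qed

section \<open>Scaling of the marked process\<close>

lemma nn_integral_lborel_scaleR:
  fixes f :: "'a::euclidean_space \<Rightarrow> ennreal"
  assumes c: "c > 0" and [measurable]: "f \<in> borel_measurable borel"
  shows "(\<integral>\<^sup>+ x. f (x /\<^sub>R c) \<partial>lborel) = ennreal (c ^ DIM('a)) * (\<integral>\<^sup>+ x. f x \<partial>lborel)"
proof -
  have "(\<integral>\<^sup>+ x. f (x /\<^sub>R c) \<partial>lborel) = (\<integral>\<^sup>+ x. f (x /\<^sub>R c) \<partial>density (distr lborel borel (\<lambda>x. 0 + c *\<^sub>R x)) (\<lambda>_. ennreal (\<bar>c\<bar> ^ DIM('a))))"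
    using lborel_affine[of c "0::'a"] c by simp
  also have "\<dots> = (\<integral>\<^sup>+ x. ennreal (\<bar>c\<bar> ^ DIM('a)) * f ((0 + c *\<^sub>R x) /\<^sub>R c) \<partial>lborel)"
    by (subst nn_integral_density, simp, simp, subst nn_integral_distr) auto
  also have "\<dots> = ennreal (c ^ DIM('a)) * (\<integral>\<^sup>+ x. f x \<partial>lborel)"
    using c by (simp add: nn_integral_cmult)
  finally show ?thesis .
qed

lemma borel_measurable_rescale: "rescale \<zeta> t \<in> borel_measurable borel"
proof -
  have "continuous_on UNIV (rescale \<zeta> t)" unfolding rescale_def divide_inverse by (intro continuous_intros)
  then show ?thesis by (rule borel_measurable_continuous_onI)
qed

text \<open>Slice by slice, the truncation and rescaling of the marks contribute the factor
  \<kappa>, and the dilation of the positions contributes \<open>\<zeta> ^ CARD('n)\<close>;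
  together they determine the new intensity.\<close>

lemma emeasure_rescale_vimage:
  fixes A :: "((real^'n) \<times> real) set"
  assumes \<nu>: "prob_space \<nu>" "sets \<nu> = sets borel" and \<mu>: "prob_space \<mu>" "sets \<mu> = sets borel"
    and \<zeta>: "\<zeta> > 0" and \<kappa>: "\<kappa> \<ge> 0"
    and self: "\<And>S. S \<in> sets borel \<Longrightarrow> emeasure \<nu> {e. \<bar>e\<bar> \<le> t \<and> e / t \<in> S} = ennreal \<kappa> * emeasure \<mu> S"
    and A: "A \<in> sets borel"
  shows "emeasure (lborel \<Otimes>\<^sub>M \<nu>) (rescale \<zeta> t -` A \<inter> {p. \<bar>snd p\<bar> \<le> t})
    = ennreal (\<kappa> * \<zeta> ^ CARD('n)) * emeasure (lborel \<Otimes>\<^sub>M \<mu>) A"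
proof -
  interpret \<nu>: prob_space \<nu> by fact
  interpret \<mu>: prob_space \<mu> by fact
  let ?A = "rescale \<zeta> t -` A \<inter> {p. \<bar>snd p\<bar> \<le> t}"
  have A': "?A \<in> sets (lborel \<Otimes>\<^sub>M \<nu>)"
  proof -
    have "closed {p :: (real^'n) \<times> real. \<bar>snd p\<bar> \<le> t}" by (intro closed_Collect_le continuous_intros)
    then show ?thesis
      unfolding sets_lborel_pair[OF \<nu>(2)] using measurable_sets[OF borel_measurable_rescale A] by simp
  qed
  have A1: "A \<in> sets (lborel \<Otimes>\<^sub>M \<mu>)" using A unfolding sets_lborel_pair[OF \<mu>(2)] .
  have [measurable]: "(\<lambda>x. emeasure \<mu> (Pair x -` A)) \<in> borel_measurable borel"
    using \<mu>.measurable_emeasure_Pair[OF A1] by simp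
  have "emeasure (lborel \<Otimes>\<^sub>M \<nu>) ?A = (\<integral>\<^sup>+ x. emeasure \<nu> (Pair x -` ?A) \<partial>lborel)"
    by (rule \<nu>.emeasure_pair_measure_alt[OF A'])
  also have "\<dots> = (\<integral>\<^sup>+ x. ennreal \<kappa> * emeasure \<mu> (Pair (x /\<^sub>R \<zeta>) -` A) \<partial>lborel)"
  proof (rule nn_integral_cong)
    fix x :: "real^'n"
    have "Pair x -` ?A = {e. \<bar>e\<bar> \<le> t \<and> e / t \<in> Pair (x /\<^sub>R \<zeta>) -` A}" by (auto simp: rescale_def)
    moreover have "Pair (x /\<^sub>R \<zeta>) -` A \<in> sets borel" using sets_Pair1[OF A1] \<mu>(2) by simp
    ultimately show "emeasure \<nu> (Pair x -` ?A) = ennreal \<kappa> * emeasure \<mu> (Pair (x /\<^sub>R \<zeta>) -` A)"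
      using self by (simp only:)
  qed
  also have "\<dots> = ennreal \<kappa> * (\<integral>\<^sup>+ x. emeasure \<mu> (Pair (x /\<^sub>R \<zeta>) -` A) \<partial>lborel)"
    by (rule nn_integral_cmult) simp
  also have "(\<integral>\<^sup>+ x. emeasure \<mu> (Pair (x /\<^sub>R \<zeta>) -` A) \<partial>lborel) = ennreal (\<zeta> ^ CARD('n)) * (\<integral>\<^sup>+ x. emeasure \<mu> (Pair x -` A) \<partial>lborel)"
    using nn_integral_lborel_scaleR[OF \<zeta>, of "\<lambda>x :: real^'n. emeasure \<mu> (Pair x -` A)"] by simp
  also have "(\<integral>\<^sup>+ x. emeasure \<mu> (Pair x -` A) \<partial>lborel) = emeasure (lborel \<Otimes>\<^sub>M \<mu>) A"
    by (rule \<mu>.emeasure_pair_measure_alt[OF A1, symmetric])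
  finally show ?thesis using \<kappa> \<zeta> by (simp add: ennreal_mult mult.assoc)
qed

lemma bounded_rescale_vimage:
  fixes A :: "((real^'n) \<times> real) set"
  assumes "bounded A" "\<zeta> > 0" "t > 0"
  shows "bounded (rescale \<zeta> t -` A)"
proof -
  have "rescale \<zeta> t -` A \<subseteq> ((\<lambda>x. \<zeta> *\<^sub>R x) ` fst ` A) \<times> ((\<lambda>x. t *\<^sub>R x) ` snd ` A)"
  proof
    fix p assume "p \<in> rescale \<zeta> t -` A"
    then have "(fst p /\<^sub>R \<zeta>, snd p / t) \<in> A" by (simp add: rescale_def)
    then have "fst p /\<^sub>R \<zeta> \<in> fst ` A" "snd p / t \<in> snd ` A" by force+
    then have "\<zeta> *\<^sub>R (fst p /\<^sub>R \<zeta>) \<in> (\<lambda>x. \<zeta> *\<^sub>R x) ` fst ` A" "t *\<^sub>R (snd p / t) \<in> (\<lambda>x. t *\<^sub>R x) ` snd ` A" by blast+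
    then show "p \<in> ((\<lambda>x. \<zeta> *\<^sub>R x) ` fst ` A) \<times> ((\<lambda>x. t *\<^sub>R x) ` snd ` A)"
      using assms by (cases p) simp
  qed
  moreover have "bounded (((\<lambda>x. \<zeta> *\<^sub>R x) ` fst ` A) \<times> ((\<lambda>x. t *\<^sub>R x) ` snd ` A))"
    by (intro bounded_Times bounded_scaling bounded_fst bounded_snd assms)
  ultimately show ?thesis by (rule bounded_subset[rotated])
qed

text \<open>Thinning by marks followed by an injective map again gives a Poisson process: the image
  avoids a set exactly when the original avoids the truncated preimage, so the void probabilities
  transform by the intensity measure alone.\<close>

theorem distr_rescale_PPP:
  fixes P Q :: "((real^'n) \<times> real) set measure"
  assumes P: "has_poisson_voids \<rho> \<nu> P" and \<nu>: "prob_space \<nu>" "sets \<nu> = sets borel"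
    and Q: "has_poisson_voids \<rho>' \<mu> Q" and \<mu>: "prob_space \<mu>" "sets \<mu> = sets borel"
    and \<zeta>: "\<zeta> > 0" and t: "t > 0" and \<kappa>: "\<kappa> \<ge> 0"
    and self: "\<And>S. S \<in> sets borel \<Longrightarrow> emeasure \<nu> {e. \<bar>e\<bar> \<le> t \<and> e / t \<in> S} = ennreal \<kappa> * emeasure \<mu> S"
    and \<rho>': "\<rho>' = \<rho> * \<kappa> * \<zeta> ^ CARD('n)"
  shows "(\<lambda>\<omega>. rescale \<zeta> t ` (\<omega> \<inter> {p. \<bar>snd p\<bar> \<le> t})) \<in> measurable P config_space"
    and "distr P config_space (\<lambda>\<omega>. rescale \<zeta> t ` (\<omega> \<inter> {p. \<bar>snd p\<bar> \<le> t})) = Q"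
proof -
  let ?r = "\<lambda>\<omega> :: ((real^'n) \<times> real) set. rescale \<zeta> t ` (\<omega> \<inter> {p. \<bar>snd p\<bar> \<le> t})"
  let ?A = "\<lambda>A :: ((real^'n) \<times> real) set. rescale \<zeta> t -` A \<inter> {p. \<bar>snd p\<bar> \<le> t}"
  have sP: "sets P = sets config_space" using P by (simp add: has_poisson_voids_def)
  have spP: "space P = configs" by (rule space_has_poisson_voids[OF P])
  have A': "?A A \<in> sets borel" if "A \<in> sets borel" for A
  proof -
    have "closed {p :: (real^'n) \<times> real. \<bar>snd p\<bar> \<le> t}" by (intro closed_Collect_le continuous_intros)
    then show ?thesis using measurable_sets[OF borel_measurable_rescale that] by simp
  qed
  have bA: "bounded (?A A)" if "bounded A" for A
    using bounded_rescale_vimage[OF that \<zeta> t] by (rule bounded_subset) auto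
  have rc: "?r \<omega> \<in> configs" if "\<omega> \<in> configs" for \<omega>
    using that \<zeta> t by (intro rescale_configs configs_subset[of \<omega> "\<omega> \<inter> {p. \<bar>snd p\<bar> \<le> t}"]) auto
  have eq: "{\<omega>\<in>space P. ?r \<omega> \<inter> A = {}} = void (?A A)" for A by (auto simp: spP void_def)
  show r: "?r \<in> measurable P config_space"
  proof (rule measurable_config_spaceI)
    show "{\<omega>\<in>space P. ?r \<omega> \<inter> A = {}} \<in> sets P" if "A \<in> sets borel" for A
      unfolding eq using void_measurable[OF A'[OF that]] by (simp add: sP)
  qed (use rc in \<open>simp add: spP\<close>)
  have "has_poisson_voids \<rho>' \<mu> (distr P config_space ?r)"
    unfolding has_poisson_voids_def
  proof (intro conjI allI impI)
    fix A :: "((real^'n) \<times> real) set" assume A: "A \<in> sets borel" "bounded A"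
    have "emeasure (distr P config_space ?r) (void A) = emeasure P (?r -` void A \<inter> space P)"
      using A by (intro emeasure_distr r) auto
    also have "?r -` void A \<inter> space P = void (?A A)" using rc eq[of A] by (auto simp: void_def spP)
    also have "emeasure P (void (?A A)) = ennreal (exp (- \<rho> * measure (lborel \<Otimes>\<^sub>M \<nu>) (?A A)))"
      using A' bA A by (intro emeasure_void[OF P]) auto
    also have "measure (lborel \<Otimes>\<^sub>M \<nu>) (?A A) = \<kappa> * \<zeta> ^ CARD('n) * measure (lborel \<Otimes>\<^sub>M \<mu>) A"
      using emeasure_rescale_vimage[OF \<nu> \<mu> \<zeta> \<kappa> self A(1)] \<zeta> \<kappa>
      by (simp add: measure_def enn2real_mult)
    finally show "emeasure (distr P config_space ?r) (void A) = ennreal (exp (- \<rho>' * measure (lborel \<Otimes>\<^sub>M \<mu>) A))"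
      by (simp add: \<rho>' mult.assoc)
  qed simp
  then show "distr P config_space ?r = Q" using Q by (rule has_poisson_voids_unique) simp
qed

theorem measure_percolates_rescale:
  fixes P Q :: "((real^'n) \<times> real) set measure"
  assumes P: "has_poisson_voids \<rho> \<nu> P" and \<nu>: "prob_space \<nu>" "sets \<nu> = sets borel"
    and Q: "has_poisson_voids \<rho>' \<mu> Q" and \<mu>: "prob_space \<mu>" "sets \<mu> = sets borel"
    and \<zeta>: "\<zeta> > 0" and \<beta>: "\<beta> > 0" and \<kappa>: "\<kappa> \<ge> 0"
    and self: "\<And>S. S \<in> sets borel \<Longrightarrow> emeasure \<nu> {e. \<bar>e\<bar> \<le> \<zeta> / \<beta> \<and> e / (\<zeta> / \<beta>) \<in> S} = ennreal \<kappa> * emeasure \<mu> S"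
    and \<rho>': "\<rho>' = \<rho> * \<kappa> * \<zeta> ^ CARD('n)"
  shows "measure P {\<omega>\<in>configs. percolates \<zeta> \<beta> \<omega>} = measure Q {\<omega>\<in>configs. percolates 1 1 \<omega>}"
proof -
  have t: "\<zeta> / \<beta> > 0" using \<zeta> \<beta> by simp
  let ?r = "\<lambda>\<omega> :: ((real^'n) \<times> real) set. rescale \<zeta> (\<zeta> / \<beta>) ` (\<omega> \<inter> {p. \<bar>snd p\<bar> \<le> \<zeta> / \<beta>})"
  note D = distr_rescale_PPP[OF P \<nu> Q \<mu> \<zeta> t \<kappa> self \<rho>']
  let ?E = "{\<omega>\<in>configs. percolates 1 1 \<omega>} :: ((real^'n) \<times> real) set set"
  have "measure (distr P config_space ?r) ?E = measure P (?r -` ?E \<inter> space P)"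
    by (intro measure_distr D(1) percolates_measurable) simp_all
  then have "measure Q ?E = measure P (?r -` ?E \<inter> space P)" by (simp only: D(2))
  moreover have "?r -` ?E \<inter> space P = {\<omega>\<in>configs. percolates \<zeta> \<beta> \<omega>}"
  proof -
    have "?r \<omega> \<in> configs \<and> (percolates 1 1 (?r \<omega>) \<longleftrightarrow> percolates \<zeta> \<beta> \<omega>)" if "\<omega> \<in> configs" for \<omega>
    proof -
      have c: "\<omega> \<inter> {p. \<bar>snd p\<bar> \<le> \<zeta> / \<beta>} \<in> configs" by (rule configs_subset[OF that]) auto
      then show ?thesis
        using percolates_rescale[OF c \<zeta> \<beta>] percolates_bounded_marks[OF that \<beta>, of \<zeta>] rescale_configs[OF c, of \<zeta> "\<zeta> / \<beta>"] \<zeta> \<beta> by simp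
    qed
    then show ?thesis unfolding space_has_poisson_voids[OF P] by blast
  qed
  ultimately show ?thesis by simp
qed

section \<open>No percolation at small intensity\<close>

definition hit :: "((real^'n) \<times> real) set \<Rightarrow> ((real^'n) \<times> real) set set" where
  "hit A = {\<omega> \<in> configs. \<omega> \<inter> A \<noteq> {}}"

lemma hit_measurable: "A \<in> sets borel \<Longrightarrow> hit A \<in> sets (config_space :: ((real^'n) \<times> real) set measure)"
proof -
  assume "A \<in> sets borel"
  then have "space config_space - void A \<in> sets config_space" by (intro sets.compl_sets void_measurable)
  moreover have "space config_space - void A = hit A" by (auto simp: void_def hit_def)
  ultimately show ?thesis by simp
qed

text \<open>Hits of disjoint regions are independent because voids are. The additional void of
  \<open>A\<close> makes the induction work: a hit of \<open>B j\<close> is everything minus its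
  void, and that void is absorbed into \<open>A\<close>.\<close>

lemma measure_void_hits:
  fixes P :: "((real^'n) \<times> real) set measure"
  assumes P: "has_poisson_voids \<rho> \<nu> P" and \<nu>: "prob_space \<nu>" "sets \<nu> = sets borel"
    and "finite S" "\<And>i. i \<in> S \<Longrightarrow> B i \<in> sets borel \<and> bounded (B i)" "disjoint_family_on B S"
    and "A \<in> sets borel" "bounded A" "\<And>i. i \<in> S \<Longrightarrow> A \<inter> B i = {}"
  shows "measure P (void A \<inter> (\<Inter>i\<in>S. hit (B i))) = measure P (void A) * (\<Prod>i\<in>S. 1 - measure P (void (B i)))"
  using assms(4-)
proof (induction S arbitrary: A rule: finite_induct)
  case (insert j S)
  interpret P: prob_space P by (rule has_poisson_voids_prob_space[OF P])
  have sP: "sets P = sets config_space" using P by (simp add: has_poisson_voids_def)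
  let ?X = "\<Inter>i\<in>S. hit (B i)"
  have disj: "disjoint_family_on B S" using insert.prems(2) by (rule disjoint_family_on_mono[rotated]) auto
  have Bj: "B j \<in> sets borel" "bounded (B j)" using insert.prems(1) by auto
  have BjS: "B j \<inter> B i = {}" if "i \<in> S" for i
    using insert.prems(2) insert.hyps(2) that by (auto simp: disjoint_family_on_def)
  have hm: "hit (B i) \<in> sets P" if "i \<in> insert j S" for i unfolding sP using insert.prems(1)[OF that] by (intro hit_measurable) simp
  have vm: "void C \<in> sets P" if "C \<in> sets borel" for C using that by (simp add: sP)
  have AX: "void C \<inter> ?X \<in> sets P" if "C \<in> sets borel" for C
  proof (cases "S = {}")
    case False
    then show ?thesis using hm insert.hyps(1) by (intro sets.Int vm that sets.finite_INT) auto
  qed (use vm that in auto)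
  have "void A \<inter> (\<Inter>i\<in>insert j S. hit (B i)) = (void A \<inter> ?X) - (void (A \<union> B j) \<inter> ?X)"
    by (auto simp: void_def hit_def)
  then have "measure P (void A \<inter> (\<Inter>i\<in>insert j S. hit (B i))) = measure P (void A \<inter> ?X) - measure P (void (A \<union> B j) \<inter> ?X)"
    using insert.prems(3) Bj by (simp only:) (intro P.finite_measure_Diff AX; auto simp: void_def)
  also have "measure P (void A \<inter> ?X) = measure P (void A) * (\<Prod>i\<in>S. 1 - measure P (void (B i)))"
    using insert.prems disj by (intro insert.IH) auto
  also have "measure P (void (A \<union> B j) \<inter> ?X) = measure P (void (A \<union> B j)) * (\<Prod>i\<in>S. 1 - measure P (void (B i)))"
    using insert.prems disj BjS Bj by (intro insert.IH) (auto simp: Int_Un_distrib2)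
  also have "measure P (void (A \<union> B j)) = measure P (void A) * measure P (void (B j))"
  proof -
    have "emeasure P (void A \<inter> void (B j)) = emeasure P (void A) * emeasure P (void (B j))"
      using insert.prems Bj by (intro emeasure_void_disjoint[OF P \<nu>]) auto
    then show ?thesis by (simp add: void_Int measure_def enn2real_mult)
  qed
  finally show ?case using insert.hyps by (simp add: algebra_simps)
qed simp

lemma measure_hits:
  fixes P :: "((real^'n) \<times> real) set measure"
  assumes P: "has_poisson_voids \<rho> \<nu> P" and \<nu>: "prob_space \<nu>" "sets \<nu> = sets borel"
    and S: "finite S" "S \<noteq> {}" "\<And>i. i \<in> S \<Longrightarrow> B i \<in> sets borel \<and> bounded (B i)" "disjoint_family_on B S"
  shows "measure P (\<Inter>i\<in>S. hit (B i)) = (\<Prod>i\<in>S. 1 - measure P (void (B i)))"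
proof -
  interpret P: prob_space P by (rule has_poisson_voids_prob_space[OF P])
  have "configs \<inter> (\<Inter>i\<in>S. hit (B i)) = (\<Inter>i\<in>S. hit (B i))" using S(2) by (auto simp: hit_def)
  then show ?thesis
    using measure_void_hits[OF P \<nu> S(1,3,4), of "{}"] P.prob_space by (simp add: space_has_poisson_voids[OF P])
qed

section \<open>Unit cells and occupied lattice paths\<close>

definition cell :: "(real^'n) \<times> real \<Rightarrow> 'n \<Rightarrow> int" where
  "cell p i = \<lfloor>fst p $ i\<rfloor>"

definition cell_box :: "('n \<Rightarrow> int) \<Rightarrow> ((real^'n) \<times> real) set" where
  "cell_box z = {p. cell p = z \<and> \<bar>snd p\<bar> \<le> 1}"

text \<open>Diagonal neighbours and the cell itself are included, since an edge of length at most 1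
  can join any two such cells; this gives \<open>3 ^ CARD('n)\<close> neighbours.\<close>

definition cell_adj :: "('n \<Rightarrow> int) \<Rightarrow> ('n \<Rightarrow> int) \<Rightarrow> bool" where
  "cell_adj z z' \<longleftrightarrow> (\<forall>i. \<bar>z i - z' i\<bar> \<le> 1)"

lemma cell_box_sets: "cell_box z \<in> sets (borel :: ((real^'n) \<times> real) measure)"
proof -
  have m: "(\<lambda>p :: (real^'n) \<times> real. fst p $ i) \<in> borel_measurable borel" for i
    by (intro borel_measurable_continuous_onI continuous_intros)
  have m2: "(\<lambda>p :: (real^'n) \<times> real. snd p) \<in> borel_measurable borel"
    by (intro borel_measurable_continuous_onI continuous_intros)
  have "cell_box z = {p \<in> space borel. (\<forall>i\<in>UNIV. \<lfloor>fst p $ i\<rfloor> = z i) \<and> \<bar>snd p\<bar> \<le> 1}"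
    by (auto simp: cell_box_def cell_def fun_eq_iff)
  also have "\<dots> \<in> sets borel"
    using m m2 by measurable
  finally show ?thesis .
qed

lemma cell_box_subset:
  "cell_box z \<subseteq> cbox (\<chi> i. real_of_int (z i)) (\<chi> i. real_of_int (z i) + 1) \<times> cball 0 1"
proof
  fix p assume p: "p \<in> cell_box z"
  then have z: "z i = \<lfloor>fst p $ i\<rfloor>" for i by (auto simp: cell_box_def cell_def)
  have "real_of_int (z i) \<le> fst p $ i \<and> fst p $ i \<le> real_of_int (z i) + 1" for i
    unfolding z by linarith
  then have "fst p \<in> cbox (\<chi> i. real_of_int (z i)) (\<chi> i. real_of_int (z i) + 1)" by (simp add: mem_box_cart)
  then show "p \<in> cbox (\<chi> i. real_of_int (z i)) (\<chi> i. real_of_int (z i) + 1) \<times> cball 0 1"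
    using p by (cases p) (simp add: cell_box_def)
qed

lemma bounded_cell_box: "bounded (cell_box z)"
  by (rule bounded_subset[OF _ cell_box_subset]) (intro bounded_Times bounded_cbox bounded_cball)

lemma disjoint_cell_boxes: "disjoint_family cell_box"
  by (auto simp: disjoint_family_on_def cell_box_def)

lemma measure_cell_box_le:
  assumes \<nu>: "prob_space \<nu>" "sets \<nu> = sets borel"
  shows "measure (lborel \<Otimes>\<^sub>M \<nu>) (cell_box z :: ((real^'n) \<times> real) set) \<le> 1"
proof -
  interpret \<nu>: prob_space \<nu> by fact
  let ?C = "cbox (\<chi> i. real_of_int (z i)) (\<chi> i. real_of_int (z i) + 1) :: (real^'n) set"
  have ne: "?C \<noteq> {}" by (auto simp: interval_ne_empty_cart)
  have "emeasure (lborel \<Otimes>\<^sub>M \<nu>) (cell_box z) \<le> emeasure (lborel \<Otimes>\<^sub>M \<nu>) (?C \<times> space \<nu>)"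
  proof (rule emeasure_mono)
    show "cell_box z \<subseteq> ?C \<times> space \<nu>"
      using cell_box_subset[of z] sets_eq_imp_space_eq[OF \<nu>(2)] by auto
    show "?C \<times> space \<nu> \<in> sets (lborel \<Otimes>\<^sub>M \<nu>)" by (intro pair_measureI) auto
  qed
  also have "\<dots> = emeasure lborel ?C * emeasure \<nu> (space \<nu>)" by (rule \<nu>.emeasure_pair_measure_Times) auto
  also have "\<dots> = ennreal (measure lborel ?C)"
    using emeasure_lborel_cbox_finite[of "\<chi> i. real_of_int (z i)" "\<chi> i. real_of_int (z i) + 1"]
    by (simp add: \<nu>.emeasure_space_1 emeasure_eq_ennreal_measure less_top)
  also have "measure lborel ?C = 1" using content_cbox_cart[OF ne] by simp
  finally show ?thesis by (simp add: measure_def enn2real_leI)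
qed

lemma hit_cell_box_le:
  fixes P :: "((real^'n) \<times> real) set measure"
  assumes P: "has_poisson_voids \<rho> \<nu> P" and \<nu>: "prob_space \<nu>" "sets \<nu> = sets borel" and \<rho>: "\<rho> \<ge> 0"
  shows "1 - measure P (void (cell_box z)) \<le> \<rho>"
proof -
  have "emeasure P (void (cell_box z)) = ennreal (exp (- \<rho> * measure (lborel \<Otimes>\<^sub>M \<nu>) (cell_box z)))"
    by (intro emeasure_void[OF P] cell_box_sets bounded_cell_box)
  then have "measure P (void (cell_box z)) = exp (- \<rho> * measure (lborel \<Otimes>\<^sub>M \<nu>) (cell_box z))" by (simp add: measure_def)
  also have "\<dots> \<ge> exp (- \<rho>)"
    using mult_left_mono[OF measure_cell_box_le[OF \<nu>, of z] \<rho>] by simp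
  finally have "exp (- \<rho>) \<le> measure P (void (cell_box z))" .
  then show ?thesis using exp_ge_add_one_self[of "- \<rho>"] by linarith
qed

fun lattice_paths :: "nat \<Rightarrow> ('n \<Rightarrow> int) \<Rightarrow> ('n \<Rightarrow> int) list set" where
  "lattice_paths 0 z = {[z]}"
| "lattice_paths (Suc n) z = (\<Union>z'\<in>{z'. cell_adj z z'}. (#) z ` lattice_paths n z')"

lemma card_cell_adj:
  fixes z :: "'n::finite \<Rightarrow> int"
  shows "finite {z'. cell_adj z z'}" "card {z'. cell_adj z z'} = 3 ^ CARD('n)"
proof -
  have "{z'. cell_adj z z'} = PiE UNIV (\<lambda>i. {z i - 1..z i + 1})"
    by (auto simp: cell_adj_def PiE_UNIV_domain abs_le_iff Pi_iff) (smt (verit))+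
  then show "finite {z'. cell_adj z z'}" "card {z'. cell_adj z z'} = 3 ^ CARD('n)"
    by (auto simp: card_PiE intro!: finite_PiE)
qed

lemma card_lattice_paths:
  fixes z :: "'n::finite \<Rightarrow> int"
  shows "finite (lattice_paths n z) \<and> card (lattice_paths n z) \<le> (3 ^ CARD('n)) ^ n"
proof (induction n arbitrary: z)
  case (Suc n)
  have "card (lattice_paths (Suc n) z) \<le> (\<Sum>z'\<in>{z'. cell_adj z z'}. card ((#) z ` lattice_paths n z'))"
    unfolding lattice_paths.simps by (rule card_UN_le[OF card_cell_adj(1)])
  also have "\<dots> \<le> (\<Sum>z'\<in>{z'. cell_adj z z'}. (3 ^ CARD('n)) ^ n)"
    using Suc by (intro sum_mono) (meson card_image_le order_trans)
  also have "\<dots> = (3 ^ CARD('n)) ^ Suc n" by (simp add: card_cell_adj)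
  finally show ?case using Suc card_cell_adj(1) by auto
qed simp

lemma length_lattice_paths: "l \<in> lattice_paths n z \<Longrightarrow> length l = Suc n"
  by (induction n arbitrary: l z) auto

lemma map_in_lattice_paths:
  "(\<And>i. i < n \<Longrightarrow> cell_adj (f i) (f (Suc i))) \<Longrightarrow> map f [0..<Suc n] \<in> lattice_paths n (f 0)"
proof (induction n arbitrary: f)
  case (Suc n)
  have "map (\<lambda>i. f (Suc i)) [0..<Suc n] \<in> lattice_paths n (f (Suc 0))"
    using Suc.prems by (intro Suc.IH) simp
  moreover have "map f [0..<Suc (Suc n)] = f 0 # map (\<lambda>i. f (Suc i)) [0..<Suc n]"
    by (subst upt_conv_Cons) (simp_all add: map_Suc_upt[symmetric] del: upt_Suc map_Suc_upt)
  moreover have "cell_adj (f 0) (f (Suc 0))" using Suc.prems by simp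
  ultimately show ?case unfolding lattice_paths.simps by (simp only:) blast
qed simp

definition occupied_path :: "nat \<Rightarrow> ('n::finite \<Rightarrow> int) \<Rightarrow> ((real^'n) \<times> real) set set" where
  "occupied_path n z = (\<Union>l\<in>{l\<in>lattice_paths n z. distinct l}. \<Inter>z'\<in>set l. hit (cell_box z'))"

lemma occupied_path_measurable: "occupied_path n z \<in> sets (config_space :: ((real^'n) \<times> real) set measure)"
  unfolding occupied_path_def
proof (rule sets.finite_UN)
  show "finite {l \<in> lattice_paths n z. distinct l}" using card_lattice_paths[of n z] by simp
  fix l assume "l \<in> {l \<in> lattice_paths n z. distinct l}"
  then have "l \<noteq> []" using length_lattice_paths[of l n z] by auto
  then show "(\<Inter>z'\<in>set l. hit (cell_box z')) \<in> sets config_space"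
    by (intro sets.finite_INT hit_measurable cell_box_sets) auto
qed

text \<open>A union bound over at most \<open>3 ^ CARD('n)\<close> choices per step. A path has
  \<open>Suc n\<close> distinct cells, each hit with probability at most \<rho>; one factor is given
  away to match the number of steps.\<close>

lemma measure_occupied_path_le:
  fixes P :: "((real^'n) \<times> real) set measure"
  assumes P: "has_poisson_voids \<rho> \<nu> P" and \<nu>: "prob_space \<nu>" "sets \<nu> = sets borel" and \<rho>: "\<rho> \<ge> 0" "\<rho> \<le> 1"
  shows "measure P (occupied_path n z) \<le> (3 ^ CARD('n) * \<rho>) ^ n"
proof -
  interpret P: prob_space P by (rule has_poisson_voids_prob_space[OF P])
  have sP: "sets P = sets config_space" using P by (simp add: has_poisson_voids_def)
  let ?L = "{l \<in> lattice_paths n z. distinct l}"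
  have fin: "finite ?L" using card_lattice_paths[of n z] by simp
  have l: "measure P (\<Inter>z'\<in>set l. hit (cell_box z')) \<le> \<rho> ^ n" if "l \<in> ?L" for l
  proof -
    have len: "length l = Suc n" "distinct l" using that length_lattice_paths by auto
    have "measure P (\<Inter>z'\<in>set l. hit (cell_box z')) = (\<Prod>z'\<in>set l. 1 - measure P (void (cell_box z')))"
      using len by (intro measure_hits[OF P \<nu>])
        (auto intro: cell_box_sets bounded_cell_box disjoint_family_on_mono[OF subset_UNIV disjoint_cell_boxes])
    also have "\<dots> \<le> (\<Prod>z'\<in>set l. \<rho>)"
      using hit_cell_box_le[OF P \<nu> \<rho>(1)] by (intro prod_mono) auto
    also have "\<dots> = \<rho> ^ Suc n" using len by (simp add: distinct_card)
    also have "\<dots> \<le> \<rho> ^ n" using \<rho> by (simp add: mult_left_le_one_le)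
    finally show ?thesis .
  qed
  have "measure P (occupied_path n z) \<le> (\<Sum>l\<in>?L. measure P (\<Inter>z'\<in>set l. hit (cell_box z')))"
    unfolding occupied_path_def
  proof (rule P.finite_measure_subadditive_finite[OF fin], safe)
    fix l assume "l \<in> lattice_paths n z" "distinct l"
    then have "l \<noteq> []" using length_lattice_paths[of l n z] by auto
    then show "(\<Inter>z'\<in>set l. hit (cell_box z')) \<in> sets P"
      unfolding sP by (intro sets.finite_INT hit_measurable cell_box_sets) auto
  qed
  also have "\<dots> \<le> (\<Sum>l\<in>?L. \<rho> ^ n)" using l by (intro sum_mono)
  also have "\<dots> = real (card ?L) * \<rho> ^ n" by simp
  also have "\<dots> \<le> real ((3 ^ CARD('n)) ^ n) * \<rho> ^ n"
  proof (intro mult_right_mono of_nat_mono)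
    have "card ?L \<le> card (lattice_paths n z)" using card_lattice_paths[of n z] by (intro card_mono) auto
    then show "card ?L \<le> (3 ^ CARD('n)) ^ n" using card_lattice_paths[of n z] by linarith
  qed (use \<rho> in simp)
  also have "\<dots> = (3 ^ CARD('n) * \<rho>) ^ n" by (simp add: power_mult_distrib)
  finally show ?thesis .
qed

text \<open>A repetition in a chain of minimal length could be cut out, leaving a shorter
  chain.\<close>

lemma relpow_shortest:
  assumes "(a, b) \<in> R\<^sup>*"
  obtains k f where "f 0 = a" "f k = b" "\<And>i. i < k \<Longrightarrow> (f i, f (Suc i)) \<in> R" "inj_on f {..k}"
proof -
  define k where "k = (LEAST k. (a, b) \<in> R ^^ k)"
  have ex: "\<exists>k. (a, b) \<in> R ^^ k" using assms rtrancl_imp_relpow by blast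
  have k: "(a, b) \<in> R ^^ k" unfolding k_def using ex by (rule LeastI_ex)
  then obtain f where f: "f 0 = a" "f k = b" "\<And>i. i < k \<Longrightarrow> (f i, f (Suc i)) \<in> R"
    unfolding relpow_fun_conv by blast
  have seg: "(f i, f j) \<in> R ^^ (j - i)" if "i \<le> j" "j \<le> k" for i j
    unfolding relpow_fun_conv using that f(3) by (intro exI[of _ "\<lambda>m. f (i + m)"]) auto
  have "False" if "i < j" "j \<le> k" "f i = f j" for i j
  proof -
    have "(a, f i) \<in> R ^^ i" using seg[of 0 i] that f(1) by simp
    moreover have "(f i, b) \<in> R ^^ (k - j)" using seg[of j k] that f(2) by simp
    ultimately have "(a, b) \<in> R ^^ (i + (k - j))" unfolding relpow_add by blast
    then have "k \<le> i + (k - j)" unfolding k_def by (rule Least_le)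
    then show False using that by simp
  qed
  then have "inj_on f {..k}"
    by (auto simp: inj_on_def) (metis linorder_neqE_nat)
  then show ?thesis using that f by blast
qed

lemma cell_near:
  assumes "near 1 1 p q"
  shows "cell_adj (cell p) (cell q)" "p \<in> cell_box (cell p)" "q \<in> cell_box (cell q)"
proof -
  have "\<bar>fst p $ i - fst q $ i\<bar> \<le> 1" for i
    using near_norm_le[OF assms] component_le_norm_cart[of "fst p - fst q" i] by simp
  then have "fst p $ i \<le> fst q $ i + 1 \<and> fst q $ i \<le> fst p $ i + 1" for i
    by (simp add: abs_le_iff algebra_simps)
  then have "\<lfloor>fst p $ i\<rfloor> \<le> \<lfloor>fst q $ i\<rfloor> + 1 \<and> \<lfloor>fst q $ i\<rfloor> \<le> \<lfloor>fst p $ i\<rfloor> + 1" for i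
    using floor_mono[of "fst p $ i" "fst q $ i + 1"] floor_mono[of "fst q $ i" "fst p $ i + 1"] by simp
  then have "\<bar>\<lfloor>fst p $ i\<rfloor> - \<lfloor>fst q $ i\<rfloor>\<bar> \<le> 1" for i by (simp add: abs_le_iff algebra_simps)
  then show "cell_adj (cell p) (cell q)" by (simp add: cell_adj_def cell_def)
  show "p \<in> cell_box (cell p)" "q \<in> cell_box (cell q)" using near_mark_le[OF assms] by (auto simp: cell_box_def)
qed

text \<open>A cluster point far from p lies in a cell far from that of p. A shortest chain of
  occupied cells between the two never repeats a cell and has more than n steps, so its first n
  steps form the required path.\<close>

lemma percolates_occupied_path:
  fixes \<omega> :: "((real^'n) \<times> real) set"
  assumes \<omega>: "\<omega> \<in> configs" and "percolates 1 1 \<omega>"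
  shows "\<exists>z. \<forall>n. \<omega> \<in> occupied_path n z"
proof -
  obtain p where p: "p \<in> \<omega>" "\<not> bounded (fst ` cluster 1 1 \<omega> p)" using assms percolates_iff_cluster[OF \<omega>] by blast
  define R where "R = {(z, z'). cell_adj z z' \<and> \<omega> \<in> hit (cell_box z) \<and> \<omega> \<in> hit (cell_box z')}"
  have reach: "(cell p, cell q) \<in> R\<^sup>*" if "q \<in> cluster 1 1 \<omega> p" for q
  proof -
    have "(p, q) \<in> (links 1 1 \<omega>)\<^sup>*" using that by (simp add: cluster_def)
    then show ?thesis
    proof (induction rule: rtrancl_induct)
      case (step q r)
      then have qr: "q \<in> \<omega>" "r \<in> \<omega>" "near 1 1 q r" by (auto simp: links_def)
      then have "\<omega> \<in> hit (cell_box (cell q))" "\<omega> \<in> hit (cell_box (cell r))"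
        using cell_near(2,3)[OF qr(3)] \<omega> by (auto simp: hit_def)
      then have "(cell q, cell r) \<in> R" using cell_near(1)[OF qr(3)] by (auto simp: R_def)
      then show ?case using step(3) by simp
    qed simp
  qed
  have "\<omega> \<in> occupied_path n (cell p)" for n
  proof -
    \<comment> \<open>The norm is at most the sum of the \<open>CARD('n)\<close> coordinates in
      absolute value, so this distance forces some coordinate to differ by more than
      \<open>n + 1\<close>.\<close>
    have "\<exists>q\<in>cluster 1 1 \<omega> p. norm (fst p) + real CARD('n) * (real n + 1) < norm (fst q)"
    proof (rule ccontr)
      assume "\<not> ?thesis"
      then have "\<forall>x\<in>fst ` cluster 1 1 \<omega> p. norm x \<le> norm (fst p) + real CARD('n) * (real n + 1)" by force
      then show False using p(2) unfolding bounded_iff by blast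
    qed
    then obtain q where q: "q \<in> cluster 1 1 \<omega> p" "norm (fst p) + real CARD('n) * (real n + 1) < norm (fst q)" by blast
    have "\<exists>i. real n + 1 < \<bar>(fst q - fst p) $ i\<bar>"
    proof (rule ccontr)
      assume "\<not> ?thesis"
      then have "(\<Sum>i\<in>UNIV. \<bar>(fst q - fst p) $ i\<bar>) \<le> real CARD('n) * (real n + 1)"
        using sum_bounded_above[of UNIV "\<lambda>i. \<bar>(fst q - fst p) $ i\<bar>" "real n + 1"] by (auto simp: not_less)
      then have "norm (fst q - fst p) \<le> real CARD('n) * (real n + 1)"
        using norm_le_l1_cart[of "fst q - fst p"] by linarith
      then show False using q(2) norm_triangle_ineq2[of "fst q" "fst p"] by linarith
    qed
    then obtain i where i: "real n + 1 < \<bar>fst q $ i - fst p $ i\<bar>" by auto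
    \<comment> \<open>Rounding down changes a difference by less than 1, which is why one extra unit
      was put into the distance.\<close>
    have far: "int n < \<bar>cell q i - cell p i\<bar>"
      using i unfolding cell_def by linarith
    obtain k f where f: "f 0 = cell p" "f k = cell q" "\<And>i. i < k \<Longrightarrow> (f i, f (Suc i)) \<in> R" "inj_on f {..k}"
      using relpow_shortest[OF reach[OF q(1)]] by blast
    have "\<bar>f j i - f 0 i\<bar> \<le> int j" if "j \<le> k" for j
      using that
    proof (induction j)
      case (Suc j)
      have "(f j, f (Suc j)) \<in> R" using f(3) Suc.prems by simp
      then have "\<bar>f j i - f (Suc j) i\<bar> \<le> 1" by (auto simp: R_def cell_adj_def)
      then show ?case using Suc by simp
    qed simp
    from this[of k] have nk: "n < k" using far f by simp
    have "map f [0..<Suc n] \<in> lattice_paths n (f 0)"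
      using f(3) nk by (intro map_in_lattice_paths) (auto simp: R_def)
    moreover have "distinct (map f [0..<Suc n])"
      using nk by (simp add: distinct_map inj_on_subset[OF f(4)] del: upt_Suc)
        (intro inj_on_subset[OF f(4)], auto)
    moreover have "\<omega> \<in> (\<Inter>z'\<in>set (map f [0..<Suc n]). hit (cell_box z'))"
    proof
      fix z' assume "z' \<in> set (map f [0..<Suc n])"
      then have "z' \<in> f ` {..<Suc n}" by (simp only: set_map set_upt atLeast0LessThan)
      then obtain j where "j \<le> n" "z' = f j" by (auto simp: less_Suc_eq_le)
      then show "\<omega> \<in> hit (cell_box z')" using f(3)[of j] nk by (auto simp: R_def)
    qed
    ultimately show "\<omega> \<in> occupied_path n (cell p)" unfolding occupied_path_def f(1) by blast
  qed
  then show ?thesis by blast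
qed

text \<open>For each starting cell the bound decays geometrically in the length of the path, so
  infinitely long occupied paths from it have probability 0; there are only countably many starting
  cells.\<close>

theorem no_percolation_small_intensity:
  fixes P :: "((real^'n) \<times> real) set measure"
  assumes P: "has_poisson_voids \<rho> \<nu> P" and \<nu>: "prob_space \<nu>" "sets \<nu> = sets borel"
    and \<rho>: "\<rho> \<ge> 0" "3 ^ CARD('n) * \<rho> < 1"
  shows "measure P {\<omega>\<in>configs. percolates 1 1 \<omega>} = 0"
proof -
  interpret P: prob_space P by (rule has_poisson_voids_prob_space[OF P])
  have sP: "sets P = sets config_space" using P by (simp add: has_poisson_voids_def)
  have \<rho>1: "\<rho> \<le> 1"
  proof -
    have "1 * \<rho> \<le> 3 ^ CARD('n) * \<rho>" using \<rho>(1) by (intro mult_right_mono) auto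
    then show ?thesis using \<rho>(2) by linarith
  qed
  have om: "occupied_path n z \<in> sets P" for n z by (simp add: sP occupied_path_measurable)
  have null: "(\<Inter>n. occupied_path n z) \<in> null_sets P" for z
  proof -
    have "measure P (\<Inter>n. occupied_path n z) \<le> (3 ^ CARD('n) * \<rho>) ^ n" for n
    proof -
      have "measure P (\<Inter>n. occupied_path n z) \<le> measure P (occupied_path n z)"
        using om by (intro P.finite_measure_mono) auto
      also have "\<dots> \<le> (3 ^ CARD('n) * \<rho>) ^ n" by (rule measure_occupied_path_le[OF P \<nu> \<rho>(1) \<rho>1])
      finally show ?thesis .
    qed
    moreover have "(\<lambda>n. (3 ^ CARD('n) * \<rho>) ^ n) \<longlonglongrightarrow> 0"
      using \<rho> by (intro LIMSEQ_realpow_zero) auto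
    ultimately have "measure P (\<Inter>n. occupied_path n z) \<le> 0" by (intro LIMSEQ_le_const) auto
    then have "measure P (\<Inter>n. occupied_path n z) = 0" using measure_nonneg[of P] by (intro antisym)
    then show ?thesis using om by (intro null_setsI) (auto simp: P.emeasure_eq_measure)
  qed
  have "(\<Union>z::'n \<Rightarrow> int. \<Inter>n. occupied_path n z) \<in> null_sets P" using null by (intro null_sets_UN)
  moreover have "{\<omega>\<in>configs. percolates 1 1 \<omega>} \<in> sets P" using percolates_measurable[of 1 1] by (simp add: sP)
  moreover have "{\<omega>\<in>configs. percolates 1 1 \<omega>} \<subseteq> (\<Union>z::'n \<Rightarrow> int. \<Inter>n. occupied_path n z)"
  proof
    fix \<omega> :: "((real^'n) \<times> real) set" assume "\<omega> \<in> {\<omega>\<in>configs. percolates 1 1 \<omega>}"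
    then show "\<omega> \<in> (\<Union>z::'n \<Rightarrow> int. \<Inter>n. occupied_path n z)"
      using percolates_occupied_path[of \<omega>] by simp
  qed
  ultimately have "{\<omega>\<in>configs. percolates 1 1 \<omega>} \<in> null_sets P" by (rule null_sets_subset)
  then show ?thesis by (rule measure_eq_0_null_sets)
qed

section \<open>Hierarchical blocks on a planar lattice\<close>

definition subs :: "nat \<times> nat \<Rightarrow> (nat \<times> nat) set" where
  "subs p = {3 * fst p..<3 * fst p + 3} \<times> {3 * snd p..<3 * snd p + 3}"

fun bad :: "(nat \<times> nat \<Rightarrow> bool) \<Rightarrow> nat \<Rightarrow> nat \<times> nat \<Rightarrow> bool" where
  "bad C 0 p = C p"
| "bad C (Suc n) p = (\<exists>c\<in>subs p. \<exists>c'\<in>subs p. c \<noteq> c' \<and> bad C n c \<and> bad C n c')"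

text \<open>The sites that remain when bad sub-blocks are discarded at every level below n.
  Connectivity can be claimed only for these, since a good block may contain isolated open sites
  inside its bad sub-block.\<close>

fun core :: "(nat \<times> nat \<Rightarrow> bool) \<Rightarrow> nat \<Rightarrow> nat \<times> nat \<Rightarrow> (nat \<times> nat) set" where
  "core C 0 p = {p}"
| "core C (Suc n) p = (\<Union>c\<in>{c\<in>subs p. \<not> bad C n c}. core C n c)"

definition site_step :: "(nat \<times> nat \<Rightarrow> bool) \<Rightarrow> ((nat \<times> nat) \<times> (nat \<times> nat)) set" where
  "site_step C = {(p, q). \<not> C p \<and> \<not> C q \<and>
     (q = (Suc (fst p), snd p) \<or> q = (fst p, Suc (snd p)) \<or> p = (Suc (fst q), snd q) \<or> p = (fst q, Suc (snd q)))}"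

definition site_conn :: "(nat \<times> nat \<Rightarrow> bool) \<Rightarrow> ((nat \<times> nat) \<times> (nat \<times> nat)) set" where
  "site_conn C = (site_step C)\<^sup>*"

lemma site_conn_sym: "(u, v) \<in> site_conn C \<Longrightarrow> (v, u) \<in> site_conn C"
proof -
  have "sym (site_step C)" by (auto simp: sym_def site_step_def)
  then have "sym (site_conn C)" unfolding site_conn_def by (rule sym_rtrancl)
  then show "(u, v) \<in> site_conn C \<Longrightarrow> (v, u) \<in> site_conn C" by (rule symD)
qed

lemma site_conn_trans: "(u, v) \<in> site_conn C \<Longrightarrow> (v, w) \<in> site_conn C \<Longrightarrow> (u, w) \<in> site_conn C"
  unfolding site_conn_def by (rule rtrancl_trans)

text \<open>A row and a column missing the exceptional cell meet in a hub, and every other cell reaches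
  the hub along its row or its column.\<close>

lemma grid_minus_cell_connected:
  fixes G :: "nat \<Rightarrow> nat \<Rightarrow> bool" and K :: "nat \<Rightarrow> nat \<Rightarrow> nat \<Rightarrow> nat \<Rightarrow> bool"
  assumes one: "\<And>i j i' j'. i < 3 \<Longrightarrow> j < 3 \<Longrightarrow> i' < 3 \<Longrightarrow> j' < 3 \<Longrightarrow> \<not> G i j \<Longrightarrow> \<not> G i' j' \<Longrightarrow> i = i' \<and> j = j'"
    and refl: "\<And>i j. i < 3 \<Longrightarrow> j < 3 \<Longrightarrow> G i j \<Longrightarrow> K i j i j"
    and sym: "\<And>i j i' j'. K i j i' j' \<Longrightarrow> K i' j' i j"
    and trans: "\<And>i j i' j' i'' j''. K i j i' j' \<Longrightarrow> G i' j' \<Longrightarrow> i' < 3 \<Longrightarrow> j' < 3 \<Longrightarrow> K i' j' i'' j'' \<Longrightarrow> K i j i'' j''"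
    and H: "\<And>i j. i < 3 \<Longrightarrow> j < 2 \<Longrightarrow> G i j \<Longrightarrow> G i (Suc j) \<Longrightarrow> K i j i (Suc j)"
    and V: "\<And>i j. i < 2 \<Longrightarrow> j < 3 \<Longrightarrow> G i j \<Longrightarrow> G (Suc i) j \<Longrightarrow> K i j (Suc i) j"
    and ij: "i < 3" "j < 3" "G i j" "i' < 3" "j' < 3" "G i' j'"
  shows "K i j i' j'"
proof -
  have lt3: "n < 3 \<longleftrightarrow> n = 0 \<or> n = 1 \<or> n = 2" for n :: nat by auto
  have row: "K i j i j'" if full: "\<And>j. j < 3 \<Longrightarrow> G i j" and i: "i < 3" and j: "j < 3" "j' < 3" for i j j'
  proof -
    have g: "G i 0" "G i 1" "G i 2" using full by auto
    have r: "K i 0 i 0" "K i 1 i 1" "K i 2 i 2" using refl[OF i] g by auto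
    have 01: "K i 0 i 1" and 12: "K i 1 i 2" using H[OF i, of 0] H[OF i, of 1] g by (auto simp: numeral_2_eq_2)
    have 02: "K i 0 i 2" using trans[OF 01 g(2) i _ 12] by simp
    show ?thesis using j r 01 12 02 sym[OF 01] sym[OF 12] sym[OF 02] unfolding lt3 by (elim disjE) simp_all
  qed
  have col: "K i j i' j" if full: "\<And>i. i < 3 \<Longrightarrow> G i j" and j: "j < 3" and i: "i < 3" "i' < 3" for i i' j
  proof -
    have g: "G 0 j" "G 1 j" "G 2 j" using full by auto
    have r: "K 0 j 0 j" "K 1 j 1 j" "K 2 j 2 j" using refl[OF _ j] g by auto
    have 01: "K 0 j 1 j" and 12: "K 1 j 2 j" using V[of 0 j] V[of 1 j] g j by (auto simp: numeral_2_eq_2)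
    have 02: "K 0 j 2 j" using trans[OF 01 g(2) _ j 12] by simp
    show ?thesis using i r 01 12 02 sym[OF 01] sym[OF 12] sym[OF 02] unfolding lt3 by (elim disjE) simp_all
  qed
  obtain x y where xy: "\<And>i j. i < 3 \<Longrightarrow> j < 3 \<Longrightarrow> \<not> G i j \<Longrightarrow> i = x \<and> j = y"
  proof (cases "\<exists>x y. x < 3 \<and> y < 3 \<and> \<not> G x y")
    case True
    then show ?thesis using one that by metis
  next
    case False
    then show ?thesis using that by blast
  qed
  \<comment> \<open>The hub is the cell \<open>(r, s)\<close>: row r and column s both avoid the
    exceptional cell \<open>(x, y)\<close>.\<close>
  have "\<exists>r::nat. r < 3 \<and> r \<noteq> x" by (rule exI[of _ "if x = 0 then 1 else 0"]) simp
  then obtain r :: nat where r: "r < 3" "r \<noteq> x" by blast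
  have "\<exists>s::nat. s < 3 \<and> s \<noteq> y" by (rule exI[of _ "if y = 0 then 1 else 0"]) simp
  then obtain s :: nat where s: "s < 3" "s \<noteq> y" by blast
  have rf: "G r j" if "j < 3" for j using xy[of r j] r that by blast
  have sf: "G i s" if "i < 3" for i using xy[of i s] s that by blast
  have hub: "K i j r s" if "i < 3" "j < 3" "G i j" for i j
  proof (cases "i = x")
    case False
    then have "G i j" if "j < 3" for j using xy[of i j] that \<open>i < 3\<close> by blast
    then have "K i j i s" using that s by (intro row)
    moreover have "K i s r s" using sf s that r by (intro col)
    ultimately show ?thesis using trans sf that s by blast
  next
    case True
    have "G i' j" if "i' < 3" for i'
    proof (rule ccontr)
      assume "\<not> G i' j"
      then have "j = y" "i' = x" using xy[of i' j] \<open>j < 3\<close> \<open>i' < 3\<close> by blast+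
      then show False using \<open>\<not> G i' j\<close> True \<open>G i j\<close> by simp
    qed
    then have "K i j r j" using that r by (intro col)
    moreover have "K r j r s" using rf s that r by (intro row)
    ultimately show ?thesis using trans rf that r by blast
  qed
  show ?thesis using trans[OF hub[OF ij(1-3)] rf[OF s(1)] r(1) s(1) sym[OF hub[OF ij(4-6)]]] .
qed

text \<open>Connectivity inside a block and across a common side must be proved together. Inside a
  good block at most one of the nine sub-blocks is missing, and the others are linked through
  adjacent pairs. Two adjacent good blocks have three facing pairs of sub-blocks; each block spoils
  at most one pair, so one pair survives and joins them. Nonemptiness is carried along because
  connections are concatenated through a site of an intermediate core.\<close>

lemma core_connected:
  "(\<forall>p. \<not> bad C n p \<longrightarrow> core C n p \<noteq> {} \<and> (\<forall>u\<in>core C n p. \<forall>v\<in>core C n p. (u, v) \<in> site_conn C)) \<and>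
   (\<forall>a b. \<not> bad C n (a, b) \<longrightarrow>
     (\<not> bad C n (Suc a, b) \<longrightarrow> (\<forall>u\<in>core C n (a, b). \<forall>v\<in>core C n (Suc a, b). (u, v) \<in> site_conn C)) \<and>
     (\<not> bad C n (a, Suc b) \<longrightarrow> (\<forall>u\<in>core C n (a, b). \<forall>v\<in>core C n (a, Suc b). (u, v) \<in> site_conn C)))"
proof (induction n)
  case 0
  then show ?case by (auto simp: site_conn_def site_step_def intro: r_into_rtrancl)
next
  case (Suc n)
  \<comment> \<open>Turns connectivity of cores into a relation between sub-blocks, to which the
    connectivity of the 3 by 3 grid applies.\<close>
  define J where "J c c' \<longleftrightarrow> (\<forall>u\<in>core C n c. \<forall>v\<in>core C n c'. (u, v) \<in> site_conn C)" for c c'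
  have J_sym: "J c c' \<Longrightarrow> J c' c" for c c' unfolding J_def using site_conn_sym by blast
  have ne: "\<not> bad C n c \<Longrightarrow> core C n c \<noteq> {}" for c using Suc by blast
  have J_trans: "J c c' \<Longrightarrow> \<not> bad C n c' \<Longrightarrow> J c' c'' \<Longrightarrow> J c c''" for c c' c''
    unfolding J_def using ne[of c'] site_conn_trans by (metis all_not_in_conv)
  have J_refl: "\<not> bad C n c \<Longrightarrow> J c c" for c unfolding J_def using Suc by blast
  have J_right: "\<not> bad C n (a, b) \<Longrightarrow> \<not> bad C n (Suc a, b) \<Longrightarrow> J (a, b) (Suc a, b)" for a b unfolding J_def using Suc by blast
  have J_up: "\<not> bad C n (a, b) \<Longrightarrow> \<not> bad C n (a, Suc b) \<Longrightarrow> J (a, b) (a, Suc b)" for a b unfolding J_def using Suc by blast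
  have one: "i = i' \<and> j = j'" if "\<not> bad C (Suc n) (a, b)" "i < 3" "j < 3" "i' < 3" "j' < 3"
     "bad C n (3 * a + i, 3 * b + j)" "bad C n (3 * a + i', 3 * b + j')" for a b i j i' j'
  proof (rule ccontr)
    assume "\<not> ?thesis"
    then have "(3 * a + i, 3 * b + j) \<noteq> (3 * a + i', 3 * b + j')" by auto
    moreover have "(3 * a + i, 3 * b + j) \<in> subs (a, b)" "(3 * a + i', 3 * b + j') \<in> subs (a, b)"
      using that by (auto simp: subs_def)
    ultimately show False using that by (simp only: bad.simps) blast
  qed
  have grid: "J (3 * a + i, 3 * b + j) (3 * a + i', 3 * b + j')"
    if good: "\<not> bad C (Suc n) (a, b)" and ij: "i < 3" "j < 3" "\<not> bad C n (3 * a + i, 3 * b + j)"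
      "i' < 3" "j' < 3" "\<not> bad C n (3 * a + i', 3 * b + j')" for a b i j i' j'
  proof (rule grid_minus_cell_connected[where G="\<lambda>i j. \<not> bad C n (3 * a + i, 3 * b + j)"
        and K="\<lambda>i j i' j'. J (3 * a + i, 3 * b + j) (3 * a + i', 3 * b + j')", OF _ _ _ _ _ _ ij])
    show "J (3 * a + i, 3 * b + j) (3 * a + i'', 3 * b + j'')"
      if "J (3 * a + i, 3 * b + j) (3 * a + i', 3 * b + j')" "\<not> bad C n (3 * a + i', 3 * b + j')"
        "J (3 * a + i', 3 * b + j') (3 * a + i'', 3 * b + j'')" for i j i' j' i'' j''
      using J_trans that by blast
  qed (use one[OF good] J_refl J_sym J_right J_up in simp_all)
  have subsE: "\<exists>i j. c = (3 * fst p + i, 3 * snd p + j) \<and> i < 3 \<and> j < 3" if "c \<in> subs p" for c p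
    using that by (intro exI[of _ "fst c - 3 * fst p"] exI[of _ "snd c - 3 * snd p"]) (auto simp: subs_def)
  have J_subs: "J c c'" if h: "\<not> bad C (Suc n) p" "c \<in> subs p" "c' \<in> subs p" "\<not> bad C n c" "\<not> bad C n c'" for p c c'
  proof -
    obtain i j where c: "c = (3 * fst p + i, 3 * snd p + j)" "i < 3" "j < 3" using subsE[OF h(2)] by blast
    obtain i' j' where c': "c' = (3 * fst p + i', 3 * snd p + j')" "i' < 3" "j' < 3" using subsE[OF h(3)] by blast
    show ?thesis using grid[of "fst p" "snd p" i j i' j'] h c c' by simp
  qed
  \<comment> \<open>Three indices, of which each of the two predicates excludes at most one.\<close>
  have avoid: "\<exists>k<3. \<not> P k \<and> \<not> Q k" if "\<And>i i'. i < 3 \<Longrightarrow> i' < 3 \<Longrightarrow> P i \<Longrightarrow> P i' \<Longrightarrow> i = i'"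
    "\<And>i i'. i < 3 \<Longrightarrow> i' < 3 \<Longrightarrow> Q i \<Longrightarrow> Q i' \<Longrightarrow> i = i'" for P Q :: "nat \<Rightarrow> bool"
  proof (rule ccontr)
    assume "\<not> ?thesis"
    then have "P 0 \<or> Q 0" "P 1 \<or> Q 1" "P 2 \<or> Q 2" by auto
    then show False using that(1)[of 0 1] that(1)[of 1 2] that(1)[of 0 2] that(2)[of 0 1] that(2)[of 1 2] that(2)[of 0 2] by auto
  qed
  have subs_I: "(3 * a + i, 3 * b + j) \<in> subs (a, b)" if "i < 3" "j < 3" for a b i j using that by (auto simp: subs_def)
  have core_link: "(u, v) \<in> site_conn C"
    if p: "\<not> bad C (Suc n) p" and q: "\<not> bad C (Suc n) q" and c: "c \<in> subs p" "\<not> bad C n c" and c': "c' \<in> subs q" "\<not> bad C n c'"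
      and J: "J c c'" and uv: "u \<in> core C (Suc n) p" "v \<in> core C (Suc n) q" for p q c c' u v
  proof -
    obtain d where d: "d \<in> subs p" "\<not> bad C n d" "u \<in> core C n d" using uv(1) by auto
    obtain d' where d': "d' \<in> subs q" "\<not> bad C n d'" "v \<in> core C n d'" using uv(2) by auto
    have "J d c" using J_subs[OF p d(1) c(1) d(2) c(2)] .
    moreover have "J c' d'" using J_subs[OF q c'(1) d'(1) c'(2) d'(2)] .
    ultimately have "J d d'" using J_trans c(2) c'(2) J by blast
    then show ?thesis using d(3) d'(3) unfolding J_def by blast
  qed
  have Suc_block: "Suc (3 * a + 2) = 3 * Suc a + 0" for a :: nat by simp
  show ?case
  proof (intro conjI allI impI)
    fix p assume p: "\<not> bad C (Suc n) p"
    \<comment> \<open>Both predicates are taken equal here: all that is needed is one good sub-block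
      in a row of the block.\<close>
    have "\<exists>k<3. \<not> bad C n (3 * fst p + k, 3 * snd p + 0) \<and> \<not> bad C n (3 * fst p + k, 3 * snd p + 0)"
      using one[of "fst p" "snd p" _ 0 _ 0] p by (intro avoid) simp_all
    then obtain k where k: "k < 3" "\<not> bad C n (3 * fst p + k, 3 * snd p + 0)" by blast
    have kc: "(3 * fst p + k, 3 * snd p + 0) \<in> subs p" using subs_I[OF k(1), of 0 "fst p" "snd p"] by simp
    show "core C (Suc n) p \<noteq> {}" using ne[OF k(2)] k(2) kc by (simp only: core.simps) blast
    show "\<forall>u\<in>core C (Suc n) p. \<forall>v\<in>core C (Suc n) p. (u, v) \<in> site_conn C"
      using core_link[OF p p kc k(2) kc k(2) J_refl[OF k(2)]] by blast
  next
    fix a b assume p: "\<not> bad C (Suc n) (a, b)" and q: "\<not> bad C (Suc n) (Suc a, b)"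
    have "\<exists>k<3. \<not> bad C n (3 * a + 2, 3 * b + k) \<and> \<not> bad C n (3 * Suc a + 0, 3 * b + k)"
      using one[OF p, of 2 _ 2] one[OF q, of 0 _ 0] by (intro avoid) simp_all
    then obtain k where k: "k < 3" "\<not> bad C n (3 * a + 2, 3 * b + k)" "\<not> bad C n (3 * Suc a + 0, 3 * b + k)" by blast
    have "J (3 * a + 2, 3 * b + k) (3 * Suc a + 0, 3 * b + k)"
      using J_right[OF k(2)] k(3) unfolding Suc_block by blast
    then show "\<forall>u\<in>core C (Suc n) (a, b). \<forall>v\<in>core C (Suc n) (Suc a, b). (u, v) \<in> site_conn C"
      using core_link[OF p q subs_I k(2) subs_I k(3)] k(1) by simp
  next
    fix a b assume p: "\<not> bad C (Suc n) (a, b)" and q: "\<not> bad C (Suc n) (a, Suc b)"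
    have "\<exists>k<3. \<not> bad C n (3 * a + k, 3 * b + 2) \<and> \<not> bad C n (3 * a + k, 3 * Suc b + 0)"
      using one[OF p, of _ 2 _ 2] one[OF q, of _ 0 _ 0] by (intro avoid) simp_all
    then obtain k where k: "k < 3" "\<not> bad C n (3 * a + k, 3 * b + 2)" "\<not> bad C n (3 * a + k, 3 * Suc b + 0)" by blast
    have "J (3 * a + k, 3 * b + 2) (3 * a + k, 3 * Suc b + 0)"
      using J_up[OF k(2)] k(3) unfolding Suc_block by blast
    then show "\<forall>u\<in>core C (Suc n) (a, b). \<forall>v\<in>core C (Suc n) (a, Suc b). (u, v) \<in> site_conn C"
      using core_link[OF p q subs_I k(2) subs_I k(3)] k(1) by simp
  qed
qed

lemma core_open: "u \<in> core C n p \<Longrightarrow> \<not> bad C n p \<Longrightarrow> \<not> C u"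
  by (induction n arbitrary: p) auto

lemma core_fst_ge: "u \<in> core C n p \<Longrightarrow> 3 ^ n * fst p \<le> fst u"
proof (induction n arbitrary: p)
  case (Suc n)
  then obtain c where c: "c \<in> subs p" "u \<in> core C n c" by auto
  have "3 ^ Suc n * fst p = 3 ^ n * (3 * fst p)" by simp
  also have "\<dots> \<le> 3 ^ n * fst c" using c(1) by (intro mult_left_mono) (auto simp: subs_def)
  also have "\<dots> \<le> fst u" by (rule Suc.IH[OF c(2)])
  finally show ?case .
qed simp

text \<open>The origin belongs to the core of its block at every level, as all blocks containing it
  are good. In its block of level \<open>Suc N\<close> the sub-blocks \<open>(2, 0)\<close> and
  \<open>(2, 1)\<close> are not both bad, and the core of a good one supplies a site with first
  coordinate at least \<open>2 * 3 ^ N\<close> that is connected to the origin.\<close>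

lemma unbounded_site_cluster:
  assumes good: "\<And>n. \<not> bad C n (0, 0)"
  shows "\<not> C (0, 0)" and "\<exists>v. N \<le> fst v \<and> \<not> C v \<and> ((0, 0), v) \<in> site_conn C"
proof -
  show C0: "\<not> C (0, 0)" using good[of 0] by simp
  have 0: "(0, 0) \<in> core C n (0, 0)" for n
  proof (induction n)
    case (Suc n)
    have "(0, 0) \<in> subs (0, 0)" by (simp add: subs_def)
    then show ?case using Suc good[of n] by auto
  qed simp
  obtain j where j: "j < 3" "\<not> bad C N (2, j)"
  proof -
    have "\<not> (bad C N (2, 0) \<and> bad C N (2, 1))"
    proof
      assume "bad C N (2, 0) \<and> bad C N (2, 1)"
      moreover have "(2, 0) \<in> subs (0, 0)" "(2, 1) \<in> subs (0, 0)" "(2, 0) \<noteq> (2, 1 :: nat)" by (auto simp: subs_def)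
      ultimately have "bad C (Suc N) (0, 0)" unfolding bad.simps by blast
      then show False using good by blast
    qed
    then show ?thesis using that[of 0] that[of 1] by auto
  qed
  then obtain v where v: "v \<in> core C N (2, j)" using core_connected[of C N] by blast
  have "(2, j) \<in> subs (0, 0)" using j(1) by (simp add: subs_def)
  then have vc: "v \<in> core C (Suc N) (0, 0)" using v j(2) by auto
  have "N \<le> 3 ^ N * 2"
  proof -
    have "N < 3 ^ N" by (induction N) auto
    then show ?thesis by linarith
  qed
  also have "\<dots> \<le> fst v" using core_fst_ge[OF v] by simp
  finally have "N \<le> fst v" .
  moreover have "\<not> C v" using core_open[OF vc good] .
  moreover have "((0, 0), v) \<in> site_conn C" using core_connected[of C "Suc N"] good[of "Suc N"] 0[of "Suc N"] vc by blast
  ultimately show "\<exists>v. N \<le> fst v \<and> \<not> C v \<and> ((0, 0), v) \<in> site_conn C" by blast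
qed

text \<open>The sets of sites whose simultaneous failure certifies that a block is bad: unfolding
  the recursion of \<open>bad\<close> chooses two distinct sub-blocks at each stage, so the family
  is finite and suits a union bound.\<close>

fun witnesses :: "nat \<Rightarrow> nat \<times> nat \<Rightarrow> (nat \<times> nat) set set" where
  "witnesses 0 p = {{p}}"
| "witnesses (Suc n) p = (\<Union>(c, c')\<in>{(c, c') \<in> subs p \<times> subs p. c \<noteq> c'}. (\<lambda>(S, S'). S \<union> S') ` (witnesses n c \<times> witnesses n c'))"

lemma bad_witness: "bad C n p \<Longrightarrow> \<exists>S\<in>witnesses n p. \<forall>u\<in>S. C u"
proof (induction n arbitrary: p)
  case (Suc n)
  then obtain c c' where c: "c \<in> subs p" "c' \<in> subs p" "c \<noteq> c'" "bad C n c" "bad C n c'" by auto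
  obtain S S' where S: "S \<in> witnesses n c" "\<forall>u\<in>S. C u" "S' \<in> witnesses n c'" "\<forall>u\<in>S'. C u"
    using Suc.IH[OF c(4)] Suc.IH[OF c(5)] by blast
  have "S \<union> S' \<in> witnesses (Suc n) p"
    unfolding witnesses.simps using c(1-3) S(1,3) by (intro UN_I[of "(c, c')"]) (auto intro!: image_eqI[of _ _ "(S, S')"])
  then show ?case using S(2,4) by blast
qed simp

text \<open>The block of level n that contains a site is given by the quotients of its coordinates
  by \<open>3 ^ n\<close>. Witnesses of distinct sub-blocks are therefore disjoint, which gives the
  full cardinality \<open>2 ^ n\<close>.\<close>

lemma witness_block:
  "S \<in> witnesses n p \<Longrightarrow> finite S \<and> card S = 2 ^ n \<and> (\<forall>u\<in>S. fst u div 3 ^ n = fst p \<and> snd u div 3 ^ n = snd p)"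
proof (induction n arbitrary: p S)
  case (Suc n)
  then obtain c c' S1 S2 where c: "c \<in> subs p" "c' \<in> subs p" "c \<noteq> c'" "S1 \<in> witnesses n c" "S2 \<in> witnesses n c'" "S = S1 \<union> S2"
    by auto
  note 1 = Suc.IH[OF c(4)] and 2 = Suc.IH[OF c(5)]
  have "S1 \<inter> S2 = {}"
  proof (rule ccontr)
    assume "S1 \<inter> S2 \<noteq> {}"
    then obtain u where "u \<in> S1" "u \<in> S2" by blast
    then have "fst c = fst c' \<and> snd c = snd c'" using 1 2 by metis
    then show False using c(3) prod_eqI by blast
  qed
  then have "card S = 2 ^ Suc n" using 1 2 by (simp add: c(6) card_Un_disjoint)
  moreover have "fst u div 3 ^ Suc n = fst p \<and> snd u div 3 ^ Suc n = snd p" if u: "u \<in> S" for u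
  proof -
    obtain d where d: "d \<in> subs p" "fst u div 3 ^ n = fst d" "snd u div 3 ^ n = snd d"
      using u 1 2 c by blast
    have "fst d div 3 = fst p" "snd d div 3 = snd p" using d(1) by (auto simp: subs_def)
    moreover have "fst u div 3 ^ Suc n = fst u div 3 ^ n div 3" "snd u div 3 ^ Suc n = snd u div 3 ^ n div 3"
      by (simp_all only: power_Suc2 div_mult2_eq)
    ultimately show ?thesis using d(2,3) by simp
  qed
  ultimately show ?case using 1 2 by (simp add: c(6))
qed simp

text \<open>There are at most 9 * 9 = 81 ordered pairs of sub-blocks, so a bound w for level n
  yields 81 * w * w for level n + 1. Carrying the factor 81 turns this recursion into plain
  squaring.\<close>

lemma card_witnesses: "finite (witnesses n p) \<and> 81 * card (witnesses n p) \<le> 81 ^ (2 ^ n)"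
proof (induction n arbitrary: p)
  case (Suc n)
  let ?I = "{(c, c') \<in> subs p \<times> subs p. c \<noteq> c'}"
  have cs: "card (subs p) = 9" "finite (subs p)" by (auto simp: subs_def)
  have fI: "finite ?I" by (rule finite_subset[of _ "subs p \<times> subs p"]) (use cs in auto)
  have "card ?I \<le> card (subs p \<times> subs p)" using cs by (intro card_mono) auto
  then have cI: "card ?I \<le> 81" using cs by (simp add: card_cartesian_product)
  \<comment> \<open>Integer division extracts from the induction hypothesis a bound on the
    cardinality that is common to all sub-blocks.\<close>
  define w :: nat where "w = 81 ^ (2 ^ n) div 81"
  have w81: "81 * w \<le> 81 ^ (2 ^ n)" by (simp add: w_def)
  have w: "card (witnesses n c) \<le> w" for c unfolding w_def using Suc[of c] by (simp add: less_eq_div_iff_mult_less_eq mult.commute)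
  have "card (witnesses (Suc n) p) \<le> (\<Sum>x\<in>?I. card (case x of (c, c') \<Rightarrow> (\<lambda>(S, S'). S \<union> S') ` (witnesses n c \<times> witnesses n c')))"
    unfolding witnesses.simps by (rule card_UN_le[OF fI])
  also have "\<dots> \<le> (\<Sum>x\<in>?I. w * w)"
  proof (rule sum_mono)
    fix x :: "(nat \<times> nat) \<times> (nat \<times> nat)"
    obtain c c' where x: "x = (c, c')" by (cases x)
    have "card ((\<lambda>(S, S'). S \<union> S') ` (witnesses n c \<times> witnesses n c')) \<le> card (witnesses n c \<times> witnesses n c')"
      using Suc by (intro card_image_le) auto
    also have "\<dots> \<le> w * w" unfolding card_cartesian_product using w by (intro mult_mono) auto
    finally show "card (case x of (c, c') \<Rightarrow> (\<lambda>(S, S'). S \<union> S') ` (witnesses n c \<times> witnesses n c')) \<le> w * w"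
      by (simp add: x)
  qed
  also have "\<dots> = card ?I * (w * w)" by simp
  also have "\<dots> \<le> 81 * (w * w)" using cI by (intro mult_right_mono) auto
  finally have "81 * card (witnesses (Suc n) p) \<le> (81 * w) * (81 * w)" by simp
  also have "\<dots> \<le> 81 ^ (2 ^ n) * 81 ^ (2 ^ n)" using w81 by (intro mult_mono) auto
  also have "\<dots> = 81 ^ (2 ^ Suc n)" by (simp add: power_add[symmetric] mult_2)
  finally have "81 * card (witnesses (Suc n) p) \<le> 81 ^ (2 ^ Suc n)" .
  moreover have "finite (witnesses (Suc n) p)"
    unfolding witnesses.simps using fI Suc by (intro finite_UN_I) auto
  ultimately show ?case by blast
qed simp

section \<open>Percolation at large intensity\<close>

text \<open>The planar lattice is laid out in the directions \<open>a\<close> and \<open>b\<close>;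
  in all other directions the boxes span the same interval starting at 0.\<close>

definition site_corner :: "'n::finite \<Rightarrow> 'n \<Rightarrow> nat \<times> nat \<Rightarrow> real^'n" where
  "site_corner a b u = (\<chi> i. (if i = a then real (fst u) else if i = b then real (snd u) else 0) / (4 * real CARD('n)))"

text \<open>The side \<open>1 / (4 d)\<close> makes points of adjacent boxes closer than \<open>1/2\<close>, and marks of size at
  most \<open>1/8\<close> contribute at most another \<open>1/2\<close>.\<close>

definition site_box :: "'n::finite \<Rightarrow> 'n \<Rightarrow> nat \<times> nat \<Rightarrow> ((real^'n) \<times> real) set" where
  "site_box a b u = box (site_corner a b u) (site_corner a b u + (\<chi> i. 1 / (4 * real CARD('n)))) \<times> cball 0 (1/8)"

lemma site_box_sets: "site_box a b u \<in> sets borel"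
  unfolding site_box_def by (intro borel_Times) auto

lemma bounded_site_box: "bounded (site_box a b u)"
  unfolding site_box_def by (intro bounded_Times bounded_box bounded_cball)

lemma mem_site_box:
  fixes p :: "(real^'n) \<times> real"
  assumes "p \<in> site_box a b u"
  shows "site_corner a b u $ i < fst p $ i" "fst p $ i < site_corner a b u $ i + 1 / (4 * real CARD('n))"
    and "\<bar>snd p\<bar> \<le> 1/8"
  using assms by (auto simp: site_box_def mem_box_cart)

lemma disjoint_site_boxes:
  assumes "a \<noteq> b" "u \<noteq> v"
  shows "site_box a b u \<inter> site_box a b v = {}"
proof (rule ccontr)
  assume "site_box a b u \<inter> site_box a b v \<noteq> {}"
  then obtain p where p: "p \<in> site_box a b u" "p \<in> site_box a b v" by blast
  have eq: "m = n" if "real m / (4 * real CARD('a)) < x" "x < real m / (4 * real CARD('a)) + 1 / (4 * real CARD('a))"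
     "real n / (4 * real CARD('a)) < x" "x < real n / (4 * real CARD('a)) + 1 / (4 * real CARD('a))" for m n :: nat and x :: real
  proof -
    have d: "4 * real CARD('a) > 0" by simp
    have "real m < x * (4 * real CARD('a))" "x * (4 * real CARD('a)) < real m + 1"
      "real n < x * (4 * real CARD('a))" "x * (4 * real CARD('a)) < real n + 1"
      using that d by (simp_all only: add_divide_distrib[symmetric] pos_divide_less_eq pos_less_divide_eq)
    then show ?thesis by linarith
  qed
  have "fst u = fst v"
    using eq mem_site_box(1,2)[OF p(1), of a] mem_site_box(1,2)[OF p(2), of a] by (simp add: site_corner_def)
  moreover have "snd u = snd v"
    using eq mem_site_box(1,2)[OF p(1), of b] mem_site_box(1,2)[OF p(2), of b] assms(1) by (simp add: site_corner_def)
  ultimately show False using assms(2) by (simp add: prod_eq_iff)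
qed

lemma measure_site_box:
  fixes a b :: "'n::finite"
  assumes "prob_space \<nu>" "sets \<nu> = sets borel"
  shows "measure (lborel \<Otimes>\<^sub>M \<nu>) (site_box a b u) = (1 / (4 * real CARD('n))) ^ CARD('n) * measure \<nu> (cball 0 (1/8))"
proof -
  interpret \<nu>: prob_space \<nu> by fact
  let ?s = "1 / (4 * real CARD('n))"
  let ?B = "box (site_corner a b u) (site_corner a b u + (\<chi> i. ?s))"
  have in_s: "(\<chi> i. ?s) \<bullet> x = ?s" if "x \<in> Basis" for x :: "real^'n"
    using that by (auto simp: Basis_vec_def inner_axis)
  have "emeasure lborel ?B = (\<Prod>x\<in>(Basis :: (real^'n) set). (site_corner a b u + (\<chi> i. ?s) - site_corner a b u) \<bullet> x)"
    by (rule emeasure_lborel_box) (simp add: inner_add_left in_s)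
  also have "\<dots> = ennreal (?s ^ CARD('n))" by (simp add: in_s)
  finally have B: "emeasure lborel ?B = ennreal (?s ^ CARD('n))" .
  have "emeasure (lborel \<Otimes>\<^sub>M \<nu>) (site_box a b u) = emeasure lborel ?B * emeasure \<nu> (cball 0 (1/8))"
    unfolding site_box_def using assms by (intro \<nu>.emeasure_pair_measure_Times) auto
  then show ?thesis unfolding B by (simp add: measure_def enn2real_mult)
qed

lemma near_site_boxes:
  fixes a b :: "'n::finite"
  assumes p: "p \<in> site_box a b u" and q: "q \<in> site_box a b v"
    and uv: "\<bar>real (fst u) - real (fst v)\<bar> \<le> 1" "\<bar>real (snd u) - real (snd v)\<bar> \<le> 1"
  shows "near 1 1 p q"
proof -
  let ?s = "1 / (4 * real CARD('n))"
  have "\<bar>site_corner a b u $ i - site_corner a b v $ i\<bar> \<le> ?s" for i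
    using uv by (auto simp: site_corner_def diff_divide_distrib[symmetric] divide_right_mono)
  have "\<bar>(fst p - fst q) $ i\<bar> \<le> 2 * ?s" for i
  proof -
    have *: "\<bar>x - y\<bar> \<le> 2 * s" if "c < x" "x < c + s" "c' < y" "y < c' + s" "\<bar>c - c'\<bar> \<le> s" for c c' x y s :: real
      using that by linarith
    show ?thesis
      unfolding vector_minus_component
      by (rule *[OF mem_site_box(1,2)[OF p, of i] mem_site_box(1,2)[OF q, of i]]) fact
  qed
  then have "norm (fst p - fst q) \<le> (\<Sum>i\<in>(UNIV :: 'n set). 2 * ?s)"
    by (intro order_trans[OF norm_le_l1_cart] sum_mono)
  also have "\<dots> = 1/2" by simp
  \<comment> \<open>The three mark terms are at most 1/8, 1/8 and 1/4.\<close>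
  finally show ?thesis using mem_site_box(3)[OF p] mem_site_box(3)[OF q] unfolding near_def by (simp add: abs_le_iff)
qed

lemma percolates_if_never_bad:
  fixes \<omega> :: "((real^'n) \<times> real) set" and a b :: 'n
  assumes \<omega>: "\<omega> \<in> configs" and good: "\<And>n. \<not> bad (\<lambda>u. \<omega> \<inter> site_box a b u = {}) n (0, 0)"
  shows "percolates 1 1 \<omega>"
proof -
  let ?C = "\<lambda>u. \<omega> \<inter> site_box a b u = {}"
  \<comment> \<open>One representative per occupied box suffices, since any two points in adjacent
    boxes are linked.\<close>
  define r where "r u = (SOME p. p \<in> \<omega> \<inter> site_box a b u)" for u
  have r: "r u \<in> \<omega> \<inter> site_box a b u" if "\<not> ?C u" for u
    unfolding r_def some_in_eq using that .
  have conn: "r v \<in> cluster 1 1 \<omega> (r u)" if "(u, v) \<in> site_conn ?C" for u v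
    using that unfolding site_conn_def
  proof (induction rule: rtrancl_induct)
    case (step v w)
    have o: "\<not> ?C v" "\<not> ?C w" using step(2) by (auto simp: site_step_def)
    have "near 1 1 (r v) (r w)"
      using step(2) r[OF o(1)] r[OF o(2)] by (intro near_site_boxes[of _ a b v _ w]) (auto simp: site_step_def)
    then have "(r v, r w) \<in> links 1 1 \<omega>" using r[OF o(1)] r[OF o(2)] by (simp add: links_def)
    then show ?case using step(3) by (auto simp: cluster_def)
  qed (simp add: cluster_def)
  note U = unbounded_site_cluster[of ?C, OF good]
  have "\<not> bounded (fst ` cluster 1 1 \<omega> (r (0, 0)))"
  proof
    assume "bounded (fst ` cluster 1 1 \<omega> (r (0, 0)))"
    then obtain m where m: "\<And>q. q \<in> cluster 1 1 \<omega> (r (0, 0)) \<Longrightarrow> norm (fst q) \<le> m" unfolding bounded_iff by blast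
    obtain N :: nat where N: "m * (4 * real CARD('n)) < real N" using reals_Archimedean2 by blast
    obtain v where v: "N \<le> fst v" "\<not> ?C v" "((0, 0), v) \<in> site_conn ?C" using U(2)[of N] by blast
    have "real N / (4 * real CARD('n)) \<le> real (fst v) / (4 * real CARD('n))" using v(1) by (intro divide_right_mono) auto
    also have "\<dots> = site_corner a b v $ a" by (simp add: site_corner_def)
    also have "\<dots> < fst (r v) $ a" using mem_site_box(1) r[OF v(2)] by blast
    also have "\<dots> \<le> norm (fst (r v))" using component_le_norm_cart[of "fst (r v)" a] by linarith
    also have "\<dots> \<le> m" using m conn[OF v(3)] by blast
    finally have "real N \<le> m * (4 * real CARD('n))" by (simp add: pos_divide_less_eq)
    then show False using N by linarith
  qed
  then show ?thesis using r[OF U(1)] percolates_iff_cluster[OF \<omega>] by blast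
qed

text \<open>A box is empty with probability q, so badness at level n has probability at most
  \<open>81 ^ (2 ^ n) * q ^ (2 ^ n) / 81\<close> by counting witnesses. The assumption
  \<open>81 * q \<le> 1/4\<close> makes the sum over n at most 4/243, so with positive probability
  no block at the origin is ever bad, and the zero-one law does the rest. Dimension at least 2
  enters through the two distinct directions of the planar lattice.\<close>

theorem percolation_large_intensity:
  fixes P :: "((real^'n) \<times> real) set measure"
  assumes d: "CARD('n) \<ge> 2" and P: "has_poisson_voids \<rho> \<nu> P" and \<nu>: "prob_space \<nu>" "sets \<nu> = sets borel"
    and \<rho>: "81 * exp (- \<rho> * ((1 / (4 * real CARD('n))) ^ CARD('n) * measure \<nu> (cball 0 (1/8)))) \<le> 1/4"
  shows "measure P {\<omega>\<in>configs. percolates 1 1 \<omega>} = 1"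
proof -
  interpret P: prob_space P by (rule has_poisson_voids_prob_space[OF P])
  have sP: "sets P = sets config_space" using P by (simp add: has_poisson_voids_def)
  have spP: "space P = configs" by (rule space_has_poisson_voids[OF P])
  obtain a b :: 'n where ab: "a \<noteq> b"
  proof -
    have "\<not> CARD('n) \<le> Suc 0" using d by simp
    then show ?thesis using that card_le_Suc0_iff_eq[of "UNIV :: 'n set"] by auto
  qed
  let ?v = "(1 / (4 * real CARD('n))) ^ CARD('n) * measure \<nu> (cball 0 (1/8))"
  define q where "q = exp (- \<rho> * ?v)"
  have q: "0 < q" "81 * q \<le> 1/4" using \<rho> by (auto simp: q_def)
  let ?V = "\<lambda>S. void (\<Union>u\<in>S. site_box a b u)"
  have V: "measure P (?V S) = q ^ card S" if S: "finite S" for S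
  proof -
    have "measure (lborel \<Otimes>\<^sub>M \<nu>) (\<Union>u\<in>S. site_box a b u) = (\<Sum>u\<in>S. measure (lborel \<Otimes>\<^sub>M \<nu>) (site_box a b u))"
    proof (rule measure_finite_Union[OF S])
      show "disjoint_family_on (site_box a b) S" using disjoint_site_boxes[OF ab] by (auto simp: disjoint_family_on_def)
      show "site_box a b ` S \<subseteq> sets (lborel \<Otimes>\<^sub>M \<nu>)" unfolding sets_lborel_pair[OF \<nu>(2)] using site_box_sets by blast
      show "emeasure (lborel \<Otimes>\<^sub>M \<nu>) (site_box a b u) \<noteq> \<infinity>" for u by (rule emeasure_bounded_pair[OF \<nu> bounded_site_box])
    qed
    also have "\<dots> = real (card S) * ?v" unfolding measure_site_box[OF \<nu>] by simp
    finally have m: "measure (lborel \<Otimes>\<^sub>M \<nu>) (\<Union>u\<in>S. site_box a b u) = real (card S) * ?v" .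
    have "emeasure P (?V S) = ennreal (exp (- \<rho> * measure (lborel \<Otimes>\<^sub>M \<nu>) (\<Union>u\<in>S. site_box a b u)))"
      using S by (intro emeasure_void[OF P] sets.finite_UN bounded_UN ballI site_box_sets bounded_site_box)
    then have "measure P (?V S) = exp (real (card S) * (- \<rho> * ?v))"
      unfolding m by (simp add: measure_def mult_ac)
    also have "\<dots> = q ^ card S" unfolding q_def by (rule exp_of_nat_mult)
    finally show ?thesis .
  qed
  define W where "W n = (\<Union>S\<in>witnesses n (0, 0). ?V S)" for n
  have finS: "finite S" if "S \<in> witnesses n (0, 0)" for S n using witness_block[OF that] by blast
  have VP: "?V S \<in> sets P" if "finite S" for S
    unfolding sP using that by (intro void_measurable sets.finite_UN site_box_sets)
  have Wm: "W n \<in> sets P" for n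
    unfolding W_def using card_witnesses[of n "(0, 0)"] finS by (intro sets.finite_UN VP) auto
  have Wle: "measure P (W n) \<le> (1/4) ^ n / 81" for n
  proof -
    have fw: "finite (witnesses n (0, 0))" using card_witnesses by blast
    have cw: "81 * real (card (witnesses n (0, 0))) \<le> 81 ^ (2 ^ n)"
      using card_witnesses[of n "(0, 0)"] by (metis of_nat_le_iff of_nat_mult of_nat_numeral of_nat_power)
    have "measure P (W n) \<le> (\<Sum>S\<in>witnesses n (0, 0). measure P (?V S))"
      unfolding W_def using VP finS by (intro P.finite_measure_subadditive_finite fw) auto
    also have "\<dots> = (\<Sum>S\<in>witnesses n (0, 0). q ^ (2 ^ n))"
      using V finS witness_block by (intro sum.cong refl) simp
    also have "\<dots> = (81 * real (card (witnesses n (0, 0)))) * q ^ (2 ^ n) / 81" by simp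
    also have "\<dots> \<le> 81 ^ (2 ^ n) * q ^ (2 ^ n) / 81"
      using cw q by (intro divide_right_mono mult_right_mono) auto
    also have "\<dots> = (81 * q) ^ (2 ^ n) / 81" by (simp add: power_mult_distrib)
    also have "\<dots> \<le> (1/4) ^ (2 ^ n) / 81" using q by (intro divide_right_mono power_mono) auto
    also have "\<dots> \<le> (1/4) ^ n / 81"
    proof (intro divide_right_mono power_decreasing)
      have "n < 2 ^ n" by (rule less_exp)
      then show "n \<le> 2 ^ n" by simp
    qed auto
    finally show ?thesis .
  qed
  have sg: "(\<lambda>n. (1/4 :: real) ^ n / 81) sums ((1 / (1 - 1/4)) / 81)"
    by (intro sums_divide geometric_sums) simp
  have sW: "summable (\<lambda>n. measure P (W n))"
    using Wle by (intro summable_comparison_test'[OF sums_summable[OF sg], of 0]) simp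
  have "measure P (\<Union>n. W n) \<le> (\<Sum>n. measure P (W n))"
    using Wm sW by (intro P.finite_measure_subadditive_countably) auto
  also have "\<dots> \<le> (\<Sum>n. (1/4) ^ n / 81)" by (intro suminf_le Wle sW sums_summable[OF sg])
  also have "\<dots> = (1 / (1 - 1/4)) / 81" using sg by (rule sums_unique[symmetric])
  finally have W1: "measure P (\<Union>n. W n) < 1" by simp
  let ?E = "{\<omega>\<in>configs. percolates 1 1 \<omega>} :: ((real^'n) \<times> real) set set"
  have E: "?E \<in> sets P" using percolates_measurable[of 1 1] by (simp add: sP)
  have "space P - (\<Union>n. W n) \<subseteq> ?E"
  proof
    fix \<omega> assume "\<omega> \<in> space P - (\<Union>n. W n)"
    then have \<omega>: "\<omega> \<in> configs" and nW: "\<And>n. \<omega> \<notin> W n" by (auto simp: spP)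
    have "\<not> bad (\<lambda>u. \<omega> \<inter> site_box a b u = {}) n (0, 0)" for n
    proof
      assume "bad (\<lambda>u. \<omega> \<inter> site_box a b u = {}) n (0, 0)"
      from bad_witness[OF this] obtain S where "S \<in> witnesses n (0, 0)" "\<forall>u\<in>S. \<omega> \<inter> site_box a b u = {}" by blast
      then have "\<omega> \<in> W n" using \<omega> unfolding W_def void_def by blast
      then show False using nW by blast
    qed
    then show "\<omega> \<in> ?E" using percolates_if_never_bad[OF \<omega>] \<omega> by blast
  qed
  then have "measure P (space P - (\<Union>n. W n)) \<le> measure P ?E" using E by (intro P.finite_measure_mono)
  moreover have "measure P (space P - (\<Union>n. W n)) = 1 - measure P (\<Union>n. W n)" using Wm by (intro P.prob_compl) auto
  ultimately have "measure P ?E > 0" using W1 by linarith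
  moreover have "measure P ?E = 0 \<or> measure P ?E = 1" by (rule percolates_zero_one[OF P \<nu>]) simp
  ultimately show ?thesis by linarith
qed

section \<open>Self-similar mark laws and the critical thresholds\<close>

text \<open>Cutting \<nu> to the interval from -t to t and stretching it to [-1,1] gives the law
  \<mu> up to a factor. This common form of the one-sided and the symmetric class lets the main
  argument be carried out once.\<close>

definition self_similar_near_0 :: "real \<Rightarrow> real \<Rightarrow> real measure \<Rightarrow> real \<Rightarrow> real measure \<Rightarrow> bool" where
  "self_similar_near_0 \<alpha> C \<mu> t\<^sub>0 \<nu> \<longleftrightarrow> (\<forall>t S. 0 < t \<longrightarrow> t \<le> t\<^sub>0 \<longrightarrow> S \<in> sets borel \<longrightarrow>
     emeasure \<nu> {e. \<bar>e\<bar> \<le> t \<and> e / t \<in> S} = ennreal ((t / C) powr (\<alpha> + 1)) * emeasure \<mu> S)"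

lemma emeasure_density_rescale:
  fixes f g :: "real \<Rightarrow> real"
  assumes [measurable]: "f \<in> borel_measurable borel" "g \<in> borel_measurable borel"
    and t: "t > 0" and c: "c \<ge> 0" and S[measurable]: "S \<in> sets borel"
    and fg: "\<And>y. \<bar>y\<bar> \<le> 1 \<Longrightarrow> f (t * y) = c * g y" and g0: "\<And>y. \<bar>y\<bar> > 1 \<Longrightarrow> g y = 0"
  shows "emeasure (density lborel (\<lambda>x. ennreal (f x))) {e. \<bar>e\<bar> \<le> t \<and> e / t \<in> S}
    = ennreal (t * c) * emeasure (density lborel (\<lambda>x. ennreal (g x))) S"
proof -
  let ?A = "{e. \<bar>e\<bar> \<le> t \<and> e / t \<in> S}"
  have [measurable]: "?A \<in> sets borel"
  proof -
    have "?A = {e \<in> space borel. \<bar>e\<bar> \<le> t \<and> e / t \<in> S}" by simp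
    also have "\<dots> \<in> sets borel" by measurable
    finally show ?thesis .
  qed
  have "emeasure (density lborel (\<lambda>x. ennreal (f x))) ?A = (\<integral>\<^sup>+ e. ennreal (f e) * indicator ?A e \<partial>lborel)"
    by (rule emeasure_density) auto
  also have "\<dots> = (\<integral>\<^sup>+ e. ennreal c * (ennreal (g (e /\<^sub>R t)) * indicator S (e /\<^sub>R t)) \<partial>lborel)"
  proof (rule nn_integral_cong)
    fix e
    have d: "e /\<^sub>R t = e / t" by (simp add: divide_inverse_commute)
    have ab: "\<bar>e\<bar> \<le> t \<longleftrightarrow> \<bar>e / t\<bar> \<le> 1" unfolding abs_divide using t by simp
    show "ennreal (f e) * indicator ?A e = ennreal c * (ennreal (g (e /\<^sub>R t)) * indicator S (e /\<^sub>R t))"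
    proof (cases "\<bar>e\<bar> \<le> t")
      case True
      have "t * (e / t) = e" using t by simp
      then have "f e = c * g (e / t)" using fg[OF iffD1[OF ab True]] by (simp only:)
      then show ?thesis unfolding d using True c by (simp add: ennreal_mult' indicator_def)
    next
      case False
      then have "\<bar>e / t\<bar> > 1" using ab by linarith
      then have "g (e / t) = 0" by (rule g0)
      then show ?thesis unfolding d using False by simp
    qed
  qed
  also have "\<dots> = ennreal (t ^ DIM(real)) * (\<integral>\<^sup>+ y. ennreal c * (ennreal (g y) * indicator S y) \<partial>lborel)"
    by (rule nn_integral_lborel_scaleR[OF t, where f="\<lambda>y. ennreal c * (ennreal (g y) * indicator S y)"]) measurable
  also have "\<dots> = ennreal (t * c) * emeasure (density lborel (\<lambda>x. ennreal (g x))) S"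
    using t c by (simp add: nn_integral_cmult emeasure_density ennreal_mult' mult.assoc)
  finally show ?thesis .
qed

text \<open>The density is homogeneous of degree \<alpha>, and \<open>t \<le> C\<close> keeps its
  cut-off at C from interfering inside the window. The exponent \<open>\<alpha> + 1\<close> is the
  degree plus the Jacobian of the dilation.\<close>

lemma nu_plus_rescale:
  assumes "0 < t" "t \<le> C" "S \<in> sets borel"
  shows "emeasure (nu_plus C \<alpha>) {e. \<bar>e\<bar> \<le> t \<and> e / t \<in> S} = ennreal ((t / C) powr (\<alpha> + 1)) * emeasure (nu_plus 1 \<alpha>) S"
proof -
  have "(t / C) powr (\<alpha> + 1) = t * (t powr \<alpha> / C powr (\<alpha> + 1))"
    using assms by (simp add: powr_divide powr_add)
  moreover have "emeasure (nu_plus C \<alpha>) {e. \<bar>e\<bar> \<le> t \<and> e / t \<in> S} = ennreal (t * (t powr \<alpha> / C powr (\<alpha> + 1))) * emeasure (nu_plus 1 \<alpha>) S"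
    unfolding nu_plus_def
  proof (rule emeasure_density_rescale)
    fix y :: real assume y: "\<bar>y\<bar> \<le> 1"
    have "t * y \<le> t * 1" using y assms by (intro mult_left_mono) auto
    then have le: "t * y \<le> C" using assms(2) by linarith
    have "t * y \<in> {0..C} \<longleftrightarrow> y \<in> {0..1}" using y le assms(1) by (auto simp: zero_le_mult_iff)
    then show "(\<alpha> + 1) / C powr (\<alpha> + 1) * (t * y) powr \<alpha> * indicator {0..C} (t * y)
      = t powr \<alpha> / C powr (\<alpha> + 1) * ((\<alpha> + 1) / 1 powr (\<alpha> + 1) * y powr \<alpha> * indicator {0..1} y)"
      using assms by (cases "y \<in> {0..1}") (auto simp: powr_mult)
  qed (use assms in \<open>auto split: split_indicator_asm\<close>)
  ultimately show ?thesis by simp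
qed

lemma nu_sym_rescale:
  assumes "0 < t" "t \<le> C" "S \<in> sets borel"
  shows "emeasure (nu_sym C \<alpha>) {e. \<bar>e\<bar> \<le> t \<and> e / t \<in> S} = ennreal ((t / C) powr (\<alpha> + 1)) * emeasure (nu_sym 1 \<alpha>) S"
proof -
  have "(t / C) powr (\<alpha> + 1) = t * (t powr \<alpha> / C powr (\<alpha> + 1))"
    using assms by (simp add: powr_divide powr_add)
  moreover have "emeasure (nu_sym C \<alpha>) {e. \<bar>e\<bar> \<le> t \<and> e / t \<in> S} = ennreal (t * (t powr \<alpha> / C powr (\<alpha> + 1))) * emeasure (nu_sym 1 \<alpha>) S"
    unfolding nu_sym_def
  proof (rule emeasure_density_rescale)
    fix y :: real assume y: "\<bar>y\<bar> \<le> 1"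
    have "\<bar>t * y\<bar> \<le> t * 1" unfolding abs_mult using y assms by (intro mult_mono) auto
    then have "\<bar>t * y\<bar> \<le> C" using assms(2) by linarith
    then have "t * y \<in> {-C..C}" "y \<in> {-1..1}"
      using y unfolding atLeastAtMost_iff abs_le_iff by linarith+
    then show "(\<alpha> + 1) / (2 * C powr (\<alpha> + 1)) * \<bar>t * y\<bar> powr \<alpha> * indicator {-C..C} (t * y)
      = t powr \<alpha> / C powr (\<alpha> + 1) * ((\<alpha> + 1) / (2 * 1 powr (\<alpha> + 1)) * \<bar>y\<bar> powr \<alpha> * indicator {-1..1} y)"
      using assms by (simp add: powr_mult abs_mult mult_ac)
  qed (use assms in \<open>auto split: split_indicator_asm\<close>)
  ultimately show ?thesis by simp
qed

lemma prob_space_density_has_integral: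
  fixes f :: "real \<Rightarrow> real"
  assumes "f \<in> borel_measurable borel" "\<And>x. 0 \<le> f x" "(f has_integral 1) UNIV"
  shows "prob_space (density lborel (\<lambda>x. ennreal (f x)))"
proof
  have "(\<integral>\<^sup>+ x. ennreal (f x) \<partial>lborel) = 1"
    using nn_integral_has_integral_lborel[OF assms] by simp
  then show "emeasure (density lborel (\<lambda>x. ennreal (f x))) (space (density lborel (\<lambda>x. ennreal (f x)))) = 1"
    using assms(1) by (subst emeasure_density) auto
qed

lemma prob_space_nu_plus:
  assumes "\<alpha> \<ge> 0"
  shows "prob_space (nu_plus 1 \<alpha>)"
  unfolding nu_plus_def
proof (rule prob_space_density_has_integral)
  have "((\<lambda>x. (\<alpha> + 1) * x powr \<alpha>) has_integral ((\<alpha> + 1) * (1 powr (\<alpha> + 1) / (\<alpha> + 1)))) {0..1::real}"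
    using assms by (intro has_integral_mult_right has_integral_powr_from_0) auto
  then have "((\<lambda>x. (\<alpha> + 1) * x powr \<alpha>) has_integral 1) {0..1::real}" using assms by simp
  then have "((\<lambda>x. if x \<in> {0..1::real} then (\<alpha> + 1) * x powr \<alpha> else 0) has_integral 1) UNIV"
    by (subst has_integral_restrict_UNIV)
  then show "((\<lambda>x. (\<alpha> + 1) / 1 powr (\<alpha> + 1) * x powr \<alpha> * indicator {0..1} x) has_integral 1) UNIV"
    by (rule has_integral_eq[rotated]) auto
qed (use assms in auto)

lemma prob_space_nu_sym:
  assumes "\<alpha> \<ge> 0"
  shows "prob_space (nu_sym 1 \<alpha>)"
  unfolding nu_sym_def
proof (rule prob_space_density_has_integral)
  let ?h = "\<lambda>x::real. (\<alpha> + 1) / 2 * \<bar>x\<bar> powr \<alpha>"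
  have hi: "((\<lambda>x. (\<alpha> + 1) / 2 * x powr \<alpha>) has_integral ((\<alpha> + 1) / 2 * (1 powr (\<alpha> + 1) / (\<alpha> + 1)))) {0..1::real}"
    using assms by (intro has_integral_mult_right has_integral_powr_from_0) auto
  then have "((\<lambda>x. (\<alpha> + 1) / 2 * x powr \<alpha>) has_integral 1/2) {0..1::real}"
  proof -
    have "(\<alpha> + 1) / 2 * (1 powr (\<alpha> + 1) / (\<alpha> + 1)) = 1/2" using assms by (simp add: divide_simps)
    then show ?thesis using hi by (simp only:)
  qed
  then have r: "(?h has_integral 1/2) {0..1}" by (rule has_integral_eq[rotated]) auto
  then have "((\<lambda>x. ?h (- x)) has_integral 1/2) {-1..-0}" by (subst has_integral_reflect_real)
  then have l: "(?h has_integral 1/2) {-1..0}" by simp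
  have "(?h has_integral (1/2 + 1/2)) {-1..1}" by (rule has_integral_combine[OF _ _ l r]) auto
  then have "((\<lambda>x. if x \<in> {-1..1} then ?h x else 0) has_integral 1) UNIV"
    by (subst has_integral_restrict_UNIV) simp
  then show "((\<lambda>x. (\<alpha> + 1) / (2 * 1 powr (\<alpha> + 1)) * \<bar>x\<bar> powr \<alpha> * indicator {-1..1} x) has_integral 1) UNIV"
    by (rule has_integral_eq[rotated]) auto
qed (use assms in auto)

lemma agree_near_0_rescale:
  assumes "agree_near_0 \<epsilon> \<nu> \<mu>" "0 < t" "t \<le> \<epsilon>" "S \<in> sets borel"
  shows "emeasure \<nu> {e. \<bar>e\<bar> \<le> t \<and> e / t \<in> S} = emeasure \<mu> {e. \<bar>e\<bar> \<le> t \<and> e / t \<in> S}"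
proof -
  have "{e. \<bar>e\<bar> \<le> t \<and> e / t \<in> S} = {e \<in> space borel. \<bar>e\<bar> \<le> t \<and> e / t \<in> S}" by simp
  also have "\<dots> \<in> sets borel" using assms(4) by measurable
  finally have "{e. \<bar>e\<bar> \<le> t \<and> e / t \<in> S} \<in> sets borel" .
  moreover have "{e. \<bar>e\<bar> \<le> t \<and> e / t \<in> S} \<subseteq> {-\<epsilon>..\<epsilon>}" using assms(3) by auto
  ultimately show ?thesis using assms(1) by (simp add: agree_near_0_def)
qed

section \<open>Percolation and thresholds under a self-similar reference law\<close>

locale self_similar_law =
  fixes \<alpha> :: real and \<mu> :: "real measure"
  assumes \<alpha>: "\<alpha> \<ge> 0" and prob_\<mu>: "prob_space \<mu>" and sets_\<mu>: "sets \<mu> = sets borel"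
    and self_similar: "self_similar_near_0 \<alpha> 1 \<mu> 1 \<mu>"
begin

definition perc :: "'n::finite itself \<Rightarrow> real \<Rightarrow> real" where
  "perc _ r = measure (PPP r \<mu> :: ((real^'n) \<times> real) set measure) {\<omega>\<in>configs. percolates 1 1 \<omega>}"

text \<open>All parameters collapse into a single effective intensity. The condition
  \<open>\<zeta> / \<beta> \<le> t\<^sub>0\<close> ensures that the marks able to occur on edges lie
  in the range where \<nu> is self-similar.\<close>

lemma measure_percolates_eq_perc:
  assumes \<rho>: "\<rho> > 0" and \<nu>: "prob_space \<nu>" "sets \<nu> = sets borel" and ss: "self_similar_near_0 \<alpha> C \<mu> t\<^sub>0 \<nu>"
    and C: "C > 0" and \<zeta>: "\<zeta> > 0" and \<beta>: "\<beta> > 0" and t: "\<zeta> / \<beta> \<le> t\<^sub>0"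
  shows "measure (PPP \<rho> \<nu> :: ((real^'n) \<times> real) set measure) {\<omega>\<in>configs. percolates \<zeta> \<beta> \<omega>}
    = perc TYPE('n) (\<rho> * \<zeta> powr (\<alpha> + 1 + real CARD('n)) / (\<beta> * C) powr (\<alpha> + 1))"
proof -
  let ?\<kappa> = "(\<zeta> / \<beta> / C) powr (\<alpha> + 1)"
  have k: "?\<kappa> > 0" using \<zeta> \<beta> C by simp
  have eq: "\<rho> * \<zeta> powr (\<alpha> + 1 + real CARD('n)) / (\<beta> * C) powr (\<alpha> + 1) = \<rho> * ?\<kappa> * \<zeta> ^ CARD('n)"
  proof -
    have "?\<kappa> = \<zeta> powr (\<alpha> + 1) / (\<beta> * C) powr (\<alpha> + 1)" using \<zeta> \<beta> C by (simp add: powr_divide)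
    moreover have "\<zeta> powr (\<alpha> + 1 + real CARD('n)) = \<zeta> powr (\<alpha> + 1) * \<zeta> ^ CARD('n)"
      using \<zeta> by (simp only: powr_add powr_realpow)
    ultimately show ?thesis by simp
  qed
  have pos: "\<rho> * ?\<kappa> * \<zeta> ^ CARD('n) > 0" using \<rho> k \<zeta> by simp
  have self: "emeasure \<nu> {e. \<bar>e\<bar> \<le> \<zeta> / \<beta> \<and> e / (\<zeta> / \<beta>) \<in> S} = ennreal ?\<kappa> * emeasure \<mu> S" if "S \<in> sets borel" for S
    using ss that t \<zeta> \<beta> unfolding self_similar_near_0_def by (elim allE[of _ "\<zeta> / \<beta>"] allE[of _ S]) simp
  show ?thesis
    unfolding perc_def eq
    by (rule measure_percolates_rescale[OF PPP_has_poisson_voids[OF \<rho> \<nu>] \<nu> PPP_has_poisson_voids[OF pos prob_\<mu> sets_\<mu>]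
          prob_\<mu> sets_\<mu> \<zeta> \<beta> less_imp_le[OF k] self refl])
qed

lemma measure_percolates_mono:
  fixes P :: "((real^'n) \<times> real) set measure"
  assumes P: "has_poisson_voids \<rho> \<nu> P" and "\<zeta> \<le> \<zeta>'" "\<beta> \<ge> 0"
  shows "measure P {\<omega>\<in>configs. percolates \<zeta> \<beta> \<omega>} \<le> measure P {\<omega>\<in>configs. percolates \<zeta>' \<beta> \<omega>}"
proof -
  interpret P: prob_space P by (rule has_poisson_voids_prob_space[OF P])
  have sP: "sets P = sets config_space" using P by (simp add: has_poisson_voids_def)
  show ?thesis
  proof (rule P.finite_measure_mono)
    show "{\<omega>\<in>configs. percolates \<zeta> \<beta> \<omega>} \<subseteq> {\<omega>\<in>configs. percolates \<zeta>' \<beta> \<omega>}"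
      using percolates_mono[OF _ subset_refl assms(2)] by blast
    show "{\<omega>\<in>configs. percolates \<zeta>' \<beta> \<omega>} \<in> sets P"
      unfolding sP by (rule percolates_measurable[OF assms(3)])
  qed
qed

text \<open>By scaling, lowering the intensity amounts to lowering \<open>\<zeta>\<close> at fixed intensity, so
  monotonicity in the intensity needs no coupling.\<close>

lemma perc_mono:
  assumes "0 < r" "r \<le> r'"
  shows "perc TYPE('n::finite) r \<le> perc TYPE('n) r'"
proof -
  define D where "D = \<alpha> + 1 + real CARD('n)"
  have D: "D > 0" using \<alpha> by (simp add: D_def add_pos_nonneg)
  \<comment> \<open>Chosen so that \<open>r' * \<zeta> powr D = r\<close>: intensity r with unit
    parameters is intensity r' with range \<zeta>.\<close>
  define \<zeta> where "\<zeta> = (r / r') powr (1 / D)"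
  have \<zeta>: "0 < \<zeta>" "\<zeta> \<le> 1" using assms D by (auto simp: \<zeta>_def powr_le1)
  have r': "r' > 0" using assms by simp
  have "r' * \<zeta> powr D = r" using assms D by (simp add: \<zeta>_def powr_powr)
  then have "perc TYPE('n) r = measure (PPP r' \<mu> :: ((real^'n) \<times> real) set measure) {\<omega>\<in>configs. percolates \<zeta> 1 \<omega>}"
    using measure_percolates_eq_perc[OF r' prob_\<mu> sets_\<mu> self_similar _ \<zeta>(1), of 1, where 'n='n] \<zeta> by (simp add: D_def)
  also have "\<dots> \<le> perc TYPE('n) r'"
    unfolding perc_def by (rule measure_percolates_mono[OF PPP_has_poisson_voids[OF r' prob_\<mu> sets_\<mu>] \<zeta>(2)]) simp
  finally show ?thesis .
qed

lemma perc_zero_one: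
  assumes "r > 0"
  shows "perc TYPE('n::finite) r = 0 \<or> perc TYPE('n) r = 1"
  unfolding perc_def
  by (rule percolates_zero_one[OF PPP_has_poisson_voids[OF assms prob_\<mu> sets_\<mu>] prob_\<mu> sets_\<mu>]) simp

lemma perc_AE:
  assumes "r > 0"
  shows "(AE \<omega> in (PPP r \<mu> :: ((real^'n) \<times> real) set measure). percolates 1 1 \<omega>) \<longleftrightarrow> perc TYPE('n) r = 1"
    and "(AE \<omega> in (PPP r \<mu> :: ((real^'n) \<times> real) set measure). \<not> percolates 1 1 \<omega>) \<longleftrightarrow> perc TYPE('n) r = 0"
proof -
  let ?P = "PPP r \<mu> :: ((real^'n) \<times> real) set measure"
  have P: "has_poisson_voids r \<mu> ?P" by (rule PPP_has_poisson_voids[OF assms prob_\<mu> sets_\<mu>])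
  interpret P: prob_space ?P by (rule has_poisson_voids_prob_space[OF P])
  have sp: "space ?P = configs" by (rule space_has_poisson_voids[OF P])
  have E: "{\<omega>\<in>space ?P. percolates 1 1 \<omega>} \<in> sets ?P"
    unfolding sp using P percolates_measurable[of 1 1] by (simp add: has_poisson_voids_def)
  show "(AE \<omega> in ?P. percolates 1 1 \<omega>) \<longleftrightarrow> perc TYPE('n) r = 1"
    using P.prob_Collect_eq_1[OF E] by (simp add: perc_def sp)
  show "(AE \<omega> in ?P. \<not> percolates 1 1 \<omega>) \<longleftrightarrow> perc TYPE('n) r = 0"
    using P.prob_Collect_eq_0[OF E] by (simp add: perc_def sp)
qed

text \<open>The threshold is the infimum of the percolating intensities. The path count bounds it
  away from 0, the hierarchical argument shows that it is an infimum over a nonempty set, and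
  monotonicity with the zero-one law gives the values on either side.\<close>

lemma perc_threshold_exists:
  assumes d: "CARD('n::finite) \<ge> 2"
  shows "\<exists>l>0. (\<forall>r>l. perc TYPE('n) r = 1) \<and> (\<forall>r. 0 < r \<longrightarrow> r < l \<longrightarrow> perc TYPE('n) r = 0)"
proof -
  define S where "S = {r. 0 < r \<and> perc TYPE('n) r = 1}"
  \<comment> \<open>This makes the ratio of the geometric bound on occupied paths equal to
    1/2.\<close>
  define r\<^sub>0 :: real where "r\<^sub>0 = 1 / (2 * 3 ^ CARD('n))"
  have r0: "r\<^sub>0 > 0" "3 ^ CARD('n) * r\<^sub>0 < 1" by (auto simp: r\<^sub>0_def)
  have p0: "perc TYPE('n) r\<^sub>0 = 0"
    unfolding perc_def
    by (rule no_percolation_small_intensity[OF PPP_has_poisson_voids[OF r0(1) prob_\<mu> sets_\<mu>] prob_\<mu> sets_\<mu> less_imp_le[OF r0(1)] r0(2)])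
  have lower: "r\<^sub>0 \<le> r" if "r \<in> S" for r
  proof (rule ccontr)
    assume "\<not> r\<^sub>0 \<le> r"
    then have "perc TYPE('n) r \<le> perc TYPE('n) r\<^sub>0" using that by (intro perc_mono) (auto simp: S_def)
    then show False using p0 that by (simp add: S_def)
  qed
  interpret \<mu>: prob_space \<mu> by (rule prob_\<mu>)
  define v where "v = (1 / (4 * real CARD('n))) ^ CARD('n) * measure \<mu> (cball 0 (1/8))"
  have v: "v > 0"
  proof -
    \<comment> \<open>Self-similarity at t = 1/8 with the full line as test set computes the mass of
      the small marks as \<open>(1/8) powr (\<alpha> + 1)\<close>, which is positive.\<close>
    have "emeasure \<mu> {e. \<bar>e\<bar> \<le> 1/8 \<and> e / (1/8) \<in> UNIV} = ennreal ((1/8 / 1) powr (\<alpha> + 1)) * emeasure \<mu> UNIV"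
      using self_similar unfolding self_similar_near_0_def by (elim allE[of _ "1/8"] allE[of _ UNIV]) simp
    moreover have "{e. \<bar>e\<bar> \<le> 1/8 \<and> e / (1/8) \<in> UNIV} = cball (0::real) (1/8)" by (auto simp: dist_real_def)
    moreover have "emeasure \<mu> UNIV = 1" using \<mu>.emeasure_space_1 sets_eq_imp_space_eq[OF sets_\<mu>] by simp
    ultimately have "emeasure \<mu> (cball 0 (1/8)) = ennreal ((1/8) powr (\<alpha> + 1))" by simp
    then have "measure \<mu> (cball 0 (1/8)) > 0" by (simp add: measure_def)
    then show ?thesis by (simp add: v_def)
  qed
  \<comment> \<open>The number 324 is 4 * 81, so that 81 times the probability of an empty box is
    exactly 1/4.\<close>
  define r\<^sub>1 where "r\<^sub>1 = ln 324 / v"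
  have r1: "r\<^sub>1 > 0" using v by (simp add: r\<^sub>1_def)
  have "exp (- r\<^sub>1 * v) = 1 / 324" using v by (simp add: r\<^sub>1_def exp_minus)
  then have "81 * exp (- r\<^sub>1 * v) \<le> 1/4" by simp
  then have "perc TYPE('n) r\<^sub>1 = 1"
    unfolding perc_def v_def
    by (rule percolation_large_intensity[OF d PPP_has_poisson_voids[OF r1 prob_\<mu> sets_\<mu>] prob_\<mu> sets_\<mu>])
  then have ne: "S \<noteq> {}" using r1 by (auto simp: S_def)
  have bdd: "bdd_below S" using lower by (auto simp: bdd_below_def)
  have "r\<^sub>0 \<le> Inf S" using ne lower by (rule cInf_greatest)
  then have "Inf S > 0" using r0(1) by simp
  moreover have "perc TYPE('n) r = 1" if r: "r > Inf S" for r
  proof -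
    obtain s where s: "s \<in> S" "s < r" using r ne bdd by (meson cInf_less_iff)
    then have "1 \<le> perc TYPE('n) r" using perc_mono[of s r, where 'n='n] by (auto simp: S_def)
    then show ?thesis using perc_zero_one[of r, where 'n='n] s by (auto simp: S_def)
  qed
  moreover have "perc TYPE('n) r = 0" if r: "0 < r" "r < Inf S" for r
  proof -
    have "r \<notin> S" using r(2) bdd cInf_lower by (meson not_le)
    then show ?thesis using perc_zero_one[OF r(1), where 'n='n] r(1) by (auto simp: S_def)
  qed
  ultimately show ?thesis by blast
qed

text \<open>Two different thresholds would leave an intensity strictly between them at which
  \<open>perc\<close> had to be both 0 and 1, so the definite description is resolved.\<close>

lemma critical_intensity_spec:
  assumes d: "CARD('n::finite) \<ge> 2"
  defines "l \<equiv> critical_intensity TYPE('n) \<mu>"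
  shows "0 < l" "\<And>r. l < r \<Longrightarrow> perc TYPE('n) r = 1" "\<And>r. 0 < r \<Longrightarrow> r < l \<Longrightarrow> perc TYPE('n) r = 0"
proof -
  obtain l' where l': "l' > 0" "\<forall>r>l'. perc TYPE('n) r = 1" "\<forall>r. 0 < r \<longrightarrow> r < l' \<longrightarrow> perc TYPE('n) r = 0"
    using perc_threshold_exists[OF d] by blast
  have "critical_intensity TYPE('n) \<mu> = l'"
    unfolding critical_intensity_def
  proof (rule the_equality)
    show "0 < l' \<and> (\<forall>r>l'. AE \<omega> in (PPP r \<mu> :: ((real^'n) \<times> real) set measure). percolates 1 1 \<omega>) \<and>
      (\<forall>r. 0 < r \<longrightarrow> r < l' \<longrightarrow> (AE \<omega> in (PPP r \<mu> :: ((real^'n) \<times> real) set measure). \<not> percolates 1 1 \<omega>))"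
      using l' perc_AE[where 'n='n] by (auto intro: less_trans)
  next
    fix m assume m: "0 < m \<and> (\<forall>r>m. AE \<omega> in (PPP r \<mu> :: ((real^'n) \<times> real) set measure). percolates 1 1 \<omega>) \<and>
      (\<forall>r. 0 < r \<longrightarrow> r < m \<longrightarrow> (AE \<omega> in (PPP r \<mu> :: ((real^'n) \<times> real) set measure). \<not> percolates 1 1 \<omega>))"
    then have m1: "perc TYPE('n) r = 1" if "r > m" for r using that perc_AE(1)[of r, where 'n='n] by (auto intro: less_trans)
    have m0: "perc TYPE('n) r = 0" if "0 < r" "r < m" for r using m that perc_AE(2)[of r, where 'n='n] by auto
    show "m = l'"
    proof (rule antisym; rule dense_ge; rule ccontr)
      fix r assume r: "l' < r" "\<not> m \<le> r"
      then have "0 < r" "perc TYPE('n) r = 1" using l'(1,2) by auto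
      then show False using m0[of r] r by simp
    next
      fix r assume r: "m < r" "\<not> l' \<le> r"
      then have "0 < r" using m by linarith
      then show False using m1[of r] l'(3) r by auto
    qed
  qed
  then show "0 < l" "\<And>r. l < r \<Longrightarrow> perc TYPE('n) r = 1" "\<And>r. 0 < r \<Longrightarrow> r < l \<Longrightarrow> perc TYPE('n) r = 0"
    using l' unfolding l_def by auto
qed

text \<open>The effective intensity \<open>F \<zeta>\<close> is strictly increasing and reaches the
  critical intensity exactly at z. The formula in terms of \<open>F\<close> is available only up to
  \<open>t\<^sub>0 * \<beta>\<close>, so z has to lie below this bound.\<close>

theorem zeta_c_eq:
  fixes \<beta> :: real
  assumes d: "CARD('n::finite) \<ge> 2" and \<rho>: "\<rho> > 0" and \<nu>: "prob_space \<nu>" "sets \<nu> = sets borel"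
    and ss: "self_similar_near_0 \<alpha> C \<mu> t\<^sub>0 \<nu>" and C: "C > 0" and \<beta>: "\<beta> > 0"
  defines "z \<equiv> (critical_intensity TYPE('n) \<mu> * (\<beta> * C) powr (\<alpha> + 1) / \<rho>) powr (1 / (\<alpha> + 1 + real CARD('n)))"
  assumes z: "z < t\<^sub>0 * \<beta>"
  shows "zeta_c TYPE('n) \<beta> \<rho> \<nu> = z"
proof -
  let ?l = "critical_intensity TYPE('n) \<mu>"
  note L = critical_intensity_spec[OF d]
  define D where "D = \<alpha> + 1 + real CARD('n)"
  have D: "D > 0" using \<alpha> by (simp add: D_def add_pos_nonneg)
  let ?P = "PPP \<rho> \<nu> :: ((real^'n) \<times> real) set measure"
  have P: "has_poisson_voids \<rho> \<nu> ?P" by (rule PPP_has_poisson_voids[OF \<rho> \<nu>])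
  interpret P: prob_space ?P by (rule has_poisson_voids_prob_space[OF P])
  have pm: "perc_prob TYPE('n) \<zeta> \<beta> \<rho> \<nu> = measure ?P {\<omega>\<in>configs. percolates \<zeta> \<beta> \<omega>}" for \<zeta>
    unfolding perc_prob_def Let_def space_has_poisson_voids[OF P] ..
  define F where "F \<zeta> = \<rho> * \<zeta> powr D / (\<beta> * C) powr (\<alpha> + 1)" for \<zeta>
  have bc: "(\<beta> * C) powr (\<alpha> + 1) > 0" using \<beta> C by simp
  have z0: "z > 0" using L(1) bc \<rho> by (simp add: z_def)
  have Fz: "F z = ?l"
    using L(1) bc \<rho> D unfolding F_def z_def D_def[symmetric] by (simp add: powr_powr)
  have F_mono: "F x < F y" if "0 \<le> x" "x < y" for x y
    unfolding F_def using that D \<rho> bc by (intro divide_strict_right_mono mult_strict_left_mono powr_less_mono2) auto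
  have pF: "perc_prob TYPE('n) \<zeta> \<beta> \<rho> \<nu> = perc TYPE('n) (F \<zeta>)" if "0 < \<zeta>" "\<zeta> \<le> t\<^sub>0 * \<beta>" for \<zeta>
    unfolding pm F_def D_def using that \<beta>
    by (intro measure_percolates_eq_perc[OF \<rho> \<nu> ss C _ \<beta>]) (auto simp: pos_divide_le_eq)
  have above: "perc_prob TYPE('n) \<zeta> \<beta> \<rho> \<nu> = 1" if "\<zeta> > z" for \<zeta>
  proof -
    \<comment> \<open>Beyond \<open>t\<^sub>0 * \<beta>\<close> the effective intensity is no longer
      at hand; percolation is established at a smaller supercritical value and transferred by
      monotonicity in the range.\<close>
    define \<zeta>' where "\<zeta>' = min \<zeta> (t\<^sub>0 * \<beta>)"
    have \<zeta>': "z < \<zeta>'" "\<zeta>' \<le> \<zeta>" "\<zeta>' \<le> t\<^sub>0 * \<beta>" using that z by (auto simp: \<zeta>'_def)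
    have "perc_prob TYPE('n) \<zeta>' \<beta> \<rho> \<nu> = 1"
      using pF[of \<zeta>'] \<zeta>' z0 L(2) F_mono[of z \<zeta>'] Fz by simp
    then have "1 \<le> perc_prob TYPE('n) \<zeta> \<beta> \<rho> \<nu>"
      using measure_percolates_mono[OF P \<zeta>'(2), of \<beta>] \<beta> unfolding pm by simp
    then show ?thesis unfolding pm using P.prob_le_1[of "{\<omega>\<in>configs. percolates \<zeta> \<beta> \<omega>}"] by linarith
  qed
  have below: "perc_prob TYPE('n) \<zeta> \<beta> \<rho> \<nu> = 0" if "0 < \<zeta>" "\<zeta> < z" for \<zeta>
  proof -
    have "F \<zeta> < ?l" using F_mono[of \<zeta> z] that Fz by simp
    moreover have "F \<zeta> > 0" using that \<rho> bc by (simp add: F_def)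
    ultimately show ?thesis using pF[of \<zeta>] that z L(3) by simp
  qed
  show ?thesis
    unfolding zeta_c_def
  proof (rule the_equality)
    show "0 < z \<and> (\<forall>\<zeta>>z. perc_prob TYPE('n) \<zeta> \<beta> \<rho> \<nu> = 1) \<and> (\<forall>\<zeta>. 0 < \<zeta> \<longrightarrow> \<zeta> < z \<longrightarrow> perc_prob TYPE('n) \<zeta> \<beta> \<rho> \<nu> = 0)"
      using z0 above below by blast
  next
    fix y assume y: "0 < y \<and> (\<forall>\<zeta>>y. perc_prob TYPE('n) \<zeta> \<beta> \<rho> \<nu> = 1) \<and> (\<forall>\<zeta>. 0 < \<zeta> \<longrightarrow> \<zeta> < y \<longrightarrow> perc_prob TYPE('n) \<zeta> \<beta> \<rho> \<nu> = 0)"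
    show "y = z"
    proof (rule antisym; rule dense_ge; rule ccontr)
      fix r assume "z < r" "\<not> y \<le> r"
      then show False using above[of r] y z0 by auto
    next
      fix r assume "y < r" "\<not> z \<le> r"
      then show False using below[of r] y by auto
    qed
  qed
qed

text \<open>The candidate threshold is a constant times \<beta> to a power below 1, so it eventually
  falls under \<open>t\<^sub>0 * \<beta>\<close> and is the true one. The powers of \<beta> then
  cancel, and the expression is eventually equal to its limit.\<close>

theorem ln_c_c_limit:
  assumes d: "CARD('n::finite) \<ge> 2" and \<rho>: "\<rho> > 0" and \<nu>: "prob_space \<nu>" "sets \<nu> = sets borel"
    and ss: "self_similar_near_0 \<alpha> C \<mu> t\<^sub>0 \<nu>" and C: "C > 0" and t0: "t\<^sub>0 > 0"
  shows "((\<lambda>\<beta>. \<beta> powr (- ((\<alpha> + 1) / (\<alpha> + 1 + real CARD('n)))) * ln (c_c TYPE('n) \<beta> \<rho> \<nu>))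
     \<longlongrightarrow> - ((critical_intensity TYPE('n) \<mu> * C powr (\<alpha> + 1) / \<rho>) powr (1 / (\<alpha> + 1 + real CARD('n))))) at_top"
proof (rule tendsto_eventually)
  let ?l = "critical_intensity TYPE('n) \<mu>"
  define D where "D = \<alpha> + 1 + real CARD('n)"
  have D: "D > 0" "\<alpha> + 1 < D" using \<alpha> by (auto simp: D_def add_pos_nonneg)
  define A where "A = (?l * C powr (\<alpha> + 1) / \<rho>) powr (1 / D)"
  have l: "?l > 0" by (rule critical_intensity_spec(1)[OF d])
  have z: "(?l * (\<beta> * C) powr (\<alpha> + 1) / \<rho>) powr (1 / D) = A * \<beta> powr ((\<alpha> + 1) / D)" if "\<beta> > 0" for \<beta>
  proof -
    have "?l * (\<beta> * C) powr (\<alpha> + 1) / \<rho> = (?l * C powr (\<alpha> + 1) / \<rho>) * \<beta> powr (\<alpha> + 1)"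
      using that C by (simp add: powr_mult)
    then show ?thesis using l C \<rho> that by (simp only: A_def powr_mult) (simp add: powr_powr powr_mult)
  qed
  have "((\<lambda>\<beta>. A * \<beta> powr ((\<alpha> + 1) / D - 1)) \<longlongrightarrow> A * 0) at_top"
    using D by (intro tendsto_mult tendsto_const tendsto_neg_powr filterlim_ident) auto
  then have "\<forall>\<^sub>F \<beta> in at_top. A * \<beta> powr ((\<alpha> + 1) / D - 1) < t\<^sub>0"
    using t0 by (auto dest!: order_tendstoD(2)[of _ _ _ t\<^sub>0])
  then show "\<forall>\<^sub>F \<beta> in at_top. \<beta> powr (- ((\<alpha> + 1) / (\<alpha> + 1 + real CARD('n)))) * ln (c_c TYPE('n) \<beta> \<rho> \<nu>)
      = - ((?l * C powr (\<alpha> + 1) / \<rho>) powr (1 / (\<alpha> + 1 + real CARD('n))))"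
    using eventually_gt_at_top[of 0]
  proof eventually_elim
    case (elim \<beta>)
    have "A * \<beta> powr ((\<alpha> + 1) / D) = A * \<beta> powr ((\<alpha> + 1) / D - 1) * \<beta>"
      using elim(2) by (simp add: powr_diff)
    also have "\<dots> < t\<^sub>0 * \<beta>" using elim by (intro mult_strict_right_mono)
    finally have "A * \<beta> powr ((\<alpha> + 1) / D) < t\<^sub>0 * \<beta>" .
    then have "zeta_c TYPE('n) \<beta> \<rho> \<nu> = A * \<beta> powr ((\<alpha> + 1) / D)"
      using zeta_c_eq[OF d \<rho> \<nu> ss C elim(2)] z[OF elim(2)] unfolding D_def by simp
    then have "ln (c_c TYPE('n) \<beta> \<rho> \<nu>) = - (A * \<beta> powr ((\<alpha> + 1) / D))" by (simp add: c_c_def)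
    moreover have "\<beta> powr (- ((\<alpha> + 1) / D)) * \<beta> powr ((\<alpha> + 1) / D) = 1"
      using elim(2) by (simp add: powr_add[symmetric])
    ultimately show ?case unfolding D_def[symmetric] A_def[symmetric] by (simp add: algebra_simps)
  qed
qed

end

text \<open>Both bounds in the minimum matter: up to \<epsilon> the law coincides with the reference
  density, and up to C that density is homogeneous.\<close>

lemma self_similar_near_0_plus:
  assumes "agree_near_0 \<epsilon> \<nu> (nu_plus C \<alpha>)"
  shows "self_similar_near_0 \<alpha> C (nu_plus 1 \<alpha>) (min \<epsilon> C) \<nu>"
  unfolding self_similar_near_0_def
proof (intro allI impI)
  fix t :: real and S :: "real set" assume t: "0 < t" "t \<le> min \<epsilon> C" and S: "S \<in> sets borel"
  then show "emeasure \<nu> {e. \<bar>e\<bar> \<le> t \<and> e / t \<in> S} = ennreal ((t / C) powr (\<alpha> + 1)) * emeasure (nu_plus 1 \<alpha>) S"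
    using agree_near_0_rescale[OF assms, of t S] nu_plus_rescale[of t C S \<alpha>] by simp
qed

lemma self_similar_law_nu_plus:
  assumes "\<alpha> \<ge> 0"
  shows "self_similar_law \<alpha> (nu_plus 1 \<alpha>)"
proof (rule self_similar_law.intro)
  show "self_similar_near_0 \<alpha> 1 (nu_plus 1 \<alpha>) 1 (nu_plus 1 \<alpha>)"
    unfolding self_similar_near_0_def using nu_plus_rescale[of _ 1 _ \<alpha>] by blast
  show "prob_space (nu_plus 1 \<alpha>)" by (rule prob_space_nu_plus[OF assms])
qed (use assms in \<open>simp_all add: nu_plus_def\<close>)

lemma self_similar_near_0_sym:
  assumes "agree_near_0 \<epsilon> \<nu> (nu_sym C \<alpha>)"
  shows "self_similar_near_0 \<alpha> C (nu_sym 1 \<alpha>) (min \<epsilon> C) \<nu>"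
  unfolding self_similar_near_0_def
proof (intro allI impI)
  fix t :: real and S :: "real set" assume t: "0 < t" "t \<le> min \<epsilon> C" and S: "S \<in> sets borel"
  then show "emeasure \<nu> {e. \<bar>e\<bar> \<le> t \<and> e / t \<in> S} = ennreal ((t / C) powr (\<alpha> + 1)) * emeasure (nu_sym 1 \<alpha>) S"
    using agree_near_0_rescale[OF assms, of t S] nu_sym_rescale[of t C S \<alpha>] by simp
qed

lemma self_similar_law_nu_sym:
  assumes "\<alpha> \<ge> 0"
  shows "self_similar_law \<alpha> (nu_sym 1 \<alpha>)"
proof (rule self_similar_law.intro)
  show "self_similar_near_0 \<alpha> 1 (nu_sym 1 \<alpha>) 1 (nu_sym 1 \<alpha>)"
    unfolding self_similar_near_0_def using nu_sym_rescale[of _ 1 _ \<alpha>] by blast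
  show "prob_space (nu_sym 1 \<alpha>)" by (rule prob_space_nu_sym[OF assms])
qed (use assms in \<open>simp_all add: nu_sym_def\<close>)

theorem corollary7p5:
  fixes \<alpha> \<rho> \<epsilon>\<^sub>\<nu> C\<^sub>\<nu> :: real and \<nu> :: "real measure"
  assumes "CARD('n::finite) \<ge> 2" and "\<alpha> \<ge> 0" and "\<rho> > 0"
    and "\<nu> \<in> V_plus \<alpha> \<union> V_sym \<alpha>"
    and "\<epsilon>\<^sub>\<nu> > 0" and "C\<^sub>\<nu> > 0"
    and "\<nu> \<in> V_plus \<alpha> \<Longrightarrow> agree_near_0 \<epsilon>\<^sub>\<nu> \<nu> (nu_plus C\<^sub>\<nu> \<alpha>)"
    and "\<nu> \<in> V_sym \<alpha> \<Longrightarrow> agree_near_0 \<epsilon>\<^sub>\<nu> \<nu> (nu_sym C\<^sub>\<nu> \<alpha>)"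
  shows "((\<lambda>\<beta>. \<beta> powr (- ((\<alpha> + 1) / (\<alpha> + 1 + real CARD('n)))) * ln (c_c TYPE('n) \<beta> \<rho> \<nu>))
     \<longlongrightarrow> - ((lambda_c_star TYPE('n) \<alpha> \<nu> * C\<^sub>\<nu> powr (\<alpha> + 1) / \<rho>)
            powr (1 / (\<alpha> + 1 + real CARD('n))))) at_top"
proof (cases "\<nu> \<in> V_plus \<alpha>")
  case True
  have \<nu>: "prob_space \<nu>" "sets \<nu> = sets borel" using True by (auto simp: V_plus_def)
  interpret self_similar_law \<alpha> "nu_plus 1 \<alpha>" by (rule self_similar_law_nu_plus[OF assms(2)])
  have "self_similar_near_0 \<alpha> C\<^sub>\<nu> (nu_plus 1 \<alpha>) (min \<epsilon>\<^sub>\<nu> C\<^sub>\<nu>) \<nu>"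
    by (rule self_similar_near_0_plus[OF assms(7)[OF True]])
  from ln_c_c_limit[OF assms(1,3) \<nu> this assms(6)] show ?thesis
    using assms(5,6) True by (simp add: lambda_c_star_def lambda_c_plus_def)
next
  case False
  then have sym: "\<nu> \<in> V_sym \<alpha>" using assms(4) by simp
  have \<nu>: "prob_space \<nu>" "sets \<nu> = sets borel" using sym by (auto simp: V_sym_def)
  interpret self_similar_law \<alpha> "nu_sym 1 \<alpha>" by (rule self_similar_law_nu_sym[OF assms(2)])
  have "self_similar_near_0 \<alpha> C\<^sub>\<nu> (nu_sym 1 \<alpha>) (min \<epsilon>\<^sub>\<nu> C\<^sub>\<nu>) \<nu>"
    by (rule self_similar_near_0_sym[OF assms(8)[OF sym]])
  from ln_c_c_limit[OF assms(1,3) \<nu> this assms(6)] show ?thesis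
    \<comment> \<open>\<open>lambda_c_star\<close> tests membership in \<open>V_plus\<close> first,
      so it takes the symmetric value precisely in this case.\<close>
    using assms(5,6) False by (simp add: lambda_c_star_def lambda_c_def)
qed

end
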